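(* If $M$ is a simple module in $\Omega^{\bar S_2}_{\mathbf 1}$, then $M$ is isomorphic (as an $\bar S_2$-module) to some simple quotient of $T(A_2^{\mathbf 1},V)$ for some finite-dimensional simple $\mathfrak{gl}_2$-module $V$.
   Context: All vector spaces and algebras are over $\mathbb C$; $\otimes=\otimes_{\mathbb C}$. $A_2=\mathbb C[t_1,t_2]$, $\partial_i=\partial/\partial t_i$, $d_i=t_i\partial_i$, $e_1,e_2$ is the standard basis of $\mathbb C^2$, $t^\alpha=t_1^{\alpha_1}t_2^{\alpha_2}$. $\bar S_2$ is the Lie algebra of polynomial vector fields $p_1\partial_1+p_2\partial_2$ ($p_i\in A_2$) with $\partial_1(p_1)+\partial_2(p_2)\in\mathbb C$. For $\alpha\in\mathbb Z_{\ge -1}^2\setminus\{(-1,-1)\}$ put $L_\alpha=(1+\alpha_2)t^{\alpha+e_1}\partial_1-(1+\alpha_1)t^{\alpha+e_2}\partial_2$; these $L_\alpha$ together with $d_2$ span $\bar S_2$. $\Omega^{\bar S_2}_{\mathbf 1}$ is the category of $\bar S_2$-modules $M$ on which $\Delta_2=\mathrm{span}\{\partial_1,\partial_2\}$ acts locally finitely, such that for every $v\in M$ and $x\in\Delta_2$ one has $(x-\phi_{\mathbf 1}(x))^kv=0$ for some $k\in\mathbb N$, where $\phi_{\mathbf 1}:\Delta_2\to\mathbb C$ is linear with $\phi_{\mathbf 1}(\partial_1)=\phi_{\mathbf 1}(\partial_2)=1$, and such that $\mathrm{Wh}_{\mathbf 1}(M)=\{v\in M:\partial_1v=\partial_2v=v\}$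 is finite-dimensional. $A_2^{\mathbf 1}$ is the module over the Weyl algebra $\mathcal D_2=\mathbb C\langle t_1,t_2,\partial_1,\partial_2\rangle$ with underlying space $A_2$ on which $t_i$ acts by multiplication by $t_i$ and $\partial_i$ acts as $\partial_i+1$. For a $\mathfrak{gl}_2$-module $V$ (with matrix units $E_{ij}$), $T(A_2^{\mathbf 1},V)=A_2^{\mathbf 1}\otimes V$ is the $\bar S_2$-module with action, for $p\in A_2^{\mathbf 1}$, $v\in V$, $$\begin{aligned} L_{\alpha}(p\otimes v)=\;&L_{\alpha}p\otimes v+(1+\alpha_1)(1+\alpha_2)t^{\alpha}p\otimes(E_{11}-E_{22})v\\&+\alpha_2(1+\alpha_2)t^{\alpha+e_1-e_2}p\otimes E_{21}v-\alpha_1(1+\alpha_1)t^{\alpha+e_2-e_1}p\otimes E_{12}v,\\ d_2(p\otimes v)=\;&d_2p\otimes v+p\otimes E_{22}v,\end{aligned}$$ where $L_\alpha p$, $d_2p$ use the $\mathcal D_2$-action on $A_2^{\mathbf 1}$ and terms with zero coefficient are omitted. *)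

theory Defs
  imports
    "HOL-Analysis.Analysis"
    "HOL-Library.Poly_Mapping"
    "HOL-Library.Product_Plus"
    "HOL-Library.Set_Algebras"
begin

section \<open>Lie algebras, their modules, and quotient modules\<close>

text \<open>
  Lie algebras and modules live on subspaces \<open>g\<close>, \<open>M\<close> of ambient complex vector spaces (types of
  class \<open>ab_group_add\<close> with an explicit scalar multiplication). Brackets and actions are total
  functions; only their values on the carriers matter.
\<close>

locale lie_algebra = vector_space gs
  for gs :: "complex \<Rightarrow> 'g::ab_group_add \<Rightarrow> 'g"
    and br :: "'g \<Rightarrow> 'g \<Rightarrow> 'g"
    and g :: "'g set" +
  assumes subspace_g: "subspace g"
    and br_closed: "x \<in> g \<Longrightarrow> y \<in> g \<Longrightarrow> br x y \<in> g"
    and br_add: "x \<in> g \<Longrightarrow> y \<in> g \<Longrightarrow> z \<in> g \<Longrightarrow> br (x + y) z = br x z + br y z"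
    and br_scale: "x \<in> g \<Longrightarrow> y \<in> g \<Longrightarrow> br (gs c x) y = gs c (br x y)"
    and br_add_right: "x \<in> g \<Longrightarrow> y \<in> g \<Longrightarrow> z \<in> g \<Longrightarrow> br x (y + z) = br x y + br x z"
    and br_scale_right: "x \<in> g \<Longrightarrow> y \<in> g \<Longrightarrow> br x (gs c y) = gs c (br x y)"
    and br_alternating: "x \<in> g \<Longrightarrow> br x x = 0"
    and br_jacobi: "x \<in> g \<Longrightarrow> y \<in> g \<Longrightarrow> z \<in> g \<Longrightarrow>
      br x (br y z) + br y (br z x) + br z (br x y) = 0"

locale lie_module = lie_algebra gs br g + V: vector_space s
  for gs :: "complex \<Rightarrow> 'g::ab_group_add \<Rightarrow> 'g"
    and br :: "'g \<Rightarrow> 'g \<Rightarrow> 'g"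
    and g :: "'g set"
    and s :: "complex \<Rightarrow> 'm::ab_group_add \<Rightarrow> 'm"
    and M :: "'m set"
    and act :: "'g \<Rightarrow> 'm \<Rightarrow> 'm" +
  assumes subspace_M: "V.subspace M"
    and act_closed: "x \<in> g \<Longrightarrow> v \<in> M \<Longrightarrow> act x v \<in> M"
    and act_add_left: "x \<in> g \<Longrightarrow> y \<in> g \<Longrightarrow> v \<in> M \<Longrightarrow> act (x + y) v = act x v + act y v"
    and act_scale_left: "x \<in> g \<Longrightarrow> v \<in> M \<Longrightarrow> act (gs c x) v = s c (act x v)"
    and act_add: "x \<in> g \<Longrightarrow> v \<in> M \<Longrightarrow> w \<in> M \<Longrightarrow> act x (v + w) = act x v + act x w"
    and act_scale: "x \<in> g \<Longrightarrow> v \<in> M \<Longrightarrow> act x (s c v) = s c (act x v)"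
    and act_bracket: "x \<in> g \<Longrightarrow> y \<in> g \<Longrightarrow> v \<in> M \<Longrightarrow>
      act (br x y) v = act x (act y v) - act y (act x v)"

definition submodule ::
  "'g set \<Rightarrow> (complex \<Rightarrow> 'm::ab_group_add \<Rightarrow> 'm) \<Rightarrow> 'm set \<Rightarrow> ('g \<Rightarrow> 'm \<Rightarrow> 'm) \<Rightarrow> 'm set \<Rightarrow> bool"
  where "submodule g s M act N \<longleftrightarrow>
    module.subspace s N \<and> N \<subseteq> M \<and> (\<forall>x\<in>g. \<forall>v\<in>N. act x v \<in> N)"

definition simple_module ::
  "'g set \<Rightarrow> (complex \<Rightarrow> 'm::ab_group_add \<Rightarrow> 'm) \<Rightarrow> 'm set \<Rightarrow> ('g \<Rightarrow> 'm \<Rightarrow> 'm) \<Rightarrow> bool"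
  where "simple_module g s M act \<longleftrightarrow>
    M \<noteq> {0} \<and> (\<forall>N. submodule g s M act N \<longrightarrow> N = {0} \<or> N = M)"

text \<open>For a subspace; the span is taken in the ambient space.\<close>
definition finite_dim :: "(complex \<Rightarrow> 'm::ab_group_add \<Rightarrow> 'm) \<Rightarrow> 'm set \<Rightarrow> bool"
  where "finite_dim s W \<longleftrightarrow> (\<exists>B. finite B \<and> module.span s B = W)"

text \<open>
  The quotient \<open>M/N\<close> is the set of cosets \<open>v + N\<close>. Its zero is \<open>N\<close> and its addition is the
  elementwise sum of sets from \<open>HOL-Library.Set_Algebras\<close>. The image of a coset under a linear
  map preserving \<open>N\<close> may be smaller than a coset, hence the \<open>+ N\<close> in the last two operations.
\<close>

definition quot :: "'m::ab_group_add set \<Rightarrow> 'm set \<Rightarrow> 'm set set"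
  where "quot M N = (\<lambda>v. v +o N) ` M"

definition quot_scale :: "(complex \<Rightarrow> 'm::ab_group_add \<Rightarrow> 'm) \<Rightarrow> 'm set \<Rightarrow> complex \<Rightarrow> 'm set \<Rightarrow> 'm set"
  where "quot_scale s N c C = s c ` C + N"

definition quot_act :: "('g \<Rightarrow> 'm::ab_group_add \<Rightarrow> 'm) \<Rightarrow> 'm set \<Rightarrow> 'g \<Rightarrow> 'm set \<Rightarrow> 'm set"
  where "quot_act act N x C = act x ` C + N"

definition quot_submodule ::
  "'g set \<Rightarrow> (complex \<Rightarrow> 'm::ab_group_add \<Rightarrow> 'm) \<Rightarrow> 'm set \<Rightarrow> ('g \<Rightarrow> 'm \<Rightarrow> 'm) \<Rightarrow> 'm set \<Rightarrow> 'm set set \<Rightarrow> bool"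
  where "quot_submodule g s M act N Q \<longleftrightarrow>
    Q \<subseteq> quot M N \<and> N \<in> Q \<and> (\<forall>C\<in>Q. \<forall>D\<in>Q. C + D \<in> Q) \<and>
    (\<forall>c. \<forall>C\<in>Q. quot_scale s N c C \<in> Q) \<and> (\<forall>x\<in>g. \<forall>C\<in>Q. quot_act act N x C \<in> Q)"

definition simple_quotient ::
  "'g set \<Rightarrow> (complex \<Rightarrow> 'm::ab_group_add \<Rightarrow> 'm) \<Rightarrow> 'm set \<Rightarrow> ('g \<Rightarrow> 'm \<Rightarrow> 'm) \<Rightarrow> 'm set \<Rightarrow> bool"
  where "simple_quotient g s M act N \<longleftrightarrow>
    submodule g s M act N \<and> quot M N \<noteq> {N} \<and>
    (\<forall>Q. quot_submodule g s M act N Q \<longrightarrow> Q = {N} \<or> Q = quot M N)"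

text \<open>\<open>f\<close> is an isomorphism of modules from \<open>M/N\<close> onto \<open>M'\<close>.\<close>
definition quotient_iso ::
  "'g set \<Rightarrow> (complex \<Rightarrow> 'm::ab_group_add \<Rightarrow> 'm) \<Rightarrow> 'm set \<Rightarrow> ('g \<Rightarrow> 'm \<Rightarrow> 'm) \<Rightarrow> 'm set \<Rightarrow>
    (complex \<Rightarrow> 'n::ab_group_add \<Rightarrow> 'n) \<Rightarrow> 'n set \<Rightarrow> ('g \<Rightarrow> 'n \<Rightarrow> 'n) \<Rightarrow> ('m set \<Rightarrow> 'n) \<Rightarrow> bool"
  where "quotient_iso g s M act N s' M' act' f \<longleftrightarrow>
    bij_betw f (quot M N) M' \<and>
    (\<forall>C\<in>quot M N. \<forall>D\<in>quot M N. f (C + D) = f C + f D) \<and>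
    (\<forall>c. \<forall>C\<in>quot M N. f (quot_scale s N c C) = s' c (f C)) \<and>
    (\<forall>x\<in>g. \<forall>C\<in>quot M N. f (quot_act act N x C) = act' x (f C))"

text \<open>The quotient operations are the ones induced on representatives.\<close>

lemma coset_ops:
  fixes s :: "complex \<Rightarrow> 'm::ab_group_add \<Rightarrow> 'm"
  assumes s: "vector_space s" and N: "submodule g s M act N" and M: "lie_module gs br g s M act"
    and v: "v \<in> M" and w: "w \<in> M"
  shows "(v +o N) + (w +o N) = (v + w) +o N"
    and "quot_scale s N c (v +o N) = s c v +o N"
    and "x \<in> g \<Longrightarrow> quot_act act N x (v +o N) = act x v +o N"
proof -
  interpret vector_space s by fact
  interpret lm: lie_module gs br g s M act by fact
  have sub: "subspace N" and NM: "N \<subseteq> M" and aN: "\<And>x n. x \<in> g \<Longrightarrow> n \<in> N \<Longrightarrow> act x n \<in> N"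
    using N by (auto simp: submodule_def)
  have key: "h ` (u +o N) + N = h u +o N"
    if "\<And>n. n \<in> N \<Longrightarrow> h (u + n) = h u + h n" "\<And>n. n \<in> N \<Longrightarrow> h n \<in> N" "h 0 = 0" for h u
  proof (intro set_eqI iffI)
    fix z assume "z \<in> h ` (u +o N) + N"
    then obtain n m where nm: "n \<in> N" "m \<in> N" "z = h (u + n) + m"
      by (auto simp: set_plus_def elt_set_plus_def)
    then have "z = h u + (h n + m)" using that by (simp add: add.assoc)
    moreover have "h n + m \<in> N" using nm that(2) subspace_add[OF sub] by blast
    ultimately show "z \<in> h u +o N" by (auto simp: elt_set_plus_def)
  next
    fix z assume "z \<in> h u +o N"
    then obtain m where m: "m \<in> N" "z = h u + m" by (auto simp: elt_set_plus_def)
    have "u \<in> u +o N" using subspace_0[OF sub] by (auto simp: elt_set_plus_def intro: bexI[of _ 0])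
    with m show "z \<in> h ` (u +o N) + N" unfolding set_plus_def by blast
  qed
  show "(v +o N) + (w +o N) = (v + w) +o N"
  proof (intro set_eqI iffI)
    fix z assume "z \<in> (v +o N) + (w +o N)"
    then obtain n m where nm: "n \<in> N" "m \<in> N" "z = v + n + (w + m)"
      by (auto simp: set_plus_def elt_set_plus_def)
    then have "z = v + w + (n + m)" "n + m \<in> N" using subspace_add[OF sub] by (simp_all add: algebra_simps)
    then show "z \<in> (v + w) +o N" by (auto simp: elt_set_plus_def)
  next
    fix z assume "z \<in> (v + w) +o N"
    then obtain m where m: "m \<in> N" "z = v + (w + m)"
      by (auto simp: elt_set_plus_def add.assoc)
    have "v \<in> v +o N" "w + m \<in> w +o N"
      using subspace_0[OF sub] m(1) by (auto simp: elt_set_plus_def intro: bexI[of _ 0])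
    with m show "z \<in> (v +o N) + (w +o N)" unfolding set_plus_def by blast
  qed
  show "quot_scale s N c (v +o N) = s c v +o N"
    unfolding quot_scale_def by (rule key) (simp_all add: scale_right_distrib subspace_scale[OF sub])
  show "quot_act act N x (v +o N) = act x v +o N" if x: "x \<in> g"
    unfolding quot_act_def
  proof (rule key)
    show "act x 0 = 0"
      using lm.act_scale[OF x subspace_0[OF lm.subspace_M], of 0] by simp
    show "act x (v + n) = act x v + act x n" if "n \<in> N" for n
      using lm.act_add[OF x v, of n] that NM by blast
    show "act x n \<in> N" if "n \<in> N" for n
      using aN[OF x that] .
  qed
qed


section \<open>Polynomials and polynomial vector fields in two variables\<close>

text \<open>\<open>t\<^sub>1\<^sup>a t\<^sub>2\<^sup>b\<close> is \<open>Poly_Mapping.single (a, b) 1\<close>; the product is the convolution product.\<close>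
type_synonym A2 = "(nat \<times> nat) \<Rightarrow>\<^sub>0 complex"

text \<open>\<open>(p\<^sub>1, p\<^sub>2)\<close> stands for \<open>p\<^sub>1\<partial>\<^sub>1 + p\<^sub>2\<partial>\<^sub>2\<close>.\<close>
type_synonym vf = "A2 \<times> A2"

text \<open>Coefficientwise scalar multiplication, where \<open>sc\<close> is that of the coefficients.\<close>
definition pm_scale :: "(complex \<Rightarrow> 'v::zero \<Rightarrow> 'v) \<Rightarrow> complex \<Rightarrow> ('a \<Rightarrow>\<^sub>0 'v) \<Rightarrow> ('a \<Rightarrow>\<^sub>0 'v)"
  where "pm_scale sc c P = Poly_Mapping.map (sc c) P"

lemma lookup_pm_scale:
  assumes "vector_space sc"
  shows "Poly_Mapping.lookup (pm_scale sc c P) k = sc c (Poly_Mapping.lookup P k)"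
proof -
  interpret vector_space sc by fact
  show ?thesis by (simp add: pm_scale_def Poly_Mapping.map.rep_eq when_def)
qed

lemma vector_space_pm_scale: "vector_space sc \<Longrightarrow> vector_space (pm_scale sc)"
  by (unfold_locales; rule poly_mapping_eqI)
     (simp_all add: lookup_pm_scale lookup_add vector_space.vector_space_assms)

lemma vector_space_mult: "vector_space ((*) :: complex \<Rightarrow> complex \<Rightarrow> complex)"
  by unfold_locales (simp_all add: algebra_simps)

abbreviation cscale :: "complex \<Rightarrow> ('a \<Rightarrow>\<^sub>0 complex) \<Rightarrow> ('a \<Rightarrow>\<^sub>0 complex)"
  where "cscale \<equiv> pm_scale (*)"

lift_definition pd1 :: "A2 \<Rightarrow> A2" is
  "\<lambda>p (a, b). of_nat (Suc a) * p (Suc a, b)"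
proof -
  fix p :: "nat \<times> nat \<Rightarrow> complex"
  assume f: "finite {k. p k \<noteq> 0}"
  have "{k. (case k of (a, b) \<Rightarrow> of_nat (Suc a) * p (Suc a, b)) \<noteq> 0}
      \<subseteq> (\<lambda>(a, b). (a - 1, b)) ` {k. p k \<noteq> 0}"
    by (force simp: image_iff)
  then show "finite {k. (case k of (a, b) \<Rightarrow> of_nat (Suc a) * p (Suc a, b)) \<noteq> 0}"
    using f finite_subset by blast
qed

lift_definition pd2 :: "A2 \<Rightarrow> A2" is
  "\<lambda>p (a, b). of_nat (Suc b) * p (a, Suc b)"
proof -
  fix p :: "nat \<times> nat \<Rightarrow> complex"
  assume f: "finite {k. p k \<noteq> 0}"
  have "{k. (case k of (a, b) \<Rightarrow> of_nat (Suc b) * p (a, Suc b)) \<noteq> 0}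
      \<subseteq> (\<lambda>(a, b). (a, b - 1)) ` {k. p k \<noteq> 0}"
    by (force simp: image_iff)
  then show "finite {k. (case k of (a, b) \<Rightarrow> of_nat (Suc b) * p (a, Suc b)) \<noteq> 0}"
    using f finite_subset by blast
qed

definition vf_scale :: "complex \<Rightarrow> vf \<Rightarrow> vf"
  where "vf_scale c X = (cscale c (fst X), cscale c (snd X))"

definition vf_apply :: "vf \<Rightarrow> A2 \<Rightarrow> A2"
  where "vf_apply X p = fst X * pd1 p + snd X * pd2 p"

definition vf_bracket :: "vf \<Rightarrow> vf \<Rightarrow> vf"
  where "vf_bracket X Y =
    (vf_apply X (fst Y) - vf_apply Y (fst X), vf_apply X (snd Y) - vf_apply Y (snd X))"

definition Sbar2 :: "vf set"
  where "Sbar2 = {X. \<exists>c. pd1 (fst X) + pd2 (snd X) = Poly_Mapping.single (0, 0) c}"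

definition D1 :: vf where "D1 = (1, 0)"
definition D2 :: vf where "D2 = (0, 1)"

text \<open>
  \<open>c t\<^sub>1\<^sup>i t\<^sub>2\<^sup>j\<close> with integer exponents. Negative exponents only ever occur below with
  coefficient \<open>0\<close>, so that the truncation by \<open>nat\<close> is harmless.
\<close>
definition cmono :: "int \<Rightarrow> int \<Rightarrow> int \<Rightarrow> A2"
  where "cmono c i j = Poly_Mapping.single (nat i, nat j) (of_int c)"

definition L :: "int \<Rightarrow> int \<Rightarrow> vf"
  where "L a1 a2 = (cmono (1 + a2) (a1 + 1) a2, - cmono (1 + a1) a1 (a2 + 1))"

definition dd2 :: vf
  where "dd2 = (0, cmono 1 0 1)"


section \<open>Basic facts about vector fields\<close>

lemma lookup_pd1 [simp]:
  "Poly_Mapping.lookup (pd1 p) (a, b) = of_nat (Suc a) * Poly_Mapping.lookup p (Suc a, b)"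
  by (simp add: pd1.rep_eq)

lemma lookup_pd2 [simp]:
  "Poly_Mapping.lookup (pd2 p) (a, b) = of_nat (Suc b) * Poly_Mapping.lookup p (a, Suc b)"
  by (simp add: pd2.rep_eq)

lemma A2_eqI:
  fixes p q :: "(nat \<times> nat) \<Rightarrow>\<^sub>0 'v::zero"
  assumes "\<And>a b. Poly_Mapping.lookup p (a, b) = Poly_Mapping.lookup q (a, b)"
  shows "p = q"
  by (rule poly_mapping_eqI) (metis assms surj_pair)

lemma pd_add: "pd1 (p + q) = pd1 p + pd1 q" "pd2 (p + q) = pd2 p + pd2 q"
  by (rule A2_eqI, simp add: lookup_add algebra_simps)+

lemma pd_zero [simp]: "pd1 0 = 0" "pd2 0 = 0"
  by (rule A2_eqI, simp)+

lemma pd_minus: "pd1 (- p) = - pd1 p" "pd2 (- p) = - pd2 p"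
  using pd_add[of p "- p"] by (simp_all add: eq_neg_iff_add_eq_0 add.commute)

lemma pd_diff: "pd1 (p - q) = pd1 p - pd1 q" "pd2 (p - q) = pd2 p - pd2 q"
  using pd_add[of p "- q"] by (simp_all add: pd_minus)

lemma pd_commute: "pd1 (pd2 p) = pd2 (pd1 p)"
  by (rule A2_eqI) simp

lemma pd1_single: "pd1 (Poly_Mapping.single (a, b) c) = Poly_Mapping.single (a - 1, b) (of_nat a * c)"
  by (cases a; rule A2_eqI; simp add: lookup_single when_def)

lemma pd2_single: "pd2 (Poly_Mapping.single (a, b) c) = Poly_Mapping.single (a, b - 1) (of_nat b * c)"
  by (cases b; rule A2_eqI; simp add: lookup_single when_def)

lemma pm_induct [case_names zero single add]:
  fixes p :: "'a \<Rightarrow>\<^sub>0 'v::ab_group_add"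
  assumes "P 0" "\<And>k c. P (Poly_Mapping.single k c)" "\<And>p q. P p \<Longrightarrow> P q \<Longrightarrow> P (p + q)"
  shows "P p"
proof (induction p rule: update_induct)
  case const
  show ?case by (rule assms(1))
next
  case (update f a b)
  have "Poly_Mapping.update a b f = f + Poly_Mapping.single a b"
    by (rule poly_mapping_eqI)
       (use update.hyps in \<open>auto simp add: lookup_add lookup_update lookup_single when_def in_keys_iff\<close>)
  then show ?case using assms(3)[OF update.IH assms(2)] by simp
qed

lemma pd_mult_single:
  "pd1 (Poly_Mapping.single (a, b) c * Poly_Mapping.single (a', b') c') =
    pd1 (Poly_Mapping.single (a, b) c) * Poly_Mapping.single (a', b') c' +
    Poly_Mapping.single (a, b) c * pd1 (Poly_Mapping.single (a', b') c')"
  "pd2 (Poly_Mapping.single (a, b) c * Poly_Mapping.single (a', b') c') =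
    pd2 (Poly_Mapping.single (a, b) c) * Poly_Mapping.single (a', b') c' +
    Poly_Mapping.single (a, b) c * pd2 (Poly_Mapping.single (a', b') c')"
  by (cases a; cases a'; simp add: mult_single pd1_single algebra_simps flip: single_add)
     (cases b; cases b'; simp add: mult_single pd2_single algebra_simps flip: single_add)

lemma pd_mult:
  "pd1 (p * q) = pd1 p * q + p * pd1 q \<and> pd2 (p * q) = pd2 p * q + p * pd2 q"
proof (induction p rule: pm_induct)
  case (single k c)
  show ?case
  proof (induction q rule: pm_induct)
    case (single l d)
    show ?case using pd_mult_single by (cases k; cases l) auto
  qed (auto simp: pd_add algebra_simps)
qed (auto simp: pd_add algebra_simps)

lemmas pd1_mult = pd_mult[THEN conjunct1]
lemmas pd2_mult = pd_mult[THEN conjunct2]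

lemma cscale_eq_mult: "cscale c (p :: A2) = Poly_Mapping.single (0, 0) c * p"
proof (induction p rule: pm_induct)
  case (single k d)
  show ?case by (cases k) (simp add: pm_scale_def mult_single)
next
  case (add p q)
  have "cscale c (p + q) = cscale c p + cscale c q"
    by (meson vector_space.vector_space_assms(1) vector_space_mult vector_space_pm_scale)
  with add show ?case by (simp add: algebra_simps)
qed (simp add: poly_mapping_eqI lookup_pm_scale[OF vector_space_mult])

lemma pd_cscale: "pd1 (cscale c p) = cscale c (pd1 p)" "pd2 (cscale c p) = cscale c (pd2 p)"
  by (rule A2_eqI, simp add: lookup_pm_scale[OF vector_space_mult])+

lemma vector_space_vf: "vector_space vf_scale"
proof -
  interpret vector_space "cscale :: complex \<Rightarrow> A2 \<Rightarrow> A2"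
    by (rule vector_space_pm_scale[OF vector_space_mult])
  show ?thesis
    by unfold_locales (auto simp: vf_scale_def scale_right_distrib scale_left_distrib)
qed

lemma pd_const [simp]: "pd1 (Poly_Mapping.single (0, 0) c) = 0" "pd2 (Poly_Mapping.single (0, 0) c) = 0"
  by (simp_all add: pd1_single pd2_single)

lemma vf_apply_diff: "vf_apply X (p - q) = vf_apply X p - vf_apply X q"
  by (simp add: vf_apply_def pd_diff algebra_simps)

lemma vf_apply_bracket:
  "vf_apply (vf_bracket X Y) p = vf_apply X (vf_apply Y p) - vf_apply Y (vf_apply X p)"
  by (simp add: vf_bracket_def vf_apply_def pd_add pd1_mult pd2_mult pd_commute algebra_simps)

lemma lie_algebra_Sbar2: "lie_algebra vf_scale vf_bracket Sbar2"
proof -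
  interpret vector_space vf_scale by (rule vector_space_vf)
  have zero: "0 \<in> Sbar2"
    unfolding Sbar2_def by (rule CollectI, rule exI[of _ 0]) simp
  have plus: "X + Y \<in> Sbar2" if XY: "X \<in> Sbar2" "Y \<in> Sbar2" for X Y
  proof -
    obtain c d where c: "pd1 (fst X) + pd2 (snd X) = Poly_Mapping.single (0, 0) c"
      and d: "pd1 (fst Y) + pd2 (snd Y) = Poly_Mapping.single (0, 0) d"
      using XY unfolding Sbar2_def by blast
    have "pd1 (fst (X + Y)) + pd2 (snd (X + Y)) =
        (pd1 (fst X) + pd2 (snd X)) + (pd1 (fst Y) + pd2 (snd Y))"
      by (simp add: pd_add)
    also have "\<dots> = Poly_Mapping.single (0, 0) (c + d)" unfolding c d by (simp add: single_add)
    finally show ?thesis unfolding Sbar2_def by blast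
  qed
  have scal: "vf_scale e X \<in> Sbar2" if X: "X \<in> Sbar2" for e X
  proof -
    obtain c where c: "pd1 (fst X) + pd2 (snd X) = Poly_Mapping.single (0, 0) c"
      using X unfolding Sbar2_def by blast
    have "pd1 (fst (vf_scale e X)) + pd2 (snd (vf_scale e X)) =
        Poly_Mapping.single (0, 0) e * (pd1 (fst X) + pd2 (snd X))"
      by (simp add: vf_scale_def cscale_eq_mult pd1_mult pd2_mult distrib_left)
    also have "\<dots> = Poly_Mapping.single (0, 0) (e * c)"
      unfolding c by (simp add: mult_single)
    finally show ?thesis unfolding Sbar2_def by blast
  qed
  have brac: "vf_bracket X Y \<in> Sbar2" if XY: "X \<in> Sbar2" "Y \<in> Sbar2" for X Y
  proof -
    obtain c d where c: "pd1 (fst X) + pd2 (snd X) = Poly_Mapping.single (0, 0) c"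
      and d: "pd1 (fst Y) + pd2 (snd Y) = Poly_Mapping.single (0, 0) d"
      using XY unfolding Sbar2_def by blast
    have "pd1 (fst (vf_bracket X Y)) + pd2 (snd (vf_bracket X Y)) =
       vf_apply X (pd1 (fst Y) + pd2 (snd Y)) - vf_apply Y (pd1 (fst X) + pd2 (snd X))"
      by (simp add: vf_bracket_def vf_apply_def pd_add pd_diff pd1_mult pd2_mult pd_commute algebra_simps)
    also have "\<dots> = Poly_Mapping.single (0, 0) 0"
      unfolding c d by (simp add: vf_apply_def)
    finally show ?thesis unfolding Sbar2_def by blast
  qed
  show ?thesis
  proof unfold_locales
    show "subspace Sbar2" by (rule subspaceI) (fact zero plus scal)+
  next
    fix x y z :: vf
    show "vf_bracket x (vf_bracket y z) + vf_bracket y (vf_bracket z x) + vf_bracket z (vf_bracket x y) = 0"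
      by (simp add: vf_bracket_def[of _ "vf_bracket _ _"] vf_apply_bracket prod_eq_iff)
         (simp add: vf_bracket_def vf_apply_diff)
  next
    fix x y z :: vf and c
    show "vf_bracket (x + y) z = vf_bracket x z + vf_bracket y z"
      "vf_bracket x (y + z) = vf_bracket x y + vf_bracket x z"
      by (simp_all add: vf_bracket_def vf_apply_def pd_add algebra_simps)
    show "vf_bracket (vf_scale c x) y = vf_scale c (vf_bracket x y)"
      "vf_bracket x (vf_scale c y) = vf_scale c (vf_bracket x y)"
      by (simp_all add: vf_bracket_def vf_apply_def vf_scale_def cscale_eq_mult pd1_mult pd2_mult algebra_simps)
    show "vf_bracket x x = 0" by (simp add: vf_bracket_def zero_prod_def)
  qed (fact brac)
qed

lemma L_in_Sbar2:
  assumes "a1 \<ge> -1" "a2 \<ge> -1"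
  shows "L a1 a2 \<in> Sbar2"
proof -
  have "pd1 (cmono (1 + a2) (a1 + 1) a2) = cmono ((1 + a1) * (1 + a2)) a1 a2"
    using assms by (cases "a1 = -1") (auto simp: cmono_def pd1_single nat_add_distrib nat_diff_distrib' algebra_simps)
  moreover have "pd2 (cmono (1 + a1) a1 (a2 + 1)) = cmono ((1 + a1) * (1 + a2)) a1 a2"
    using assms by (cases "a2 = -1") (auto simp: cmono_def pd2_single nat_add_distrib nat_diff_distrib' algebra_simps)
  ultimately show ?thesis
    by (auto simp: Sbar2_def L_def pd_minus intro!: exI[of _ 0])
qed

lemma dd2_in_Sbar2: "dd2 \<in> Sbar2"
  by (auto simp: Sbar2_def dd2_def cmono_def pd2_single intro!: exI[of _ 1])


section \<open>The category of Whittaker modules\<close>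

definition Delta2 :: "vf set"
  where "Delta2 = module.span vf_scale {D1, D2}"

text \<open>On \<open>Delta2\<close>, where both coefficients are constants, \<open>phi1 (a\<partial>\<^sub>1 + b\<partial>\<^sub>2) = a + b\<close>.\<close>
definition phi1 :: "vf \<Rightarrow> complex"
  where "phi1 X = Poly_Mapping.lookup (fst X) (0, 0) + Poly_Mapping.lookup (snd X) (0, 0)"

definition Wh1 :: "'m set \<Rightarrow> (vf \<Rightarrow> 'm \<Rightarrow> 'm) \<Rightarrow> 'm set"
  where "Wh1 M act = {v \<in> M. act D1 v = v \<and> act D2 v = v}"

text \<open>The object \<open>M\<close> lies in \<open>\<Omega>\<^sub>1\<close>. Local finiteness: each vector lies in a finite-dimensional
  \<open>Delta2\<close>-stable subspace.\<close>
definition Omega1 ::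
  "(complex \<Rightarrow> 'm::ab_group_add \<Rightarrow> 'm) \<Rightarrow> 'm set \<Rightarrow> (vf \<Rightarrow> 'm \<Rightarrow> 'm) \<Rightarrow> bool"
  where "Omega1 s M act \<longleftrightarrow>
    lie_module vf_scale vf_bracket Sbar2 s M act \<and>
    (\<forall>v\<in>M. \<exists>W. v \<in> W \<and> submodule Delta2 s M act W \<and> finite_dim s W) \<and>
    (\<forall>v\<in>M. \<forall>x\<in>Delta2. \<exists>k::nat. ((\<lambda>w. act x w - s (phi1 x) w) ^^ k) v = 0) \<and>
    finite_dim s (Wh1 M act)"


section \<open>The modules \<open>T(A\<^sub>2\<^sup>1, V)\<close>\<close>

text \<open>
  Every finite-dimensional complex vector space is isomorphic to a subspace of \<open>fvec\<close>; the
  \<open>gl\<^sub>2\<close>-modules \<open>V\<close> are taken on such subspaces.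
\<close>
type_synonym fvec = "nat \<Rightarrow>\<^sub>0 complex"

definition mat_bracket :: "complex^2^2 \<Rightarrow> complex^2^2 \<Rightarrow> complex^2^2"
  where "mat_bracket A B = A ** B - B ** A"

definition mat_scale :: "complex \<Rightarrow> complex^2^2 \<Rightarrow> complex^2^2"
  where "mat_scale c A = (\<chi> i j. c * A $ i $ j)"

definition matE :: "2 \<Rightarrow> 2 \<Rightarrow> complex^2^2"
  where "matE i j = axis i (axis j 1)"

lemma lie_algebra_gl2: "lie_algebra mat_scale mat_bracket UNIV"
proof -
  interpret vector_space mat_scale
    by unfold_locales (simp_all add: mat_scale_def vec_eq_iff algebra_simps)
  show ?thesis
    by unfold_locales
       (simp_all add: mat_scale_def mat_bracket_def vec_eq_iff matrix_matrix_mult_def sum_2 algebra_simps)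
qed

definition simple_fd_gl2_module :: "fvec set \<Rightarrow> (complex^2^2 \<Rightarrow> fvec \<Rightarrow> fvec) \<Rightarrow> bool"
  where "simple_fd_gl2_module V rho \<longleftrightarrow>
    lie_module mat_scale mat_bracket UNIV cscale V rho \<and>
    simple_module UNIV cscale V rho \<and> finite_dim cscale V"

text \<open>
  \<open>A\<^sub>2 \<otimes> V\<close> is realised as the space of polynomials with coefficients in \<open>V\<close>. That it is a
  tensor product (universal property) is proved below.
\<close>
definition T_space :: "fvec set \<Rightarrow> ((nat \<times> nat) \<Rightarrow>\<^sub>0 fvec) set"
  where "T_space V = {P. \<forall>k. Poly_Mapping.lookup P k \<in> V}"

abbreviation T_scale :: "complex \<Rightarrow> ((nat \<times> nat) \<Rightarrow>\<^sub>0 fvec) \<Rightarrow> ((nat \<times> nat) \<Rightarrow>\<^sub>0 fvec)"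
  where "T_scale \<equiv> pm_scale cscale"

definition tens :: "A2 \<Rightarrow> fvec \<Rightarrow> ((nat \<times> nat) \<Rightarrow>\<^sub>0 fvec)"  (infixl \<open>\<otimes>\<^sub>A\<close> 68)
  where "p \<otimes>\<^sub>A v = Poly_Mapping.map (\<lambda>c. cscale c v) p"

text \<open>
  Action of \<open>f\<partial>\<^sub>1 + g\<partial>\<^sub>2\<close>, as an element of the Weyl algebra, on the twisted module, where \<open>t\<^sub>i\<close>
  acts by multiplication and \<open>\<partial>\<^sub>i\<close> acts as \<open>\<partial>\<^sub>i + 1\<close>.
\<close>
definition tw_apply :: "vf \<Rightarrow> A2 \<Rightarrow> A2"
  where "tw_apply X p = fst X * (pd1 p + p) + snd X * (pd2 p + p)"

text \<open>
  \<open>act\<close> is the \<open>Sbar2\<close>-module structure of \<open>T(A\<^sub>2\<^sup>1, V)\<close>. As the \<open>L\<^sub>\<alpha>\<close> and \<open>d\<^sub>2\<close> span \<open>Sbar2\<close> and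
  the pure tensors span \<open>T_space V\<close>, these conditions determine \<open>act\<close> on the carriers.
\<close>
definition T_module ::
  "fvec set \<Rightarrow> (complex^2^2 \<Rightarrow> fvec \<Rightarrow> fvec) \<Rightarrow>
    (vf \<Rightarrow> ((nat \<times> nat) \<Rightarrow>\<^sub>0 fvec) \<Rightarrow> ((nat \<times> nat) \<Rightarrow>\<^sub>0 fvec)) \<Rightarrow> bool"
  where "T_module V rho act \<longleftrightarrow>
    lie_module vf_scale vf_bracket Sbar2 T_scale (T_space V) act \<and>
    (\<forall>a1 a2 p. \<forall>v\<in>V. a1 \<ge> -1 \<and> a2 \<ge> -1 \<and> (a1, a2) \<noteq> (-1, -1) \<longrightarrow>
      act (L a1 a2) (p \<otimes>\<^sub>A v) =
        tw_apply (L a1 a2) p \<otimes>\<^sub>A v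
        + (cmono ((1 + a1) * (1 + a2)) a1 a2 * p) \<otimes>\<^sub>A rho (matE 1 1 - matE 2 2) v
        + (cmono (a2 * (1 + a2)) (a1 + 1) (a2 - 1) * p) \<otimes>\<^sub>A rho (matE 2 1) v
        - (cmono (a1 * (1 + a1)) (a1 - 1) (a2 + 1) * p) \<otimes>\<^sub>A rho (matE 1 2) v) \<and>
    (\<forall>p. \<forall>v\<in>V. act dd2 (p \<otimes>\<^sub>A v) = tw_apply dd2 p \<otimes>\<^sub>A v + p \<otimes>\<^sub>A rho (matE 2 2) v)"

lemma lookup_tens: "Poly_Mapping.lookup (p \<otimes>\<^sub>A v) k = cscale (Poly_Mapping.lookup p k) v"
proof -
  interpret vector_space "cscale :: complex \<Rightarrow> fvec \<Rightarrow> fvec"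
    by (rule vector_space_pm_scale[OF vector_space_mult])
  show ?thesis by (simp add: tens_def Poly_Mapping.map.rep_eq when_def)
qed

lemma tens_bilinear:
  "(p + q) \<otimes>\<^sub>A v = p \<otimes>\<^sub>A v + q \<otimes>\<^sub>A v" "p \<otimes>\<^sub>A (v + w) = p \<otimes>\<^sub>A v + p \<otimes>\<^sub>A w"
  "cscale c p \<otimes>\<^sub>A v = T_scale c (p \<otimes>\<^sub>A v)" "p \<otimes>\<^sub>A cscale c v = T_scale c (p \<otimes>\<^sub>A v)"
proof -
  have vs: "vector_space (cscale :: complex \<Rightarrow> fvec \<Rightarrow> fvec)"
    by (rule vector_space_pm_scale[OF vector_space_mult])
  interpret vector_space "cscale :: complex \<Rightarrow> fvec \<Rightarrow> fvec" by fact
  note [simp] = lookup_tens lookup_add lookup_pm_scale[OF vs] lookup_pm_scale[OF vector_space_mult]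
  show "(p + q) \<otimes>\<^sub>A v = p \<otimes>\<^sub>A v + q \<otimes>\<^sub>A v" by (rule poly_mapping_eqI) (simp add: scale_left_distrib)
  show "p \<otimes>\<^sub>A (v + w) = p \<otimes>\<^sub>A v + p \<otimes>\<^sub>A w" by (rule A2_eqI) (simp add: scale_right_distrib)
  show "cscale c p \<otimes>\<^sub>A v = T_scale c (p \<otimes>\<^sub>A v)" by (rule A2_eqI) simp
  show "p \<otimes>\<^sub>A cscale c v = T_scale c (p \<otimes>\<^sub>A v)" by (rule A2_eqI) (simp add: mult.commute)
qed

lemma tens_universal:
  fixes sW :: "complex \<Rightarrow> 'w::ab_group_add \<Rightarrow> 'w" and f :: "A2 \<Rightarrow> fvec \<Rightarrow> 'w"
  assumes V: "module.subspace cscale V" and W: "vector_space sW"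
    and f: "\<And>p q v. v \<in> V \<Longrightarrow> f (p + q) v = f p v + f q v"
      "\<And>p v w. v \<in> V \<Longrightarrow> w \<in> V \<Longrightarrow> f p (v + w) = f p v + f p w"
      "\<And>c p v. v \<in> V \<Longrightarrow> f (cscale c p) v = sW c (f p v)"
      "\<And>c p v. v \<in> V \<Longrightarrow> f p (cscale c v) = sW c (f p v)"
  defines "lin \<equiv> \<lambda>h. (\<forall>P\<in>T_space V. \<forall>Q\<in>T_space V. h (P + Q) = h P + h Q) \<and>
      (\<forall>c. \<forall>P\<in>T_space V. h (T_scale c P) = sW c (h P)) \<and>
      (\<forall>p. \<forall>v\<in>V. h (p \<otimes>\<^sub>A v) = f p v)"
  shows "\<exists>h. lin h \<and> (\<forall>h'. lin h' \<longrightarrow> (\<forall>P\<in>T_space V. h' P = h P))"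
proof -
  have vs: "vector_space (cscale :: complex \<Rightarrow> fvec \<Rightarrow> fvec)"
    by (rule vector_space_pm_scale[OF vector_space_mult])
  interpret F: vector_space "cscale :: complex \<Rightarrow> fvec \<Rightarrow> fvec" by fact
  interpret W: vector_space sW by fact
  let ?m = "\<lambda>k. Poly_Mapping.single k (1::complex)"
  define h where "h P = (\<Sum>k\<in>Poly_Mapping.keys P. f (?m k) (Poly_Mapping.lookup P k))" for P
  have f0: "f p 0 = 0" for p using f(4)[where v=0 and c=0 and p=p] F.subspace_0[OF V] by simp
  have f0': "f 0 v = 0" if "v \<in> V" for v using f(1)[where v=v and p=0 and q=0] that by simp
  have h_alt: "h P = (\<Sum>k\<in>K. f (?m k) (Poly_Mapping.lookup P k))"
    if "finite K" "Poly_Mapping.keys P \<subseteq> K" for P K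
    unfolding h_def by (rule sum.mono_neutral_left) (use that f0 in \<open>auto simp: in_keys_iff\<close>)
  have TV: "Poly_Mapping.lookup P k \<in> V" if "P \<in> T_space V" for P k
    using that unfolding T_space_def by blast
  have tV: "p \<otimes>\<^sub>A v \<in> T_space V" if "v \<in> V" for p v
    using that F.subspace_scale[OF V] by (simp add: T_space_def lookup_tens)
  have aV: "P + Q \<in> T_space V" if "P \<in> T_space V" "Q \<in> T_space V" for P Q
    using that F.subspace_add[OF V] by (simp add: T_space_def lookup_add)
  have h_add: "h (P + Q) = h P + h Q" if PQ: "P \<in> T_space V" "Q \<in> T_space V" for P Q
  proof -
    let ?K = "Poly_Mapping.keys P \<union> Poly_Mapping.keys Q"
    have "Poly_Mapping.keys (P + Q) \<subseteq> ?K" by (rule Poly_Mapping.keys_add)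
    then show ?thesis
      using PQ TV by (simp add: h_alt[of ?K] lookup_add f(2) sum.distrib)
  qed
  have h_scale: "h (T_scale c P) = sW c (h P)" if P: "P \<in> T_space V" for c P
  proof -
    have "Poly_Mapping.keys (T_scale c P) \<subseteq> Poly_Mapping.keys P"
      by (auto simp: in_keys_iff lookup_pm_scale[OF vs])
    then show ?thesis
      using P TV by (simp add: h_alt[of "Poly_Mapping.keys P"] lookup_pm_scale[OF vs] f(4) W.scale_sum_right)
  qed
  have h_tens: "h (p \<otimes>\<^sub>A v) = f p v" if v: "v \<in> V" for p v
  proof (induction p rule: pm_induct)
    case zero
    have "0 \<otimes>\<^sub>A v = 0" by (rule poly_mapping_eqI) (simp add: lookup_tens)
    then show ?case using f0'[OF v] by (simp add: h_def)
  next
    case (single k c)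
    have "Poly_Mapping.keys (Poly_Mapping.single k c \<otimes>\<^sub>A v) \<subseteq> {k}"
      by (auto simp: in_keys_iff lookup_tens lookup_single when_def split: if_splits)
    then have "h (Poly_Mapping.single k c \<otimes>\<^sub>A v) = f (?m k) (cscale c v)"
      by (simp add: h_alt[of "{k}"] lookup_tens)
    also have "\<dots> = f (cscale c (?m k)) v" using v by (simp add: f)
    also have "cscale c (?m k) = Poly_Mapping.single k c" by (simp add: pm_scale_def)
    finally show ?case .
  next
    case (add p q)
    then show ?case using v tV by (simp add: tens_bilinear h_add f)
  qed
  have lin: "lin h" using h_add h_scale h_tens by (simp add: lin_def)
  have "h' P = h P" if h': "lin h'" and P: "P \<in> T_space V" for h' P
  proof -
    have "P \<in> T_space V \<Longrightarrow> h' P = h P"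
    proof (induction P rule: update_induct)
      case const
      have "h' (0 \<otimes>\<^sub>A 0) = h (0 \<otimes>\<^sub>A 0)"
        using h' lin F.subspace_0[OF V] by (simp add: lin_def)
      moreover have "0 \<otimes>\<^sub>A 0 = 0"
        by (rule poly_mapping_eqI) (simp add: lookup_tens)
      ultimately show ?case by simp
    next
      case (update P a b)
      have *: "Poly_Mapping.update a b P = P + ?m a \<otimes>\<^sub>A b"
        by (rule poly_mapping_eqI)
           (use update in \<open>auto simp: lookup_add lookup_update lookup_tens lookup_single when_def in_keys_iff\<close>)
      have b: "b \<in> V" using update.prems by (metis TV lookup_update)
      have "Poly_Mapping.lookup P k \<in> V" for k
        using TV[OF update.prems, of k] update.hyps F.subspace_0[OF V]
        by (cases "k = a") (auto simp: lookup_update in_keys_iff)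
      then have P: "P \<in> T_space V" by (simp add: T_space_def)
      have "h' (P + ?m a \<otimes>\<^sub>A b) = h' P + f (?m a) b" "h (P + ?m a \<otimes>\<^sub>A b) = h P + f (?m a) b"
        using h' lin P b tV by (simp_all add: lin_def)
      then show ?case using * update.IH P by simp
    qed
    then show ?thesis using P by simp
  qed
  with lin show ?thesis by blast
qed

end

theory Submission
  imports Defs "HOL-Computational_Algebra.Fundamental_Theorem_Algebra"
begin

text \<open>
  Let \<open>H\<^sub>f = (\<partial>\<^sub>2f)\<partial>\<^sub>1 - (\<partial>\<^sub>1f)\<partial>\<^sub>2\<close> be the Hamiltonian vector field of a polynomial \<open>f\<close>. The
  fields \<open>H\<^sub>f\<close> and \<open>d\<^sub>2\<close> span the Lie algebra, and \<open>[X, H\<^sub>f] = H\<^sub>g\<close> with \<open>g = X(f) - div(X) f\<close>, so on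
  a module \<open>M\<close> the pairing \<open>f \<otimes> m \<mapsto> H\<^sub>f m\<close> is a homomorphism from \<open>A\<^sub>2 \<otimes> M\<close>, with a divergence twist on
  \<open>A\<^sub>2\<close>. This is a cover of \<open>M\<close> by a module on which \<open>A\<^sub>2\<close> acts as well.

  Write \<open>y\<^sub>i = \<partial>\<^sub>i - 1\<close>, which is locally nilpotent on \<open>M\<close>. The automorphism
  \<open>exp(-t\<^sub>1y\<^sub>1 - t\<^sub>2y\<^sub>2)\<close> of \<open>A\<^sub>2 \<otimes> M\<close> straightens the action of \<open>\<partial>\<^sub>1, \<partial>\<^sub>2\<close>: composing it with the pairing
  gives \<open>psi m a b\<close>, the image of \<open>t\<^sub>1\<^sup>at\<^sub>2\<^sup>b \<otimes> m\<close>, and in these coordinates a vector field acts on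
  \<open>t\<^sub>1\<^sup>at\<^sub>2\<^sup>b \<otimes> m\<close> as in a tensor module \<open>T(A\<^sub>2\<^sup>1, \<dots>)\<close> in which the fields vanishing at the origin act on
  the second factor. The second factor may be replaced by the quotient of \<open>M\<close> by the kernel of
  \<open>m \<mapsto> psi m\<close>, a subspace that is stable under the fields vanishing at the origin.

  The heart of the matter is that this kernel has finite codimension (\<open>finite_codim_kernel\<close>). Since \<open>M\<close> is
  generated by its finite-dimensional space of Whittaker vectors under \<open>d\<^sub>1, d\<^sub>2\<close>, it is enough that a power
  of \<open>t\<^sub>2\<partial>\<^sub>1\<close> maps Whittaker vectors into the kernel (\<open>X1_nilpotent_mod_kernel\<close>),
  and likewise for \<open>t\<^sub>1\<partial>\<^sub>2\<close>. This is an eigenvalue argument: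
  \<open>t\<^sub>2(\<partial>\<^sub>1 - \<partial>\<^sub>2)\<close> preserves the Whittaker vectors, so it has finitely many eigenvalues there, whereas a
  nonzero coefficient of \<open>psi\<close> on the \<open>k\<close>-th power would produce two eigenvalues whose difference is a
  natural number at least \<open>k - 1\<close>.

  In the finite-dimensional quotient, fields of degree one raise the eigenvalue of the Euler field
  \<open>d\<^sub>1 + d\<^sub>2\<close>, so they kill some nonzero vectors; these form a subspace stable under the linear fields, which
  contains a simple \<open>gl\<^sub>2\<close>-module \<open>V\<close> (\<open>gl2_simple\<close>). There only the first Taylor coefficients of a field survive
  and \<open>psi\<close> becomes a homomorphism \<open>T(A\<^sub>2\<^sup>1, V) \<rightarrow> M\<close>. It suffices to verify this on generators of the
  Lie algebra (\<open>Sbar2_generated\<close>), for which one-variable Taylor expansions are enough. The homomorphism is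
  nonzero, hence onto by simplicity of \<open>M\<close>, and \<open>M\<close> is the quotient by its kernel.
\<close>

section \<open>Linear maps, annihilating polynomials and eigenvectors\<close>

lemma vector_space_cscale: "vector_space (cscale :: complex \<Rightarrow> ('a \<Rightarrow>\<^sub>0 complex) \<Rightarrow> _)"
  by (rule vector_space_pm_scale[OF vector_space_mult])

lemma lookup_cscale [simp]: "Poly_Mapping.lookup (cscale c p) k = c * Poly_Mapping.lookup p k"
  by (rule lookup_pm_scale[OF vector_space_mult])

definition op_poly :: "(complex \<Rightarrow> 'm::ab_group_add \<Rightarrow> 'm) \<Rightarrow> ('m \<Rightarrow> 'm) \<Rightarrow> complex poly \<Rightarrow> 'm \<Rightarrow> 'm"
  where "op_poly s T p u = (\<Sum>i\<le>degree p. s (coeff p i) ((T ^^ i) u))"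

definition lin :: "(complex \<Rightarrow> 'm::ab_group_add \<Rightarrow> 'm) \<Rightarrow> (complex \<Rightarrow> 'n::ab_group_add \<Rightarrow> 'n) \<Rightarrow> ('m \<Rightarrow> 'n) \<Rightarrow> bool"
  where "lin s t f \<longleftrightarrow> (\<forall>u v. f (u + v) = f u + f v) \<and> (\<forall>c u. f (s c u) = t c (f u))"

abbreviation endo :: "(complex \<Rightarrow> 'm::ab_group_add \<Rightarrow> 'm) \<Rightarrow> ('m \<Rightarrow> 'm) \<Rightarrow> bool"
  where "endo s \<equiv> lin s s"

locale cvs = vector_space scale for scale :: "complex \<Rightarrow> 'm::ab_group_add \<Rightarrow> 'm"

lemma linI:
  assumes "\<And>u v. f (u + v) = f u + f v" "\<And>c u. f (s c u) = t c (f u)"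
  shows "lin s t f"
  using assms by (auto simp: lin_def)

lemma lin_add: "lin s t f \<Longrightarrow> f (u + v) = f u + f v"
  and lin_scale: "lin s t f \<Longrightarrow> f (s c u) = t c (f u)"
  by (auto simp: lin_def)

lemma lin_0: "lin s t f \<Longrightarrow> f 0 = 0"
  using lin_add[of s t f 0 0] by simp

lemma lin_minus: "lin s t f \<Longrightarrow> f (- u) = - f u"
  using lin_add[of s t f u "- u"] by (simp add: lin_0 eq_neg_iff_add_eq_0 add.commute)

lemma lin_diff: "lin s t f \<Longrightarrow> f (u - v) = f u - f v"
  using lin_add[of s t f u "- v"] by (simp add: lin_minus)

lemma lin_sum: "lin s t f \<Longrightarrow> f (sum g K) = (\<Sum>k\<in>K. f (g k))"
  by (induction K rule: infinite_finite_induct) (simp_all add: lin_0 lin_add)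

lemma lin_compose: "endo s S \<Longrightarrow> endo s T \<Longrightarrow> endo s (\<lambda>u. S (T u))"
  by (simp add: lin_def)

lemma lin_funpow: "endo s T \<Longrightarrow> endo s (T ^^ n)"
  by (induction n) (simp_all add: lin_def)

lemma funpow_0_mono:
  assumes "endo s T" "(T ^^ m) u = (0::'m::ab_group_add)" "m \<le> n"
  shows "(T ^^ n) u = 0"
proof -
  have "(T ^^ n) u = (T ^^ (n - m)) ((T ^^ m) u)"
    using assms(3) by (simp flip: funpow_add[THEN fun_cong, unfolded comp_def])
  then show ?thesis using assms(2) lin_0[OF lin_funpow[OF assms(1)]] by simp
qed

context cvs
begin

lemma op_poly_bound: "degree p \<le> n \<Longrightarrow> op_poly scale T p u = (\<Sum>i\<le>n. scale (coeff p i) ((T ^^ i) u))"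
  unfolding op_poly_def by (rule sum.mono_neutral_left) (auto simp: coeff_eq_0)

lemma op_poly_add: "op_poly scale T (p + q) u = op_poly scale T p u + op_poly scale T q u"
proof -
  let ?n = "max (degree p) (degree q)"
  have "op_poly scale T (p + q) u = (\<Sum>i\<le>?n. scale (coeff (p + q) i) ((T ^^ i) u))"
    by (rule op_poly_bound) (rule degree_add_le_max)
  also have "\<dots> = (\<Sum>i\<le>?n. scale (coeff p i) ((T ^^ i) u)) + (\<Sum>i\<le>?n. scale (coeff q i) ((T ^^ i) u))"
    by (simp add: scale_left_distrib sum.distrib)
  also have "\<dots> = op_poly scale T p u + op_poly scale T q u"
    using op_poly_bound[of p ?n T u] op_poly_bound[of q ?n T u] by simp
  finally show ?thesis .
qed

lemma op_poly_smult: "op_poly scale T (smult c p) u = scale c (op_poly scale T p u)"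
  using op_poly_bound[of "smult c p" "degree p" T u]
  by (simp add: op_poly_def scale_sum_right degree_smult_le)

lemma endo_op_poly:
  assumes "endo scale T"
  shows "endo scale (op_poly scale T p)"
proof (rule linI)
  note T = lin_funpow[OF assms]
  show "op_poly scale T p (u + v) = op_poly scale T p u + op_poly scale T p v" for u v
    unfolding op_poly_def lin_add[OF T] scale_right_distrib sum.distrib ..
  show "op_poly scale T p (scale c u) = scale c (op_poly scale T p u)" for c u
    unfolding op_poly_def lin_scale[OF T] scale_sum_right by (rule sum.cong) (simp_all add: mult.commute)
qed

lemma op_poly_pCons:
  assumes "endo scale T"
  shows "op_poly scale T (pCons a p) u = scale a u + T (op_poly scale T p u)"
proof -
  have "op_poly scale T (pCons a p) u = (\<Sum>i\<le>Suc (degree p). scale (coeff (pCons a p) i) ((T ^^ i) u))"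
    by (rule op_poly_bound) (simp add: degree_pCons_le)
  also have "\<dots> = scale a u + (\<Sum>i\<le>degree p. scale (coeff p i) (T ((T ^^ i) u)))"
    by (subst sum.atMost_Suc_shift) simp
  finally show ?thesis
    by (simp add: op_poly_def lin_sum[OF assms] lin_scale[OF assms])
qed

lemma op_poly_0 [simp]: "op_poly scale T 0 u = 0"
  by (simp add: op_poly_def)

lemma op_poly_mult:
  assumes T: "endo scale T"
  shows "op_poly scale T (p * q) u = op_poly scale T p (op_poly scale T q u)"
proof (induction p)
  case (pCons a p)
  then show ?case
    by (simp add: op_poly_add op_poly_smult op_poly_pCons[OF T])
qed simp

lemma op_poly_linear:
  assumes "endo scale T"
  shows "op_poly scale T [:- c, 1:] u = T u - scale c u"
  using op_poly_pCons[OF assms, of "-c" 1 u] op_poly_pCons[OF assms, of 1 0 u] lin_0[OF assms]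
  by (simp add: one_pCons)

lemma op_poly_in_subspace:
  assumes "subspace U" "\<And>u. u \<in> U \<Longrightarrow> T u \<in> U" "u \<in> U"
  shows "op_poly scale T p u \<in> U"
proof -
  have "(T ^^ i) u \<in> U" for i by (induction i) (use assms in auto)
  then show ?thesis unfolding op_poly_def by (intro subspace_sum subspace_scale assms(1))
qed

text \<open>
  The hypothesis concerns a single orbit, so that \<open>f\<close> may intertwine \<open>T\<close> with a different operator of which
  \<open>f w\<close> is an eigenvector.
\<close>

lemma op_poly_eigen:
  assumes "\<And>i. f ((T ^^ i) w) = scale (c ^ i) (f w)" "f 0 = 0" "\<And>u v. f (u + v) = f u + f v"
    "\<And>c u. f (scale c u) = scale c (f u)"
  shows "f (op_poly scale T p w) = scale (poly p c) (f w)"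
proof -
  have "f (sum g A) = (\<Sum>a\<in>A. f (g a))" if "finite A" for g :: "nat \<Rightarrow> 'm" and A
    using that by (induction A) (simp_all add: assms)
  then show ?thesis
    by (simp add: op_poly_def assms poly_altdef scale_sum_left)
qed

text \<open>
  In a space spanned by \<open>n\<close> vectors the \<open>n + 1\<close> vectors \<open>u, Tu, \<dots>, T\<^sup>nu\<close> are dependent; a repetition among
  them has to be treated separately, because dependence is a property of sets.
\<close>

lemma annihilating_poly_vector:
  assumes fin: "finite B" and U: "\<And>i. (T ^^ i) u \<in> span B"
  shows "\<exists>p. p \<noteq> 0 \<and> op_poly scale T p u = 0"
proof (cases "inj_on (\<lambda>i. (T ^^ i) u) {..card B}")
  case True
  let ?S = "(\<lambda>i. (T ^^ i) u) ` {..card B}"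
  have "card ?S = Suc (card B)" using card_image[OF True] by simp
  then have "dependent ?S"
    using independent_span_bound[OF fin, of ?S] U by fastforce
  then obtain c v where c: "(\<Sum>v\<in>?S. scale (c v) v) = 0" "v \<in> ?S" "c v \<noteq> 0"
    by (auto simp: dependent_finite)
  let ?p = "Abs_poly (\<lambda>i. if i \<le> card B then c ((T ^^ i) u) else 0)"
  have co: "coeff ?p i = (if i \<le> card B then c ((T ^^ i) u) else 0)" for i
    by (simp add: coeff_Abs_poly_If_le)
  have "?p \<noteq> 0" using c(2,3) co by (metis (no_types, lifting) atMost_iff coeff_0 imageE)
  moreover have "degree ?p \<le> card B" by (rule degree_le) (simp add: co)
  then have "op_poly scale T ?p u = (\<Sum>i\<le>card B. scale (c ((T ^^ i) u)) ((T ^^ i) u))"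
    using op_poly_bound co by simp
  then have "op_poly scale T ?p u = 0"
    using c(1) by (simp add: sum.reindex[OF True])
  ultimately show ?thesis by blast
next
  case False
  then obtain i j where ij: "i \<noteq> j" "(T ^^ i) u = (T ^^ j) u" by (auto simp: inj_on_def)
  have m: "op_poly scale T (monom 1 k) u = (T ^^ k) u" for k
    using op_poly_bound[of "monom 1 k" k T u] by (simp add: degree_monom_le if_distrib[of "\<lambda>c. scale c _"] cong: if_cong)
  have "op_poly scale T (monom 1 i + smult (-1) (monom 1 j)) u = 0"
    by (simp only: op_poly_add op_poly_smult m ij) simp
  moreover have "monom 1 i + smult (-1) (monom 1 j) \<noteq> (0::complex poly)"
  proof
    assume "monom 1 i + smult (-1) (monom 1 j) = (0::complex poly)"
    from arg_cong[OF this, of "\<lambda>p. coeff p i"] show False using ij by simp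
  qed
  ultimately show ?thesis by blast
qed

text \<open>
  The product of annihilating polynomials of the spanning vectors works, because polynomials in one
  operator commute.
\<close>

lemma annihilating_poly:
  assumes T: "endo scale T" and fin: "finite B" and U: "\<And>u. u \<in> span B \<Longrightarrow> T u \<in> span B"
  shows "\<exists>p. p \<noteq> 0 \<and> (\<forall>u\<in>span B. op_poly scale T p u = 0)"
proof -
  have pw: "(T ^^ i) u \<in> span B" if "u \<in> span B" for i u by (induction i) (use that U in auto)
  have "finite C \<Longrightarrow> C \<subseteq> span B \<Longrightarrow> \<exists>p. p \<noteq> 0 \<and> (\<forall>u\<in>C. op_poly scale T p u = 0)" for C
  proof (induction C rule: finite_induct)
    case empty
    have "(1::complex poly) \<noteq> 0" by (rule one_neq_zero)
    then show ?case by blast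
  next
    case (insert b C)
    have b: "b \<in> span B" and C: "C \<subseteq> span B" using insert.prems by blast+
    obtain p where p: "p \<noteq> 0" "\<forall>u\<in>C. op_poly scale T p u = 0"
      using insert.IH[OF C] by blast
    obtain q where q: "q \<noteq> 0" "op_poly scale T q b = 0"
      using annihilating_poly_vector[OF fin pw[OF b]] by blast
    have "op_poly scale T (p * q) b = 0"
      unfolding op_poly_mult[OF T] q(2) by (rule lin_0[OF endo_op_poly[OF T]])
    moreover have "op_poly scale T (p * q) u = 0" if "u \<in> C" for u
      unfolding mult.commute[of p q] op_poly_mult[OF T] using p(2) that lin_0[OF endo_op_poly[OF T]] by simp
    ultimately have "\<forall>u\<in>insert b C. op_poly scale T (p * q) u = 0" by blast
    moreover have "p * q \<noteq> 0" using p(1) q(1) by simp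
    ultimately show ?case by blast
  qed
  from this[OF fin span_superset] obtain p where p: "p \<noteq> 0" "\<forall>u\<in>B. op_poly scale T p u = 0"
    by blast
  have "op_poly scale T p u = 0" if "u \<in> span B" for u
    using that
  proof (induction rule: span_induct_alt)
    case base
    show ?case by (rule lin_0[OF endo_op_poly[OF T]])
  next
    case (step c x y)
    then show ?case
      using p(2) by (simp add: lin_add[OF endo_op_poly[OF T]] lin_scale[OF endo_op_poly[OF T]])
  qed
  with p(1) show ?thesis by blast
qed

text \<open>
  Split a linear factor \<open>x - c\<close> off \<open>p\<close>: either the cofactor already kills \<open>u\<close>, or its value at \<open>u\<close>
  is an eigenvector for \<open>c\<close>.
\<close>

lemma eigenvector_exists:
  assumes T: "endo scale T" and U: "subspace U" "\<And>u. u \<in> U \<Longrightarrow> T u \<in> U"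
    and u: "u \<in> U" "u \<noteq> 0" and p: "p \<noteq> 0" "op_poly scale T p u = 0"
  shows "\<exists>c w. w \<in> U \<and> w \<noteq> 0 \<and> T w = scale c w"
  using u p
proof (induction "degree p" arbitrary: p u rule: less_induct)
  case less
  show ?case
  proof (cases "degree p = 0")
    case True
    then obtain a where "p = [:a:]" by (metis degree_eq_zeroE)
    then have False using less.prems op_poly_pCons[OF T, of a 0 u] lin_0[OF T] by simp
    then show ?thesis ..
  next
    case False
    then obtain c where "poly p c = 0"
      using fundamental_theorem_of_algebra constant_degree by metis
    then obtain q where q: "p = [:- c, 1:] * q" by (metis poly_eq_0_iff_dvd dvdE)
    have q0: "q \<noteq> 0" using q less.prems by auto
    then have dq: "degree q < degree p" unfolding q by (subst degree_mult_eq) auto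
    let ?w = "op_poly scale T q u"
    have w: "?w \<in> U" by (rule op_poly_in_subspace) (use U less.prems in auto)
    have "op_poly scale T ([:- c, 1:] * q) u = 0" using less.prems(4) q by simp
    then have ev: "T ?w = scale c ?w"
      unfolding op_poly_mult[OF T] op_poly_linear[OF T] by simp
    show ?thesis
    proof (cases "?w = 0")
      case True
      show ?thesis by (rule less.hyps[OF dq less.prems(1,2) q0 True])
    next
      case False
      with w ev show ?thesis by blast
    qed
  qed
qed

lemma eigenvalue_root:
  assumes T: "endo scale T" and w: "T w = scale c w" "w \<noteq> 0" "op_poly scale T p w = 0"
  shows "poly p c = 0"
proof -
  have "(T ^^ i) w = scale (c ^ i) w" for i
    by (induction i) (simp_all add: w lin_scale[OF T] mult.commute)
  then have "op_poly scale T p w = scale (poly p c) w"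
    using op_poly_eigen[of id T w c p] by simp
  with w show ?thesis by simp
qed

end

section \<open>Descent along a locally nilpotent operator, and coordinates on a quotient\<close>

text \<open>
  The commutation relation \<open>[y, d] = y + 1\<close> is that of \<open>y = \<partial> - 1\<close> and \<open>d = t\<partial>\<close>. Up to terms of lower
  degree in \<open>d\<close>, \<open>y\<close> acts on \<open>d\<^sup>nk\<close> with \<open>yk = 0\<close> as differentiation with respect to \<open>d\<close>; hence \<open>y\<close> maps the span of
  all \<open>d\<^sup>nk\<close> onto itself, and induction on the nilpotency degree lifts any \<open>u\<close> from \<open>yu\<close>.
\<close>

lemma (in cvs) span_descent:
  assumes d: "endo scale d" and y: "endo scale y" and comm: "\<And>u. y (d u) = d (y u) + y u + u"
    and K: "subspace K" "\<And>u. u \<in> K \<Longrightarrow> d u \<in> K" "\<And>u. u \<in> K \<Longrightarrow> y u \<in> K"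
    and nil: "\<And>u. u \<in> K \<Longrightarrow> \<exists>n. (y ^^ n) u = 0"
  shows "K \<subseteq> span (\<Union>n. (d ^^ n) ` {u \<in> K. y u = 0})"
proof -
  define K0 where "K0 = {u \<in> K. y u = 0}"
  define D where "D n = span (\<Union>i<n. (d ^^ i) ` K0)" for n
  have D_mono: "D m \<subseteq> D n" if "m \<le> n" for m n
    unfolding D_def by (rule span_mono) (use that in force)
  have D_pow: "(d ^^ i) k \<in> D n" if "i < n" "k \<in> K0" for i k n
    unfolding D_def by (rule span_base) (use that in auto)
  have D_sub: "subspace (D n)" for n unfolding D_def by (rule subspace_span)
  have D_d: "d l \<in> D (Suc n)" if "l \<in> D n" for l n
    using that unfolding D_def
  proof (induction rule: span_induct_alt)
    case base
    show ?case using lin_0[OF d] span_zero by simp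
  next
    case (step c v w)
    then obtain i k where "i < n" "k \<in> K0" "v = (d ^^ i) k" by auto
    then have "d v \<in> D (Suc n)" using D_pow[of "Suc i" "Suc n" k] by simp
    then show ?case
      using step unfolding D_def[symmetric] lin_add[OF d] lin_scale[OF d]
      by (meson D_sub subspace_add subspace_scale)
  qed
  \<comment> \<open>\<open>y\<close> differentiates \<open>d\<^sup>n\<^sup>+\<^sup>1k\<close> up to lower order\<close>
  have top: "y ((d ^^ Suc n) k) - scale (of_nat (Suc n)) ((d ^^ n) k) \<in> D n" if "k \<in> K0" for n k
  proof (induction n)
    case 0
    have "y k = 0" using that by (simp add: K0_def)
    then show ?case using comm[of k] lin_0[OF d] subspace_0[OF D_sub] by simp
  next
    case (Suc n)
    define l where "l = y ((d ^^ Suc n) k) - scale (of_nat (Suc n)) ((d ^^ n) k)"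
    have l: "l \<in> D n" using Suc l_def by simp
    have yd: "y ((d ^^ Suc n) k) = scale (of_nat (Suc n)) ((d ^^ n) k) + l" by (simp add: l_def)
    have "y ((d ^^ Suc (Suc n)) k) - scale (of_nat (Suc (Suc n))) ((d ^^ Suc n) k)
        = d l + (scale (of_nat (Suc n)) ((d ^^ n) k) + l)"
    proof -
      have s2: "scale (of_nat (Suc (Suc n))) v = scale (of_nat (Suc n)) v + v" for v
        using scale_left_distrib[of "of_nat (Suc n)" 1 v] by (simp add: add.commute)
      have "y ((d ^^ Suc (Suc n)) k) = d (y ((d ^^ Suc n) k)) + y ((d ^^ Suc n) k) + (d ^^ Suc n) k"
        using comm[of "(d ^^ Suc n) k"] by simp
      then show ?thesis
        unfolding yd s2 by (simp add: lin_add[OF d] lin_scale[OF d] algebra_simps del: of_nat_Suc)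
    qed
    also have "\<dots> \<in> D (Suc n)"
      using D_d[OF l] D_pow[of n "Suc n" k] that D_mono[of n "Suc n"] l
      by (intro subspace_add[OF D_sub] subspace_scale[OF D_sub]) auto
    finally show ?case .
  qed
  \<comment> \<open>inverting the leading terms degree by degree\<close>
  have surj: "D n \<subseteq> y ` D (Suc n)" for n
  proof (induction n)
    case 0
    have "D 0 = {0}" by (simp add: D_def)
    then show ?case using lin_0[OF y] subspace_0[OF D_sub] by (auto simp: image_iff intro!: bexI[of _ 0])
  next
    case (Suc n)
    have sub: "subspace (y ` D (Suc (Suc n)))"
    proof (rule subspaceI)
      show "0 \<in> y ` D (Suc (Suc n))"
        using lin_0[OF y] subspace_0[OF D_sub] by (auto simp: image_iff intro!: bexI[of _ 0])
    next
      fix u v assume "u \<in> y ` D (Suc (Suc n))" "v \<in> y ` D (Suc (Suc n))"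
      then show "u + v \<in> y ` D (Suc (Suc n))"
        using subspace_add[OF D_sub] by (auto simp flip: lin_add[OF y])
    next
      fix c u assume "u \<in> y ` D (Suc (Suc n))"
      then show "scale c u \<in> y ` D (Suc (Suc n))"
        using subspace_scale[OF D_sub] by (auto simp flip: lin_scale[OF y])
    qed
    have "(d ^^ i) k \<in> y ` D (Suc (Suc n))" if k: "k \<in> K0" and i: "i < Suc n" for i k
    proof (cases "i < n")
      case True
      then have "(d ^^ i) k \<in> y ` D (Suc n)" using Suc D_pow k by blast
      then show ?thesis using D_mono[of "Suc n" "Suc (Suc n)"] by auto
    next
      case False
      with i have i: "i = n" by simp
      define l where "l = y ((d ^^ Suc n) k) - scale (of_nat (Suc n)) ((d ^^ n) k)"
      have "l \<in> y ` D (Suc n)" using top[OF k, of n] Suc by (auto simp: l_def)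
      then have l: "l \<in> y ` D (Suc (Suc n))" using D_mono[of "Suc n" "Suc (Suc n)"] by auto
      have m: "y ((d ^^ Suc n) k) \<in> y ` D (Suc (Suc n))" by (rule imageI) (rule D_pow[OF _ k], simp)
      have "(d ^^ n) k = scale (1 / of_nat (Suc n)) (y ((d ^^ Suc n) k) - l)"
        using of_nat_neq_0[of n, where ?'a = complex] by (simp add: l_def del: of_nat_Suc)
      then show ?thesis unfolding i by (rule ssubst) (rule subspace_scale[OF sub subspace_diff[OF sub m l]])
    qed
    then have "span (\<Union>i<Suc n. (d ^^ i) ` K0) \<subseteq> y ` D (Suc (Suc n))"
      by (intro span_minimal sub) auto
    then show ?case by (simp add: D_def)
  qed
  have DK: "D n \<subseteq> K" for n
  proof -
    have "(d ^^ i) k \<in> K" if "k \<in> K0" for i k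
      by (induction i) (use that K in \<open>auto simp: K0_def\<close>)
    then show ?thesis unfolding D_def by (intro span_minimal K) auto
  qed
  have "\<exists>n. u \<in> D n" if "u \<in> K" "(y ^^ m) u = 0" for m u
    using that
  proof (induction m arbitrary: u)
    case 0
    then show ?case using subspace_0[OF D_sub] by auto
  next
    case (Suc m)
    then have "(y ^^ m) (y u) = 0" by (simp add: funpow_swap1)
    then obtain n where "y u \<in> D n" using Suc.IH[of "y u"] K(3) Suc.prems(1) by blast
    then obtain u' where u': "u' \<in> D (Suc n)" "y u = y u'" using surj by blast
    then have "u - u' \<in> K0"
      using DK Suc.prems subspace_diff[OF K(1)] by (auto simp: K0_def lin_diff[OF y])
    then have "u - u' \<in> D (Suc n)" using D_pow[of 0 "Suc n" "u - u'"] by simp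
    then have "u' + (u - u') \<in> D (Suc n)" using u' subspace_add[OF D_sub] by blast
    then show ?case by auto
  qed
  moreover have "D n \<subseteq> span (\<Union>n. (d ^^ n) ` K0)" for n
    unfolding D_def by (rule span_mono) auto
  ultimately show ?thesis using nil unfolding K0_def[symmetric] by blast
qed

text \<open>
  Coordinates with respect to a basis of \<open>N\<close> extended by finitely many vectors identify the quotient by \<open>N\<close>
  with a subspace of \<open>fvec\<close>; \<open>\<sigma>\<close> is a linear section of \<open>\<kappa>\<close>.
\<close>

lemma (in cvs) quotient_coordinates:
  assumes N: "subspace N" and S: "finite S" "span (N \<union> S) = UNIV"
  shows "\<exists>(\<kappa> :: 'm \<Rightarrow> fvec) \<sigma>. lin scale cscale \<kappa> \<and> lin cscale scale \<sigma> \<and> (\<forall>m. \<kappa> m = 0 \<longleftrightarrow> m \<in> N) \<and>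
    (\<forall>m. \<kappa> (\<sigma> (\<kappa> m)) = \<kappa> m) \<and> finite_dim cscale (range \<kappa>)"
proof -
  interpret F: vector_space "cscale :: complex \<Rightarrow> fvec \<Rightarrow> fvec" by (rule vector_space_cscale)
  obtain A where A: "A \<subseteq> N" "independent A" "N \<subseteq> span A"
    using maximal_independent_subset by blast
  obtain B where B: "A \<subseteq> B" "B \<subseteq> N \<union> S" "independent B" "N \<union> S \<subseteq> span B"
    using maximal_independent_subset_extend[of A "N \<union> S"] A by blast
  have sB: "span B = UNIV" using B(4) S(2) by (metis span_mono span_span top.extremum_uniqueI)
  have "B - A \<subseteq> S"
  proof
    fix b assume b: "b \<in> B - A"
    have "b \<notin> N"
    proof
      assume "b \<in> N"
      then have "b \<in> span (B - {b})" using A(3) span_mono[of A "B - {b}"] b B(1) by blast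
      then show False using B(3) b by (auto simp: dependent_def)
    qed
    then show "b \<in> S" using b B(2) by blast
  qed
  then have finC: "finite (B - A)" using S(1) finite_subset by blast
  define r where "r = card (B - A)"
  obtain e where e: "bij_betw e {..<r} (B - A)"
    using ex_bij_betw_nat_finite[OF finC] by (auto simp: r_def atLeast0LessThan)
  have eB: "e i \<in> B" "e i \<notin> A" if "i < r" for i using e that by (auto simp: bij_betw_def)
  define \<kappa> where "\<kappa> m = (\<Sum>i<r. Poly_Mapping.single i (representation B m (e i)))" for m
  define \<sigma> where "\<sigma> v = (\<Sum>i<r. scale (Poly_Mapping.lookup v i) (e i))" for v :: fvec
  have lk: "Poly_Mapping.lookup (\<kappa> m) i = (if i < r then representation B m (e i) else 0)" for m i
    by (simp add: \<kappa>_def lookup_sum lookup_single when_def)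
  have l1: "lin scale cscale \<kappa>" unfolding lin_def
    by (auto intro!: poly_mapping_eqI simp: lk lookup_add representation_add[OF B(3)] representation_scale[OF B(3)] sB)
  have l2: "lin cscale scale \<sigma>" unfolding lin_def
    by (auto simp: \<sigma>_def lookup_add scale_left_distrib sum.distrib scale_sum_right)
  have ker: "\<kappa> m = 0 \<longleftrightarrow> m \<in> N" for m
  proof
    assume "\<kappa> m = 0"
    then have z: "representation B m (e i) = 0" if "i < r" for i
      using lk[of m i] that by simp
    have "b \<in> A" if "representation B m b \<noteq> 0" for b
    proof (rule ccontr)
      assume "b \<notin> A"
      then have "b \<in> B - A" using representation_ne_zero[OF that] by blast
      then obtain i where "i < r" "b = e i" using e by (auto simp: bij_betw_def)
      then show False using z that by blast
    qed
    then have "(\<Sum>b | representation B m b \<noteq> 0. scale (representation B m b) b) \<in> N"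
      using A(1) by (intro subspace_sum[OF N] subspace_scale[OF N]) auto
    then show "m \<in> N" using sum_nonzero_representation_eq[OF B(3)] sB by simp
  next
    assume "m \<in> N"
    then have "representation B m = representation A m"
      using A(3) representation_extend[OF B(3) _ B(1)] by blast
    then show "\<kappa> m = 0"
      using eB representation_ne_zero[of A m] by (intro poly_mapping_eqI) (auto simp: lk)
  qed
  have ks: "\<kappa> (\<sigma> v) = v" if "\<And>i. i \<ge> r \<Longrightarrow> Poly_Mapping.lookup v i = 0" for v
  proof (rule poly_mapping_eqI)
    fix j
    show "Poly_Mapping.lookup (\<kappa> (\<sigma> v)) j = Poly_Mapping.lookup v j"
    proof (cases "j < r")
      case True
      have "representation B (\<sigma> v) (e j) = (\<Sum>i<r. Poly_Mapping.lookup v i * representation B (e i) (e j))"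
        unfolding \<sigma>_def by (simp add: representation_sum[OF B(3)] representation_scale[OF B(3)] sB)
      also have "\<dots> = (\<Sum>i<r. if i = j then Poly_Mapping.lookup v i else 0)"
      proof (rule sum.cong[OF refl])
        fix i assume i: "i \<in> {..<r}"
        have "e i = e j \<longleftrightarrow> i = j" using e i True by (auto simp: bij_betw_def inj_on_def)
        then show "Poly_Mapping.lookup v i * representation B (e i) (e j) = (if i = j then Poly_Mapping.lookup v i else 0)"
          using i eB by (auto simp: representation_basis[OF B(3)])
      qed
      finally show ?thesis using True by (simp add: lk)
    next
      case False
      then show ?thesis using that by (simp add: lk)
    qed
  qed
  have fd: "finite_dim cscale (range \<kappa>)"
    unfolding finite_dim_def
  proof (intro exI conjI)
    show "finite ((\<lambda>i. Poly_Mapping.single i (1::complex)) ` {..<r})" by simp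
    have sub: "F.subspace (range \<kappa>)"
      by (rule F.subspaceI) (auto simp flip: lin_add[OF l1] lin_scale[OF l1] lin_0[OF l1])
    have "Poly_Mapping.single i 1 \<in> range \<kappa>" if "i < r" for i
      using ks[of "Poly_Mapping.single i 1"] that by (metis lookup_single_not_eq not_less rangeI)
    then have "F.span ((\<lambda>i. Poly_Mapping.single i 1) ` {..<r}) \<subseteq> range \<kappa>"
      by (intro F.span_minimal sub) auto
    moreover have "\<kappa> m \<in> F.span ((\<lambda>i. Poly_Mapping.single i 1) ` {..<r})" for m
    proof -
      have s: "Poly_Mapping.single i c = cscale c (Poly_Mapping.single i 1)" for c :: complex and i :: nat
        by (rule poly_mapping_eqI) (simp add: lookup_single when_def)
      have "Poly_Mapping.single i (representation B m (e i)) \<in> F.span ((\<lambda>i. Poly_Mapping.single i 1) ` {..<r})" if "i < r" for i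
        by (subst s) (rule F.span_scale, rule F.span_base, use that in auto)
      then show ?thesis unfolding \<kappa>_def by (intro F.span_sum) auto
    qed
    ultimately show "F.span ((\<lambda>i. Poly_Mapping.single i 1) ` {..<r}) = range \<kappa>" by blast
  qed
  have "\<kappa> (\<sigma> (\<kappa> m)) = \<kappa> m" for m by (rule ks) (simp add: lk)
  with l1 l2 ker fd show ?thesis by blast
qed

lemma (in vector_space) dim_psubspace_less:
  assumes V: "finite B" "V \<subseteq> span B" and U: "subspace U" "U \<subset> V"
  shows "dim U < dim V"
proof -
  obtain C where C: "C \<subseteq> U" "independent C" "U \<subseteq> span C" using maximal_independent_subset by blast
  then obtain D where D: "C \<subseteq> D" "D \<subseteq> V" "independent D" "V \<subseteq> span D"
    using maximal_independent_subset_extend[of C V] U(2) by blast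
  have finD: "finite D" using independent_span_bound[OF V(1) D(3)] D(2) V(2) by blast
  have "C \<noteq> D"
  proof
    assume "C = D"
    then have "V \<subseteq> U" using D(4) span_minimal[OF C(1) U(1)] by blast
    then show False using U(2) by blast
  qed
  then have "card C < card D" using D(1) finD by (meson psubsetI psubset_card_mono)
  then show ?thesis
    using dim_unique[OF C(1,3,2)] dim_unique[OF D(2,4,3)] by simp
qed

lemma (in vector_space) subspace_finite_dim:
  assumes V: "finite B" "V \<subseteq> span B" and U: "subspace U" "U \<subseteq> V"
  shows "\<exists>C. finite C \<and> span C = U"
proof -
  obtain C where C: "C \<subseteq> U" "independent C" "U \<subseteq> span C" using maximal_independent_subset by blast
  have "finite C" using independent_span_bound[OF V(1) C(2)] C(1) U(2) V(2) by blast
  then show ?thesis using C span_minimal[OF C(1) U(1)] by blast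
qed

section \<open>Hamiltonian modules and the exponential functional\<close>

text \<open>
  The coefficients of \<open>exp(-x)\<close>.
\<close>

definition cc :: "nat \<Rightarrow> complex" where "cc n = (-1) ^ n / fact n"

lemma cc_Suc: "cc (Suc n) * of_nat (Suc n) = - cc n"
proof -
  have "(1 + of_nat n :: complex) \<noteq> 0" by (metis of_nat_Suc of_nat_neq_0)
  then show ?thesis by (simp add: cc_def divide_simps)
qed

lemma cc_0 [simp]: "cc 0 = 1" by (simp add: cc_def)

text \<open>
  The operator \<open>h a b\<close> stands for the Hamiltonian field of \<open>t\<^sub>1\<^sup>at\<^sub>2\<^sup>b\<close>. In particular \<open>h 0 1 = \<partial>\<^sub>1\<close>,
  \<open>h 1 0 = - \<partial>\<^sub>2\<close>, and \<open>h 1 1 = d\<^sub>1 - d\<^sub>2\<close>. Working with operators makes the symmetry between the two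
  variables available: exchanging them turns \<open>h a b\<close> into \<open>- h b a\<close> and \<open>d\<^sub>2\<close> into \<open>d\<^sub>1\<close>.
\<close>

locale ham_module = cvs scale for scale :: "complex \<Rightarrow> 'm::ab_group_add \<Rightarrow> 'm" +
  fixes h :: "nat \<Rightarrow> nat \<Rightarrow> 'm \<Rightarrow> 'm" and d2 :: "'m \<Rightarrow> 'm"
  assumes endo_h: "endo scale (h a b)"
    and endo_d2: "endo scale d2"
    and h_zero: "h 0 0 m = 0"
    and h_comm: "h a b (h c d m) = h c d (h a b m)
      + scale (of_nat (b * c) - of_nat (a * d)) (h (a + c - 1) (b + d - 1) m)"
    and d2_comm: "d2 (h a b m) = h a b (d2 m) + scale (of_nat b - 1) (h a b m)"
    and nilpotent1: "\<exists>n. ((\<lambda>u. h 0 1 u - u) ^^ n) m = 0"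
    and nilpotent2: "\<exists>n. ((\<lambda>u. - h 1 0 u - u) ^^ n) m = 0"
    and whittaker_finite: "\<exists>B. finite B \<and> span B = {m. h 0 1 m = m \<and> h 1 0 m = - m}"
begin

definition y1 :: "'m \<Rightarrow> 'm" where "y1 u = h 0 1 u - u"
definition y2 :: "'m \<Rightarrow> 'm" where "y2 u = - h 1 0 u - u"

text \<open>
  The field \<open>t\<^sub>2\<^sup>n\<partial>\<^sub>1\<close>.
\<close>

definition X :: "nat \<Rightarrow> 'm \<Rightarrow> 'm" where "X n u = scale (1 / of_nat (Suc n)) (h 0 (Suc n) u)"
definition d1 :: "'m \<Rightarrow> 'm" where "d1 u = d2 u + h 1 1 u"

lemmas hs = lin_add[OF endo_h] lin_scale[OF endo_h] lin_0[OF endo_h] lin_minus[OF endo_h]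
  lin_diff[OF endo_h] lin_sum[OF endo_h]
lemmas d2s = lin_add[OF endo_d2] lin_scale[OF endo_d2] lin_0[OF endo_d2] lin_minus[OF endo_d2]
  lin_diff[OF endo_d2] lin_sum[OF endo_d2]

lemma endo_y1: "endo scale y1"
  by (rule linI) (simp_all add: y1_def hs scale_right_diff_distrib)
lemma endo_y2: "endo scale y2"
  by (rule linI) (simp_all add: y2_def hs scale_right_diff_distrib)
lemma endo_X: "endo scale (X n)"
  by (rule linI) (simp_all add: X_def hs scale_right_distrib mult.commute)
lemma endo_d1: "endo scale d1"
  by (rule linI) (simp_all add: d1_def hs d2s scale_right_distrib)

lemma y1_y2: "y1 (y2 u) = y2 (y1 u)"
  using h_comm[of 0 1 1 0 u] by (simp add: y1_def y2_def hs h_zero)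

lemma y1_X: "y1 (X n u) = X n (y1 u)"
  using h_comm[of 0 1 0 "Suc n" u] by (simp add: y1_def X_def hs scale_right_diff_distrib)

lemma y2_X: "y2 (X n u) = X n (y2 u) + scale (of_nat n) (X (n - 1) u)"
proof (cases n)
  case 0
  then show ?thesis
    using h_comm[of 1 0 0 1 u] by (simp add: y2_def X_def hs h_zero)
next
  case (Suc k)
  have "scale (1 / of_nat (Suc n)) (h 1 0 (h 0 (Suc n) u)) =
      scale (1 / of_nat (Suc n)) (h 0 (Suc n) (h 1 0 u)) - h 0 n u"
    unfolding h_comm[of 1 0 0 "Suc n" u]
    by (simp add: scale_right_diff_distrib scale_right_distrib del: of_nat_Suc)
  then show ?thesis
    using Suc of_nat_neq_0[of k, where ?'a = complex] by (simp add: y2_def X_def hs scale_right_diff_distrib del: of_nat_Suc)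
qed

lemma X_h: "X n (h a b u) = h a b (X n u) + scale (of_nat a) (h (a - 1) (b + n) u)"
proof -
  have *: "1 / of_nat (Suc n) * of_nat (Suc n * a) = (of_nat a :: complex)"
    using of_nat_neq_0[of n, where ?'a = complex] unfolding of_nat_mult by (simp del: of_nat_Suc)
  have "X n (h a b u) = h a b (X n u) + scale (1 / of_nat (Suc n) * of_nat (Suc n * a)) (h (a - 1) (b + n) u)"
    unfolding X_def h_comm[of 0 "Suc n" a b u]
    by (simp add: hs scale_right_distrib add.commute del: of_nat_Suc)
  then show ?thesis unfolding * .
qed

lemma y1_d2: "y1 (d2 u) = d2 (y1 u)"
  using d2_comm[of 0 1 u] by (simp add: y1_def d2s)

lemma y2_d2: "y2 (d2 u) = d2 (y2 u) - h 1 0 u"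
  using d2_comm[of 1 0 u] by (simp add: y2_def d2s)

lemma y1_y2_pow: "y1 ((y2 ^^ j) u) = (y2 ^^ j) (y1 u)"
  by (induction j) (simp_all add: y1_y2)

lemma y1_pow_y2_pow: "(y1 ^^ i) ((y2 ^^ j) u) = (y2 ^^ j) ((y1 ^^ i) u)"
  by (induction i) (simp_all add: y1_y2_pow)

text \<open>
  A truncation of \<open>\<Sum> (-1)\<^sup>i\<^sup>+\<^sup>j/(i!j!) K i j (y\<^sub>1\<^sup>iy\<^sub>2\<^sup>ju)\<close>, the functional \<open>K\<close> applied to \<open>exp(-t\<^sub>1y\<^sub>1 - t\<^sub>2y\<^sub>2)u\<close>
  where \<open>K i j\<close> is the coefficient functional at \<open>t\<^sub>1\<^sup>it\<^sub>2\<^sup>j\<close>. All truncations past the nilpotency degree agree, which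
  makes the full sum \<open>gpsi\<close> additive.
\<close>

definition psum :: "(nat \<Rightarrow> nat \<Rightarrow> 'm \<Rightarrow> 'm) \<Rightarrow> nat \<Rightarrow> nat \<Rightarrow> 'm \<Rightarrow> 'm"
  where "psum K N N' u = (\<Sum>i<N. \<Sum>j<N'. scale (cc i * cc j) (K i j ((y1 ^^ i) ((y2 ^^ j) u))))"

definition killed :: "nat \<Rightarrow> 'm \<Rightarrow> bool"
  where "killed N u \<longleftrightarrow> (y1 ^^ N) u = 0 \<and> (y2 ^^ N) u = 0"

definition gpsi :: "(nat \<Rightarrow> nat \<Rightarrow> 'm \<Rightarrow> 'm) \<Rightarrow> 'm \<Rightarrow> 'm"
  where "gpsi K u = (let N = (LEAST N. killed N u) in psum K N N u)"

lemma killed_mono: "killed N u \<Longrightarrow> N \<le> N' \<Longrightarrow> killed N' u"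
  by (auto simp: killed_def intro: funpow_0_mono[OF endo_y1] funpow_0_mono[OF endo_y2])

lemma ex_killed: "\<exists>N. killed N u"
proof -
  obtain n where "(y1 ^^ n) u = 0" using nilpotent1[of u] unfolding y1_def[abs_def] by blast
  moreover obtain n' where "(y2 ^^ n') u = 0" using nilpotent2[of u] unfolding y2_def[abs_def] by blast
  ultimately have "killed (max n n') u"
    by (auto simp: killed_def intro: funpow_0_mono[OF endo_y1] funpow_0_mono[OF endo_y2])
  then show ?thesis ..
qed

lemma ex_killed_list: "\<exists>N. \<forall>u\<in>set us. killed N u"
proof (induction us)
  case (Cons u us)
  then obtain N where N: "\<forall>u\<in>set us. killed N u" by blast
  obtain N' where "killed N' u" using ex_killed by blast
  with N have "\<forall>v\<in>set (u # us). killed (max N N') v"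
    by (auto intro: killed_mono)
  then show ?case by blast
qed simp

abbreviation endoK :: "(nat \<Rightarrow> nat \<Rightarrow> 'm \<Rightarrow> 'm) \<Rightarrow> bool"
  where "endoK K \<equiv> \<forall>i j. endo scale (K i j)"

lemma psum_mono:
  assumes K: "endoK K" and u: "(y1 ^^ N) u = 0" "(y2 ^^ N') u = 0" and le: "N \<le> M" "N' \<le> M'"
  shows "psum K M M' u = psum K N N' u"
proof -
  have 1: "(y1 ^^ i) ((y2 ^^ j) u) = 0" if "i \<ge> N" for i j
    using funpow_0_mono[OF endo_y1 u(1) that] lin_0[OF lin_funpow[OF endo_y2]] by (simp add: y1_pow_y2_pow)
  have 2: "(y1 ^^ i) ((y2 ^^ j) u) = 0" if "j \<ge> N'" for i j
    using funpow_0_mono[OF endo_y2 u(2) that] lin_0[OF lin_funpow[OF endo_y1]] by simp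
  have K0: "K i j 0 = 0" for i j using K lin_0 by blast
  have "psum K M M' u = (\<Sum>i<N. \<Sum>j<M'. scale (cc i * cc j) (K i j ((y1 ^^ i) ((y2 ^^ j) u))))"
    unfolding psum_def by (rule sum.mono_neutral_right) (use le in \<open>auto simp: 1 K0\<close>)
  also have "\<dots> = psum K N N' u"
    unfolding psum_def
    by (rule sum.cong[OF refl], rule sum.mono_neutral_right) (use le in \<open>auto simp: 2 K0\<close>)
  finally show ?thesis .
qed

lemma gpsi_eq:
  assumes K: "endoK K" and u: "(y1 ^^ N) u = 0" "(y2 ^^ N') u = 0"
  shows "gpsi K u = psum K N N' u"
proof -
  let ?L = "LEAST N. killed N u"
  have L: "killed ?L u" using ex_killed by (rule LeastI_ex)
  then have "psum K (max ?L N) (max ?L N') u = psum K ?L ?L u"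
    by (intro psum_mono K) (auto simp: killed_def)
  moreover have "psum K (max ?L N) (max ?L N') u = psum K N N' u"
    by (intro psum_mono K u) auto
  ultimately show ?thesis by (simp add: gpsi_def Let_def)
qed

lemma gpsi_eq': "endoK K \<Longrightarrow> killed N u \<Longrightarrow> gpsi K u = psum K N N u"
  by (rule gpsi_eq) (simp_all add: killed_def)

lemma endo_gpsi:
  assumes K: "endoK K"
  shows "endo scale (gpsi K)"
proof -
  have e: "endo scale (psum K N N')" for N N'
  proof (rule linI)
    have E: "endo scale (\<lambda>u. K i j ((y1 ^^ i) ((y2 ^^ j) u)))" for i j
      by (rule lin_compose[OF K[rule_format] lin_compose[OF lin_funpow[OF endo_y1] lin_funpow[OF endo_y2]]])
    show "psum K N N' (u + v) = psum K N N' u + psum K N N' v" for u v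
      unfolding psum_def lin_add[OF E] scale_right_distrib sum.distrib ..
    show "psum K N N' (scale c u) = scale c (psum K N N' u)" for c u
      unfolding psum_def lin_scale[OF E] scale_sum_right by (simp add: mult.commute)
  qed
  show ?thesis
  proof (rule linI)
    fix u v c
    obtain N where N: "killed N u" "killed N v" "killed N (u + v)" "killed N (scale c u)"
      using ex_killed_list[of "[u, v, u + v, scale c u]"] by auto
    show "gpsi K (u + v) = gpsi K u + gpsi K v" "gpsi K (scale c u) = scale c (gpsi K u)"
      using N by (simp_all add: gpsi_eq'[OF K] lin_add[OF e] lin_scale[OF e])
  qed
qed

lemma gpsi_add_fun:
  assumes "endoK K" "endoK K'"
  shows "gpsi (\<lambda>i j u. K i j u + K' i j u) m = gpsi K m + gpsi K' m"
proof -
  obtain N where N: "killed N m" using ex_killed by blast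
  have "endoK (\<lambda>i j u. K i j u + K' i j u)"
    using assms by (auto simp: lin_def scale_right_distrib)
  then show ?thesis
    using N assms by (simp add: gpsi_eq' psum_def scale_right_distrib sum.distrib)
qed

lemma gpsi_scale_fun:
  assumes "endoK K"
  shows "gpsi (\<lambda>i j u. scale c (K i j u)) m = scale c (gpsi K m)"
proof -
  obtain N where N: "killed N m" using ex_killed by blast
  have "endoK (\<lambda>i j u. scale c (K i j u))"
    using assms by (auto simp: lin_def scale_right_distrib mult.commute)
  then show ?thesis
    using N assms by (simp add: gpsi_eq' psum_def scale_sum_right mult.commute mult.left_commute)
qed

lemma gpsi_zero_fun: "gpsi (\<lambda>i j u. 0) m = 0"
  by (simp add: gpsi_def psum_def)

lemma cc_shift: "(\<Sum>j<Suc N. scale (cc j * of_nat j) (g j)) = - (\<Sum>j<N. scale (cc j) (g (Suc j)))"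
  by (simp only: sum.lessThan_Suc_shift cc_Suc) (simp add: sum_negf)

text \<open>
  Differentiating the exponential with respect to \<open>t\<^sub>1\<close> brings down the factor \<open>- y\<^sub>1\<close>.
\<close>

lemma gpsi_index1:
  assumes K: "endoK K"
  shows "gpsi (\<lambda>i j u. scale (of_nat i) (K i j u)) m = - gpsi (\<lambda>i j. K (Suc i) j) (y1 m)"
proof -
  obtain N where N: "killed N m" "killed N (y1 m)"
    using ex_killed_list[of "[m, y1 m]"] by auto
  have K': "endoK (\<lambda>i j u. scale (of_nat i) (K i j u))"
    using K by (auto simp: lin_def scale_right_distrib mult.commute)
  have m: "(y1 ^^ Suc N) m = 0" "(y2 ^^ N) m = 0" and m': "(y1 ^^ N) (y1 m) = 0" "(y2 ^^ N) (y1 m) = 0"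
    using N killed_mono[OF N(1), of "Suc N"] by (auto simp: killed_def)
  let ?g = "\<lambda>i. \<Sum>j<N. scale (cc j) (K i j ((y1 ^^ i) ((y2 ^^ j) m)))"
  have "gpsi (\<lambda>i j u. scale (of_nat i) (K i j u)) m = (\<Sum>i<Suc N. scale (cc i * of_nat i) (?g i))"
    unfolding gpsi_eq[OF K' m] psum_def
    by (simp only: scale_sum_right scale_scale) (simp add: mult_ac)
  also have "\<dots> = - (\<Sum>i<N. scale (cc i) (?g (Suc i)))" by (rule cc_shift)
  also have "\<dots> = - psum (\<lambda>i j. K (Suc i) j) N N (y1 m)"
    unfolding psum_def scale_sum_right scale_scale
    by (simp add: funpow_swap1 y1_y2_pow)
  also have "\<dots> = - gpsi (\<lambda>i j. K (Suc i) j) (y1 m)"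
    using gpsi_eq[OF _ m', of "\<lambda>i j. K (Suc i) j"] K by simp
  finally show ?thesis .
qed

lemma gpsi_index2:
  assumes K: "endoK K"
  shows "gpsi (\<lambda>i j u. scale (of_nat j) (K i j u)) m = - gpsi (\<lambda>i j. K i (Suc j)) (y2 m)"
proof -
  obtain N where N: "killed N m" "killed N (y2 m)"
    using ex_killed_list[of "[m, y2 m]"] by auto
  have K': "endoK (\<lambda>i j u. scale (of_nat j) (K i j u))"
    using K by (auto simp: lin_def scale_right_distrib mult.commute)
  have m: "(y1 ^^ N) m = 0" "(y2 ^^ Suc N) m = 0" and m': "(y1 ^^ N) (y2 m) = 0" "(y2 ^^ N) (y2 m) = 0"
    using N killed_mono[OF N(1), of "Suc N"] by (auto simp: killed_def)
  let ?g = "\<lambda>i j. K i j ((y1 ^^ i) ((y2 ^^ j) m))"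
  have "gpsi (\<lambda>i j u. scale (of_nat j) (K i j u)) m = (\<Sum>i<N. scale (cc i) (\<Sum>j<Suc N. scale (cc j * of_nat j) (?g i j)))"
    unfolding gpsi_eq[OF K' m] psum_def
    by (simp only: scale_sum_right scale_scale) (simp add: mult_ac)
  also have "\<dots> = - psum (\<lambda>i j. K i (Suc j)) N N (y2 m)"
    unfolding psum_def cc_shift scale_minus_right sum_negf scale_sum_right scale_scale
    by (simp add: funpow_swap1)
  also have "\<dots> = - gpsi (\<lambda>i j. K i (Suc j)) (y2 m)"
    using gpsi_eq[OF _ m', of "\<lambda>i j. K i (Suc j)"] K by simp
  finally show ?thesis .
qed

text \<open>
  Taylor expansion in the second variable: moving the exponential past an operator \<open>Z\<close> replaces \<open>Z\<close> by
  \<open>\<Sum> t\<^sub>2\<^sup>e/e! (ad y\<^sub>2)\<^sup>e Z\<close>. Three terms are enough for fields of degree at most one.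
\<close>

lemma gpsi_commute:
  assumes K: "endoK K" and Z: "endo scale Z" "endo scale Z1" "endo scale Z2"
    and z1: "\<And>u. y1 (Z u) = Z (y1 u)"
    and z2: "\<And>u. y2 (Z u) = Z (y2 u) + Z1 u" "\<And>u. y2 (Z1 u) = Z1 (y2 u) + Z2 u" "\<And>u. y2 (Z2 u) = Z2 (y2 u)"
  shows "gpsi (\<lambda>i j u. K i j (Z u)) m = gpsi K (Z m) + gpsi (\<lambda>i j. K i (Suc j)) (Z1 m)
    + scale (1/2) (gpsi (\<lambda>i j. K i (Suc (Suc j))) (Z2 m))"
proof -
  obtain N where N: "killed N m" "killed N (Z m)" "killed N (Z1 m)" "killed N (Z2 m)"
    using ex_killed_list[of "[m, Z m, Z1 m, Z2 m]"] by auto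
  have Z2y: "Z2 ((y2 ^^ j) u) = (y2 ^^ j) (Z2 u)" for j u
    by (induction j) (simp_all flip: z2(3))
  have Z1y: "Z1 ((y2 ^^ j) u) = (y2 ^^ j) (Z1 u) - scale (of_nat j) ((y2 ^^ (j - 1)) (Z2 u))" for j u
  proof (induction j)
    case (Suc j)
    have "Z1 ((y2 ^^ Suc j) u) = y2 (Z1 ((y2 ^^ j) u)) - (y2 ^^ j) (Z2 u)"
      by (simp add: z2(2) Z2y)
    also have "\<dots> = (y2 ^^ Suc j) (Z1 u) - scale (of_nat j) (y2 ((y2 ^^ (j - 1)) (Z2 u))) - (y2 ^^ j) (Z2 u)"
      by (simp add: Suc lin_diff[OF endo_y2] lin_scale[OF endo_y2])
    also have "scale (of_nat j) (y2 ((y2 ^^ (j - 1)) (Z2 u))) = scale (of_nat j) ((y2 ^^ j) (Z2 u))"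
      by (cases j) simp_all
    finally show ?case by (simp add: scale_left_distrib algebra_simps)
  qed simp
  have Zy: "Z ((y2 ^^ j) u) = (y2 ^^ j) (Z u) - scale (of_nat j) ((y2 ^^ (j - 1)) (Z1 u))
      + scale (of_nat (j * (j - 1)) / 2) ((y2 ^^ (j - 2)) (Z2 u))" for j u
  proof (induction j)
    case (Suc j)
    have "Z ((y2 ^^ Suc j) u) = y2 (Z ((y2 ^^ j) u)) - Z1 ((y2 ^^ j) u)"
      by (simp add: z2(1))
    also have "\<dots> = (y2 ^^ Suc j) (Z u) - scale (of_nat j) (y2 ((y2 ^^ (j - 1)) (Z1 u)))
        + scale (of_nat (j * (j - 1)) / 2) (y2 ((y2 ^^ (j - 2)) (Z2 u))) - Z1 ((y2 ^^ j) u)"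
      by (simp add: Suc lin_diff[OF endo_y2] lin_add[OF endo_y2] lin_scale[OF endo_y2])
    also have "scale (of_nat j) (y2 ((y2 ^^ (j - 1)) (Z1 u))) = scale (of_nat j) ((y2 ^^ j) (Z1 u))"
      by (cases j) simp_all
    also have "scale (of_nat (j * (j - 1)) / 2) (y2 ((y2 ^^ (j - 2)) (Z2 u)))
        = scale (of_nat (j * (j - 1)) / 2) ((y2 ^^ (j - 1)) (Z2 u))"
    proof (cases "j \<le> 1")
      case True
      then have "j = 0 \<or> j = 1" by auto
      then show ?thesis by auto
    next
      case False
      then have "j - 1 = Suc (j - 2)" by simp
      then show ?thesis by simp
    qed
    also have "(y2 ^^ Suc j) (Z u) - scale (of_nat j) ((y2 ^^ j) (Z1 u))
        + scale (of_nat (j * (j - 1)) / 2) ((y2 ^^ (j - 1)) (Z2 u)) - Z1 ((y2 ^^ j) u)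
      = (y2 ^^ Suc j) (Z u) - scale (of_nat (Suc j)) ((y2 ^^ j) (Z1 u))
        + (scale (of_nat (j * (j - 1)) / 2) ((y2 ^^ (j - 1)) (Z2 u)) + scale (of_nat j) ((y2 ^^ (j - 1)) (Z2 u)))"
      by (simp add: Z1y scale_left_distrib)
    also have "scale (of_nat (j * (j - 1)) / 2) ((y2 ^^ (j - 1)) (Z2 u)) + scale (of_nat j) ((y2 ^^ (j - 1)) (Z2 u))
       = scale (of_nat (Suc j * (Suc j - 1)) / 2) ((y2 ^^ (Suc j - 2)) (Z2 u))"
      unfolding scale_left_distrib[symmetric]
      by (cases j) (simp_all add: field_simps)
    finally show ?case by simp
  qed simp
  have Zy1: "Z ((y1 ^^ i) u) = (y1 ^^ i) (Z u)" for i u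
    by (induction i) (simp_all flip: z1)
  have KZ: "endoK (\<lambda>i j u. K i j (Z u))"
    using lin_compose[OF K[rule_format] Z(1)] by blast
  let ?M = "Suc (Suc N)"
  let ?y = "\<lambda>i j. (y1 ^^ i) ((y2 ^^ j) m)"
  note yl = lin_add[OF lin_funpow[OF endo_y1]] lin_diff[OF lin_funpow[OF endo_y1]] lin_scale[OF lin_funpow[OF endo_y1]]
  have Kl: "K i j (u + v) = K i j u + K i j v" "K i j (u - v) = K i j u - K i j v"
    "K i j (scale c u) = scale c (K i j u)" for i j u v c
    using K lin_add lin_diff lin_scale by blast+
  have k: "(y1 ^^ N) u = 0" "(y2 ^^ ?M) u = 0" "(y2 ^^ N) u = 0" "(y2 ^^ Suc N) u = 0" if "killed N u" for u
    using killed_mono[OF that, of ?M] killed_mono[OF that, of "Suc N"] that by (auto simp: killed_def)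
  let ?A = "\<lambda>i j. K i j ((y1 ^^ i) ((y2 ^^ j) (Z m)))"
  let ?B = "\<lambda>i j. K i j ((y1 ^^ i) ((y2 ^^ (j - 1)) (Z1 m)))"
  let ?C = "\<lambda>i j. K i j ((y1 ^^ i) ((y2 ^^ (j - 2)) (Z2 m)))"
  have "gpsi (\<lambda>i j u. K i j (Z u)) m = (\<Sum>i<N. \<Sum>j<?M. scale (cc i * cc j) (K i j ((y1 ^^ i) (Z ((y2 ^^ j) m)))))"
    unfolding gpsi_eq[OF KZ k(1)[OF N(1)] k(2)[OF N(1)]] psum_def Zy1 ..
  also have "\<dots> = (\<Sum>i<N. scale (cc i) (\<Sum>j<?M. scale (cc j) (?A i j)
      - scale (cc j * of_nat j) (?B i j) + scale (1/2) (scale (cc j * of_nat (j * (j - 1))) (?C i j))))"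
    unfolding Zy scale_sum_right
    by (intro sum.cong refl) (simp add: yl Kl scale_right_diff_distrib scale_right_distrib mult_ac)
  also have "\<dots> = (\<Sum>i<N. scale (cc i) ((\<Sum>j<?M. scale (cc j) (?A i j))
      - (\<Sum>j<?M. scale (cc j * of_nat j) (?B i j))
      + scale (1/2) (\<Sum>j<?M. scale (cc j * of_nat (j * (j - 1))) (?C i j))))"
    by (simp only: sum.distrib sum_subtractf scale_sum_right)
  also have "(\<lambda>i. \<Sum>j<?M. scale (cc j * of_nat j) (?B i j)) = (\<lambda>i. - (\<Sum>j<Suc N. scale (cc j) (?B i (Suc j))))"
    by (rule ext, rule cc_shift)
  also have "(\<lambda>i. \<Sum>j<?M. scale (cc j * of_nat (j * (j - 1))) (?C i j)) = (\<lambda>i. \<Sum>j<N. scale (cc j) (?C i (Suc (Suc j))))"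
  proof
    fix i
    have "(\<Sum>j<?M. scale (cc j * of_nat (j * (j - 1))) (?C i j))
        = (\<Sum>j<?M. scale (cc j * of_nat j) (scale (of_nat (j - 1)) (?C i j)))" by (simp add: mult_ac)
    also have "\<dots> = - (\<Sum>j<Suc N. scale (cc j * of_nat j) (?C i (Suc j)))"
      by (subst cc_shift) simp
    also have "\<dots> = (\<Sum>j<N. scale (cc j) (?C i (Suc (Suc j))))" by (subst cc_shift) simp
    finally show "(\<Sum>j<?M. scale (cc j * of_nat (j * (j - 1))) (?C i j)) = (\<Sum>j<N. scale (cc j) (?C i (Suc (Suc j))))" .
  qed
  also have "(\<Sum>i<N. scale (cc i) ((\<Sum>j<?M. scale (cc j) (?A i j))
      - - (\<Sum>j<Suc N. scale (cc j) (?B i (Suc j)))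
      + scale (1/2) (\<Sum>j<N. scale (cc j) (?C i (Suc (Suc j))))))
    = psum K N ?M (Z m) + psum (\<lambda>i j. K i (Suc j)) N (Suc N) (Z1 m)
      + scale (1/2) (psum (\<lambda>i j. K i (Suc (Suc j))) N N (Z2 m))"
    unfolding psum_def
    by (simp only: scale_right_distrib minus_minus diff_minus_eq_add sum.distrib scale_sum_right scale_scale
      diff_Suc_1 diff_Suc_Suc diff_zero numeral_2_eq_2) (simp add: mult_ac)
  also have "\<dots> = gpsi K (Z m) + gpsi (\<lambda>i j. K i (Suc j)) (Z1 m)
    + scale (1/2) (gpsi (\<lambda>i j. K i (Suc (Suc j))) (Z2 m))"
    using gpsi_eq[OF K k(1,2)[OF N(2)]] gpsi_eq[OF _ k(1,4)[OF N(3)], of "\<lambda>i j. K i (Suc j)"]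
      gpsi_eq[OF _ k(1,3)[OF N(4)], of "\<lambda>i j. K i (Suc (Suc j))"] K by simp
  finally show ?thesis .
qed

end

context ham_module
begin

lemma gpsi_out:
  assumes T: "endo scale T" and K: "endoK K"
  shows "T (gpsi K m) = gpsi (\<lambda>i j u. T (K i j u)) m"
proof -
  obtain N where N: "killed N m" using ex_killed by blast
  have "endoK (\<lambda>i j u. T (K i j u))" using lin_compose[OF T K[rule_format]] by blast
  then show ?thesis
    using N K by (simp add: gpsi_eq' psum_def lin_sum[OF T] lin_scale[OF T])
qed

text \<open>
  The pairing \<open>f \<otimes> m \<mapsto> H\<^sub>f m\<close> evaluated at \<open>t\<^sub>1\<^sup>at\<^sub>2\<^sup>b exp(-t\<^sub>1y\<^sub>1 - t\<^sub>2y\<^sub>2)m\<close>.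
\<close>

definition psi :: "'m \<Rightarrow> nat \<Rightarrow> nat \<Rightarrow> 'm"
  where "psi m a b = gpsi (\<lambda>i j. h (a + i) (b + j)) m"

lemma endoK_h: "endoK (\<lambda>i j. h (f i j) (g i j))"
  by (simp add: endo_h)

lemma endo_psi: "endo scale (\<lambda>m. psi m a b)"
  unfolding psi_def by (rule endo_gpsi) (rule endoK_h)

lemmas psis = lin_add[OF endo_psi] lin_scale[OF endo_psi] lin_0[OF endo_psi]
  lin_minus[OF endo_psi] lin_diff[OF endo_psi] lin_sum[OF endo_psi]

lemma endo_scaled: "endo scale T \<Longrightarrow> endo scale (\<lambda>u. scale c (T u))"
  by (simp add: lin_def scale_right_distrib mult.commute)

lemma gpsi_weight1:
  "gpsi (\<lambda>i j u. scale (of_nat (a + i)) (h (a + i - 1) (b + j) u)) m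
    = scale (of_nat a) (psi m (a - 1) b) - psi (y1 m) a b"
proof -
  have "gpsi (\<lambda>i j u. scale (of_nat (a + i)) (h (a + i - 1) (b + j) u)) m
     = gpsi (\<lambda>i j u. scale (of_nat a) (h (a + i - 1) (b + j) u) + scale (of_nat i) (h (a + i - 1) (b + j) u)) m"
    by (simp add: scale_left_distrib)
  also have "\<dots> = gpsi (\<lambda>i j u. scale (of_nat a) (h (a + i - 1) (b + j) u)) m
      + gpsi (\<lambda>i j u. scale (of_nat i) (h (a + i - 1) (b + j) u)) m"
    by (intro gpsi_add_fun allI endo_scaled endo_h)
  also have "gpsi (\<lambda>i j u. scale (of_nat i) (h (a + i - 1) (b + j) u)) m = - psi (y1 m) a b"
    by (subst gpsi_index1) (simp_all add: endo_h psi_def)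
  also have "gpsi (\<lambda>i j u. scale (of_nat a) (h (a + i - 1) (b + j) u)) m = scale (of_nat a) (psi m (a - 1) b)"
    by (cases a) (simp_all add: gpsi_zero_fun psi_def gpsi_scale_fun endo_h)
  finally show ?thesis by simp
qed

lemma gpsi_weight2:
  "gpsi (\<lambda>i j u. scale (of_nat (b + j)) (h (a + i) (b + j - 1) u)) m
    = scale (of_nat b) (psi m a (b - 1)) - psi (y2 m) a b"
proof -
  have "gpsi (\<lambda>i j u. scale (of_nat (b + j)) (h (a + i) (b + j - 1) u)) m
     = gpsi (\<lambda>i j u. scale (of_nat b) (h (a + i) (b + j - 1) u) + scale (of_nat j) (h (a + i) (b + j - 1) u)) m"
    by (simp add: scale_left_distrib)
  also have "\<dots> = gpsi (\<lambda>i j u. scale (of_nat b) (h (a + i) (b + j - 1) u)) m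
      + gpsi (\<lambda>i j u. scale (of_nat j) (h (a + i) (b + j - 1) u)) m"
    by (intro gpsi_add_fun allI endo_scaled endo_h)
  also have "gpsi (\<lambda>i j u. scale (of_nat j) (h (a + i) (b + j - 1) u)) m = - psi (y2 m) a b"
    by (subst gpsi_index2) (simp_all add: endo_h psi_def)
  also have "gpsi (\<lambda>i j u. scale (of_nat b) (h (a + i) (b + j - 1) u)) m = scale (of_nat b) (psi m a (b - 1))"
    by (cases b) (simp_all add: gpsi_zero_fun psi_def gpsi_scale_fun endo_h)
  finally show ?thesis by simp
qed

text \<open>
  The three contributions are: \<open>t\<^sub>2\<^sup>n\<partial>\<^sub>1\<close> differentiating \<open>t\<^sub>1\<^sup>at\<^sub>2\<^sup>b\<close>, differentiating the exponential, and acting on \<open>m\<close>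
  through the exponential. In the cases below, the term with \<open>y\<^sub>1m\<close> cancels against the part of \<open>X 0 m = y\<^sub>1m + m\<close>,
  leaving the \<open>\<partial>\<^sub>1 + 1\<close> of the twisted module.
\<close>

lemma X_psi:
  assumes "n \<le> 2"
  shows "X n (psi m a b) = scale (of_nat a) (psi m (a - 1) (b + n)) - psi (y1 m) a (b + n)
    + (psi (X n m) a b + scale (of_nat n) (psi (X (n - 1) m) a (b + 1))
       + scale (of_nat (n * (n - 1)) / 2) (psi (X (n - 2) m) a (b + 2)))"
proof -
  have n: "n = 0 \<or> n = 1 \<or> n = 2" using assms by auto
  have "X n (psi m a b) = gpsi (\<lambda>i j u. scale (of_nat (a + i)) (h (a + i - 1) (b + n + j) u)
      + h (a + i) (b + j) (X n u)) m"
    unfolding psi_def by (subst gpsi_out[OF endo_X endoK_h]) (simp add: X_h add_ac)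
  also have "\<dots> = gpsi (\<lambda>i j u. scale (of_nat (a + i)) (h (a + i - 1) (b + n + j) u)) m
      + gpsi (\<lambda>i j u. h (a + i) (b + j) (X n u)) m"
    by (intro gpsi_add_fun allI endo_scaled endo_h lin_compose[OF endo_h endo_X])
  also have "gpsi (\<lambda>i j u. h (a + i) (b + j) (X n u)) m =
      psi (X n m) a b + psi (scale (of_nat n) (X (n - 1) m)) a (b + 1)
       + scale (1/2) (psi (scale (of_nat (n * (n - 1))) (X (n - 2) m)) a (b + 2))"
    unfolding psi_def
    by (subst gpsi_commute[OF endoK_h endo_X, where ?Z1.0 = "\<lambda>u. scale (of_nat n) (X (n - 1) u)"
            and ?Z2.0 = "\<lambda>u. scale (of_nat (n * (n - 1))) (X (n - 2) u)"])
        (use n in \<open>auto simp: endo_scaled endo_X y1_X y2_X lin_scale[OF endo_y2] lin_0[OF endo_y2] scale_right_distrib\<close>)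
  finally show ?thesis unfolding gpsi_weight1 psis by simp
qed

lemma X0: "X 0 m = y1 m + m" by (simp add: X_def y1_def)

lemma psi_X0: "X 0 (psi m a b) = scale (of_nat a) (psi m (a - 1) b) + psi m a b"
  using X_psi[of 0 m a b] by (simp add: X0 psis)

lemma psi_X1: "X 1 (psi m a b) = scale (of_nat a) (psi m (a - 1) (b + 1)) + psi m a (b + 1) + psi (X 1 m) a b"
  using X_psi[of 1 m a b] by (simp add: X0 psis)

lemma psi_X2: "X 2 (psi m a b) = scale (of_nat a) (psi m (a - 1) (b + 2)) + psi m a (b + 2)
    + scale 2 (psi (X 1 m) a (b + 1)) + psi (X 2 m) a b"
  using X_psi[of 2 m a b] by (simp add: X0 psis)

lemma psi_h10: "h 1 0 (psi m a b) = - scale (of_nat b) (psi m a (b - 1)) - psi m a b"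
proof -
  have c: "- h 1 0 (h a' b' u) = scale (of_nat b') (h a' (b' - 1) u) + h a' b' (- h 1 0 u)" for a' b' u
    using h_comm[of 1 0 a' b' u] by (simp add: hs)
  have e: "endo scale (\<lambda>u. - h 1 0 u)" by (rule linI) (simp_all add: hs)
  have "- h 1 0 (psi m a b) = gpsi (\<lambda>i j u. scale (of_nat (b + j)) (h (a + i) (b + j - 1) u)
      + h (a + i) (b + j) (- h 1 0 u)) m"
    unfolding psi_def by (subst gpsi_out[OF e endoK_h]) (simp only: c)
  also have "\<dots> = gpsi (\<lambda>i j u. scale (of_nat (b + j)) (h (a + i) (b + j - 1) u)) m
      + gpsi (\<lambda>i j u. h (a + i) (b + j) (- h 1 0 u)) m"
    by (intro gpsi_add_fun allI endo_scaled endo_h lin_compose[OF endo_h e])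
  also have "gpsi (\<lambda>i j u. h (a + i) (b + j) (- h 1 0 u)) m = psi (- h 1 0 m) a b"
    unfolding psi_def
    by (subst gpsi_commute[OF endoK_h e, where ?Z1.0 = "\<lambda>u. 0" and ?Z2.0 = "\<lambda>u. 0"])
      (use h_comm[of 0 1 1 0] in \<open>auto simp: lin_def hs y1_def y2_def h_zero lin_0[OF endo_gpsi] endo_h\<close>)
  also have "- h 1 0 m = y2 m + m" by (simp add: y2_def)
  finally have "- h 1 0 (psi m a b) = scale (of_nat b) (psi m a (b - 1)) + psi m a b"
    unfolding gpsi_weight2 psis by simp
  then show ?thesis by (metis add.inverse_inverse minus_add_distrib uminus_add_conv_diff add.commute)
qed

text \<open>
  The \<open>-1\<close> in the coefficient of \<open>psi m a b\<close> comes from \<open>[d\<^sub>2, H\<^sub>f] = H\<^sub>g\<close> with \<open>g = d\<^sub>2(f) - f\<close>; it is minus the divergence.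
\<close>

lemma psi_d2: "d2 (psi m a b) = scale (of_nat b - 1) (psi m a b) + psi m a (b + 1) + psi (d2 m) a b"
proof -
  have e: "endo scale (\<lambda>u. - h 1 0 u)" by (rule linI) (simp_all add: hs)
  have "d2 (psi m a b) = gpsi (\<lambda>i j u. (scale (of_nat b - 1) (h (a + i) (b + j) u)
      + scale (of_nat j) (h (a + i) (b + j) u)) + h (a + i) (b + j) (d2 u)) m"
    unfolding psi_def by (subst gpsi_out[OF endo_d2 endoK_h])
      (simp add: d2_comm algebra_simps scale_left_distrib scale_left_diff_distrib)
  also have "\<dots> = gpsi (\<lambda>i j u. scale (of_nat b - 1) (h (a + i) (b + j) u)
      + scale (of_nat j) (h (a + i) (b + j) u)) m + gpsi (\<lambda>i j u. h (a + i) (b + j) (d2 u)) m"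
    by (intro gpsi_add_fun allI lin_compose[OF endo_h endo_d2])
      (simp add: lin_def hs scale_right_distrib mult.commute)
  also have "gpsi (\<lambda>i j u. scale (of_nat b - 1) (h (a + i) (b + j) u)
      + scale (of_nat j) (h (a + i) (b + j) u)) m
     = scale (of_nat b - 1) (psi m a b) - psi (y2 m) a (b + 1)"
    unfolding psi_def
    by (subst gpsi_add_fun) (simp_all add: endo_scaled endo_h gpsi_scale_fun gpsi_index2)
  also have "gpsi (\<lambda>i j u. h (a + i) (b + j) (d2 u)) m = psi (d2 m) a b + psi (- h 1 0 m) a (b + 1)"
    unfolding psi_def
    by (subst gpsi_commute[OF endoK_h endo_d2, where ?Z1.0 = "\<lambda>u. - h 1 0 u" and ?Z2.0 = "\<lambda>u. 0"])
      (auto simp: e hs y1_d2 y2_d2 lin_0[OF endo_gpsi] endo_h, auto simp: lin_def y2_def hs)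
  also have "- h 1 0 m = y2 m + m" by (simp add: y2_def)
  finally show ?thesis by (simp add: psis)
qed

end

section \<open>The kernel of the twisted evaluation has finite codimension\<close>

context ham_module
begin

definition Wh :: "'m set" where "Wh = {m. y1 m = 0 \<and> y2 m = 0}"
definition psi_kernel :: "'m set" where "psi_kernel = {m. \<forall>a b. psi m a b = 0}"

lemma Wh_iff: "m \<in> Wh \<longleftrightarrow> h 0 1 m = m \<and> h 1 0 m = - m"
  by (auto simp: Wh_def y1_def y2_def minus_equation_iff)

lemma subspace_Wh: "subspace Wh"
  by (rule subspaceI)
    (auto simp: Wh_def lin_add[OF endo_y1] lin_add[OF endo_y2] lin_scale[OF endo_y1] lin_scale[OF endo_y2]
      lin_0[OF endo_y1] lin_0[OF endo_y2])

lemma Wh_spanned: "\<exists>B. finite B \<and> Wh = span B"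
  using whittaker_finite by (auto simp: Wh_iff)

lemma subspace_kernel: "subspace psi_kernel"
  by (rule subspaceI) (auto simp: psi_kernel_def psis)

lemma psi_Wh: "w \<in> Wh \<Longrightarrow> psi w a b = h a b w"
  unfolding psi_def by (subst gpsi_eq[where N = 1 and N' = 1]) (auto simp: endo_h Wh_def psum_def)

text \<open>
  The field \<open>t\<^sub>2(\<partial>\<^sub>1 - \<partial>\<^sub>2)\<close>. It preserves the Whittaker vectors, because \<open>\<partial>\<^sub>1 - \<partial>\<^sub>2\<close> kills them and its
  brackets with \<open>\<partial>\<^sub>1\<close> and \<open>\<partial>\<^sub>2\<close> are multiples of \<open>\<partial>\<^sub>1 - \<partial>\<^sub>2\<close>.
\<close>

definition beta :: "'m \<Rightarrow> 'm" where "beta u = X 1 u - d2 u"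

lemma endo_beta: "endo scale beta"
  by (rule linI) (simp_all add: beta_def lin_add[OF endo_X] lin_scale[OF endo_X] d2s scale_right_diff_distrib)

lemma d2_X1: "d2 (X 1 u) = X 1 (d2 u) + X 1 u"
  using d2_comm[of 0 2 u] by (simp add: X_def d2s numeral_2_eq_2 scale_right_distrib)

lemma d2_X1_pow: "d2 ((X 1 ^^ k) u) = (X 1 ^^ k) (d2 u) + scale (of_nat k) ((X 1 ^^ k) u)"
proof (induction k)
  case (Suc k)
  have "d2 ((X 1 ^^ Suc k) u) = X 1 (d2 ((X 1 ^^ k) u)) + (X 1 ^^ Suc k) u"
    by (simp add: d2_X1 del: One_nat_def)
  also have "\<dots> = (X 1 ^^ Suc k) (d2 u) + scale (of_nat (Suc k)) ((X 1 ^^ Suc k) u)"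
    by (simp add: Suc lin_add[OF endo_X] lin_scale[OF endo_X] scale_left_distrib del: One_nat_def)
  finally show ?case .
qed simp

lemma beta_X1_pow: "beta ((X 1 ^^ k) u) = (X 1 ^^ k) (beta u) - scale (of_nat k) ((X 1 ^^ k) u)"
  by (simp add: beta_def d2_X1_pow lin_diff[OF lin_funpow[OF endo_X]] funpow_swap1[of "X 1"] del: One_nat_def)

lemma y1_beta: "y1 (beta u) = beta (y1 u)"
  by (simp add: beta_def lin_diff[OF endo_y1] y1_X y1_d2)

lemma y2_beta: "y2 (beta u) = beta (y2 u) + y1 u - y2 u"
  using y2_X[of 1 u]
  by (simp add: beta_def lin_diff[OF endo_y2] y2_d2 X0) (simp add: y2_def)

lemma beta_Wh: "w \<in> Wh \<Longrightarrow> beta w \<in> Wh"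
  by (auto simp: Wh_def y1_beta y2_beta lin_0[OF endo_beta])

lemma psi_beta: "beta (psi m a b) = scale (of_nat a) (psi m (a - 1) (b + 1)) - scale (of_nat b - 1) (psi m a b)
    + psi (beta m) a b"
  unfolding beta_def psi_X1 psi_d2 psis by simp

lemma y1_psi: "y1 (psi m a b) = scale (of_nat a) (psi m (a - 1) b)"
  using psi_X0[of m a b] X0[of "psi m a b"] by simp

lemma y2_psi: "y2 (psi m a b) = scale (of_nat b) (psi m a (b - 1))"
  by (simp only: y2_def psi_h10) simp

text \<open>
  Suppose that \<open>psi\<close> does not vanish on \<open>X 1 ^^ k\<close> applied to the Whittaker vectors, and look at the first
  coefficient \<open>(a, b)\<close>, ordered by \<open>a + b\<close> and then by \<open>a\<close>, where it is nonzero. Since \<open>y\<^sub>1, y\<^sub>2\<close> lower the degree of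
  the coefficient, this coefficient is a map \<open>g\<close> from Whittaker vectors to Whittaker vectors, and since the off-diagonal
  term of \<open>beta\<close> leads to a smaller \<open>a\<close>, \<open>g\<close> satisfies \<open>g beta = (beta + b - 1 + k) g\<close>. If \<open>g w\<close> is an eigenvector of \<open>beta\<close>
  for \<open>c\<close>, then every polynomial \<open>p\<close> with \<open>p(beta) w = 0\<close> vanishes at \<open>c + b - 1 + k\<close>. So two roots of one polynomial annihilating
  \<open>beta\<close> on all Whittaker vectors differ by at least \<open>k - 1\<close>, which bounds \<open>k\<close>.
\<close>

lemma X1_nilpotent_mod_kernel: "\<exists>k. \<forall>w\<in>Wh. (X 1 ^^ k) w \<in> psi_kernel"
proof -
  obtain B where B: "finite B" "Wh = span B" using Wh_spanned by blast
  obtain p where p: "p \<noteq> 0" "\<And>w. w \<in> Wh \<Longrightarrow> op_poly scale beta p w = 0"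
    using annihilating_poly[OF endo_beta B(1)] beta_Wh unfolding B(2) by metis
  let ?R = "{c. poly p c = 0}"
  have finR: "finite ?R" using p(1) by (rule poly_roots_finite)
  \<comment> \<open>\<open>k - 1\<close> exceeds all distances between roots\<close>
  obtain k :: nat where k: "\<And>c c'. c \<in> ?R \<Longrightarrow> c' \<in> ?R \<Longrightarrow> norm (c - c') + 1 < real k"
  proof -
    let ?S = "(\<lambda>(c, c'). norm (c - c') + 1) ` (?R \<times> ?R)"
    obtain M where M: "\<forall>x\<in>?S. x \<le> M"
      using finR by (meson bdd_above.E bdd_above_finite finite_SigmaI finite_imageI)
    obtain k :: nat where "M < real k" using reals_Archimedean2 by blast
    then show ?thesis using M by (intro that[of k]) fastforce
  qed
  define f where "f w a b = psi ((X 1 ^^ k) w) a b" for w a b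
  have f_lin: "f (u + v) a b = f u a b + f v a b" "f (scale c u) a b = scale c (f u a b)"
    "f 0 a b = 0" "f (u - v) a b = f u a b - f v a b" for u v c a b
    by (simp_all add: f_def psis lin_add[OF lin_funpow[OF endo_X]] lin_scale[OF lin_funpow[OF endo_X]]
       lin_0[OF lin_funpow[OF endo_X]] lin_diff[OF lin_funpow[OF endo_X]])
  have f_beta: "beta (f w a b) = scale (of_nat a) (f w (a - 1) (b + 1)) - scale (of_nat b - 1) (f w a b)
      + f (beta w) a b - scale (of_nat k) (f w a b)" for w a b
    unfolding f_def psi_beta beta_X1_pow psis by simp
  have "f w a b = 0" if w: "w \<in> Wh" for w a b
  proof (rule ccontr)
    assume nz: "f w a b \<noteq> 0"
    define P where "P = {(a, b). \<exists>w\<in>Wh. f w a b \<noteq> 0}"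
    have "(a, b) \<in> P" using nz w by (auto simp: P_def)
    then obtain q where q: "q \<in> P" "\<And>r. (r, q) \<in> measures [\<lambda>(a, b). a + b, fst] \<Longrightarrow> r \<notin> P"
      using wfE_min[OF wf_measures, of "(a, b)" P] by metis
    obtain a b where ab: "q = (a, b)" by (cases q)
    have min: "f w a' b' = 0" if "a' + b' < a + b \<or> a' + b' = a + b \<and> a' < a" "w \<in> Wh" for a' b' w
      using q(2)[of "(a', b')"] that by (auto simp: ab P_def)
    have z1: "scale (of_nat a) (f w (a - 1) b) = 0" "scale (of_nat a) (f w (a - 1) (b + 1)) = 0"
      "scale (of_nat b) (f w a (b - 1)) = 0" if "w \<in> Wh" for w
      using min[of "a - 1" b w] min[of "a - 1" "b + 1" w] min[of a "b - 1" w] that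
      by (cases a; cases b; simp)+
    define g where "g w = f w a b" for w
    have g_Wh: "g w \<in> Wh" if "w \<in> Wh" for w
      using z1[OF that] by (simp add: Wh_def g_def f_def y1_psi y2_psi)
    let ?j = "of_nat b - 1 + of_nat k :: complex"
    have g_beta: "g (beta w) = beta (g w) + scale ?j (g w)" if "w \<in> Wh" for w
      using f_beta[of w a b] z1(2)[OF that] by (simp add: g_def scale_left_distrib scale_left_diff_distrib)
    have sub: "subspace (g ` Wh)"
    proof (rule subspaceI)
      show "0 \<in> g ` Wh" using subspace_0[OF subspace_Wh] f_lin(3) by (force simp: g_def)
      show "u + v \<in> g ` Wh" if "u \<in> g ` Wh" "v \<in> g ` Wh" for u v
        using that subspace_add[OF subspace_Wh] by (auto simp: g_def simp flip: f_lin(1))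
      show "scale c u \<in> g ` Wh" if "u \<in> g ` Wh" for c u
        using that subspace_scale[OF subspace_Wh] by (auto simp: g_def simp flip: f_lin(2))
    qed
    have stable: "beta u \<in> g ` Wh" if "u \<in> g ` Wh" for u
    proof -
      from that obtain w where w: "w \<in> Wh" "u = g w" by blast
      then have "beta u = g (beta w - scale ?j w)"
        using g_beta[OF w(1)] by (simp add: g_def f_lin)
      then show ?thesis using w beta_Wh subspace_diff[OF subspace_Wh] subspace_scale[OF subspace_Wh] by blast
    qed
    obtain u where u: "u \<in> g ` Wh" "u \<noteq> 0" using q(1) by (auto simp: ab P_def g_def)
    have "op_poly scale beta p u = 0" using u g_Wh p(2) by blast
    then obtain c v where v: "v \<in> g ` Wh" "v \<noteq> 0" "beta v = scale c v"
      using eigenvector_exists[OF endo_beta sub stable u p(1)] by blast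
    then obtain w where w: "w \<in> Wh" "v = g w" by blast
    have c: "poly p c = 0"
      using eigenvalue_root[OF endo_beta v(3,2)] p(2) g_Wh w by blast
    have pow: "(beta ^^ i) w \<in> Wh \<and> g ((beta ^^ i) w) = scale ((c + ?j) ^ i) (g w)" for i
    proof (induction i)
      case (Suc i)
      then show ?case
        using v(3) by (auto simp: beta_Wh g_beta w lin_scale[OF endo_beta] distrib_right simp flip: scale_left_distrib)
    qed (use w in simp)
    have "g (op_poly scale beta p w) = scale (poly p (c + ?j)) (g w)"
      by (rule op_poly_eigen) (use pow in \<open>auto simp: g_def f_lin\<close>)
    then have "poly p (c + ?j) = 0" using p(2)[OF w(1)] v w by (simp add: g_def f_lin)
    then have "norm ((c + ?j) - c) + 1 < real k" using c by (intro k) auto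
    moreover have "norm ((c + ?j) - c) + 1 \<ge> real k"
      using complex_Re_le_cmod[of ?j] by simp
    ultimately show False by simp
  qed
  then show ?thesis by (auto simp: psi_kernel_def f_def)
qed

text \<open>
  On Whittaker vectors \<open>X 1\<close> agrees with \<open>d\<^sub>2 + beta\<close>, so \<open>X 1 ^^ k\<close> is \<open>d\<^sub>2\<^sup>k\<close> up to lower powers of \<open>d\<^sub>2\<close>.
\<close>

lemma d2_pow_reduces:
  "\<exists>k. \<forall>w\<in>Wh. (d2 ^^ k) w \<in> span (psi_kernel \<union> (\<Union>i<k. (d2 ^^ i) ` Wh))"
proof -
  obtain k where k: "\<And>w. w \<in> Wh \<Longrightarrow> (X 1 ^^ k) w \<in> psi_kernel" using X1_nilpotent_mod_kernel by blast
  define D where "D n = span (\<Union>i<n. (d2 ^^ i) ` Wh)" for n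
  have D_sub: "subspace (D n)" for n unfolding D_def by (rule subspace_span)
  have D_mono: "D n \<subseteq> D (Suc n)" for n
    unfolding D_def by (rule span_mono) force
  have D_pow: "(d2 ^^ i) w \<in> D n" if "i < n" "w \<in> Wh" for i n w
    unfolding D_def by (rule span_base) (use that in auto)
  have D_d: "d2 l \<in> D (Suc n)" if "l \<in> D n" for l n
    using that unfolding D_def
  proof (induction rule: span_induct_alt)
    case base
    show ?case by (simp add: d2s span_zero)
  next
    case (step c v w)
    then obtain i u where "i < n" "u \<in> Wh" "v = (d2 ^^ i) u" by auto
    then have "d2 v \<in> D (Suc n)" using D_pow[of "Suc i" "Suc n" u] by simp
    then show ?case
      using step unfolding D_def[symmetric] d2s
      by (meson D_sub subspace_add subspace_scale)
  qed
  have "(X 1 ^^ n) w - (d2 ^^ n) w \<in> D n" if "w \<in> Wh" for n w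
    using that
  proof (induction n arbitrary: w)
    case 0
    then show ?case using subspace_0[OF D_sub] by simp
  next
    case (Suc n)
    define l where "l w = (X 1 ^^ n) w - (d2 ^^ n) w" for w
    have l: "l w \<in> D n" if "w \<in> Wh" for w using Suc.IH[OF that] by (simp add: l_def)
    have X: "(X 1 ^^ n) w = (d2 ^^ n) w + l w" for w by (simp add: l_def)
    have "(X 1 ^^ Suc n) w = (X 1 ^^ n) (d2 w) + (X 1 ^^ n) (beta w)"
      by (simp add: funpow_swap1[of "X 1"] beta_def lin_diff[OF lin_funpow[OF endo_X]] del: One_nat_def)
    also have "(X 1 ^^ n) (d2 w) = d2 ((X 1 ^^ n) w) - scale (of_nat n) ((X 1 ^^ n) w)"
      by (simp add: d2_X1_pow del: One_nat_def)
    finally have "(X 1 ^^ Suc n) w - (d2 ^^ Suc n) w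
       = d2 (l w) - scale (of_nat n) ((d2 ^^ n) w + l w) + ((d2 ^^ n) (beta w) + l (beta w))"
      unfolding X by (simp add: d2s)
    also have "\<dots> \<in> D (Suc n)"
      using D_d[OF l[OF Suc.prems]] D_pow[of n "Suc n" w] D_pow[of n "Suc n" "beta w"] Suc.prems
        l[OF Suc.prems] l[OF beta_Wh[OF Suc.prems]] D_mono[of n] beta_Wh
      by (intro subspace_add[OF D_sub] subspace_diff[OF D_sub] subspace_scale[OF D_sub]) auto
    finally show ?case .
  qed
  then have D: "(X 1 ^^ k) w - (d2 ^^ k) w \<in> D k" if "w \<in> Wh" for w using that by blast
  have "(d2 ^^ k) w \<in> span (psi_kernel \<union> (\<Union>i<k. (d2 ^^ i) ` Wh))" if "w \<in> Wh" for w
  proof -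
    have "(X 1 ^^ k) w \<in> span (psi_kernel \<union> (\<Union>i<k. (d2 ^^ i) ` Wh))"
      by (rule span_base) (use k that in auto)
    moreover have "(X 1 ^^ k) w - (d2 ^^ k) w \<in> span (psi_kernel \<union> (\<Union>i<k. (d2 ^^ i) ` Wh))"
      using D[OF that] span_mono[of "\<Union>i<k. (d2 ^^ i) ` Wh"] unfolding D_def by blast
    ultimately have "(X 1 ^^ k) w - ((X 1 ^^ k) w - (d2 ^^ k) w) \<in> span (psi_kernel \<union> (\<Union>i<k. (d2 ^^ i) ` Wh))"
      by (rule span_diff)
    then show ?thesis by simp
  qed
  then show ?thesis by blast
qed

text \<open>
  Each formula above writes the values of \<open>psi\<close> at the image of \<open>m\<close> under a field in terms of values of \<open>psi m\<close> and of
  \<open>psi\<close> at images of \<open>m\<close> under fields of lower degree. This makes the kernel stable under the fields that vanish at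
  the origin.
\<close>

lemma d2_kernel: "m \<in> psi_kernel \<Longrightarrow> d2 m \<in> psi_kernel"
  using psi_d2[of m] by (simp add: psi_kernel_def d2s)

lemma X1_kernel: "m \<in> psi_kernel \<Longrightarrow> X 1 m \<in> psi_kernel"
  using psi_X1[of m] by (simp add: psi_kernel_def lin_0[OF endo_X])

lemma X2_kernel: "m \<in> psi_kernel \<Longrightarrow> X 2 m \<in> psi_kernel"
  using psi_X2[of m] X1_kernel[of m] by (simp add: psi_kernel_def lin_0[OF endo_X])

lemma h_X: "h 0 (Suc n) u = scale (of_nat (Suc n)) (X n u)"
  using of_nat_neq_0[of n, where ?'a = complex] by (simp add: X_def del: of_nat_Suc)

lemma h02_kernel: "m \<in> psi_kernel \<Longrightarrow> h 0 2 m \<in> psi_kernel"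
  using h_X[of 1 m] X1_kernel[of m] subspace_scale[OF subspace_kernel, of "X 1 m" 2] by (simp add: numeral_2_eq_2)

lemma h03_kernel: "m \<in> psi_kernel \<Longrightarrow> h 0 3 m \<in> psi_kernel"
  using h_X[of 2 m] X2_kernel[of m] subspace_scale[OF subspace_kernel, of "X 2 m" 3] by (simp add: numeral_3_eq_3)

text \<open>
  Exchanging \<open>t\<^sub>1\<close> and \<open>t\<^sub>2\<close>.
\<close>

lemma swapped: "ham_module scale (\<lambda>a b u. - h b a u) d1"
proof
  show "endo scale (\<lambda>u. - h b a u)" for a b by (rule linI) (simp_all add: hs)
  show "endo scale d1" by (rule endo_d1)
  show "- h 0 0 m = 0" for m by (simp add: h_zero)
  show "- h b a (- h d c m) = - h d c (- h b a m)
      + scale (of_nat (b * c) - of_nat (a * d)) (- h (b + d - 1) (a + c - 1) m)" for a b c d m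
    unfolding hs minus_minus h_comm[of b a d c m] by (simp add: scale_left_diff_distrib)
  show "d1 (- h b a m) = - h b a (d1 m) + scale (of_nat b - 1) (- h b a m)" for a b m
    using d2_comm[of b a m] h_comm[of 1 1 b a m] by (simp add: d1_def d2s hs scale_left_diff_distrib)
  show "\<exists>n. ((\<lambda>u. - h 1 0 u - u) ^^ n) m = 0" for m using nilpotent2 by blast
  show "\<exists>n. ((\<lambda>u. - (- h 0 1 u) - u) ^^ n) m = 0" for m using nilpotent1 by simp
  show "\<exists>B. finite B \<and> span B = {m. - h 1 0 m = m \<and> - h 0 1 m = - m}"
  proof -
    have "{m. - h 1 0 m = m \<and> - h 0 1 m = - m} = {m. h 0 1 m = m \<and> h 1 0 m = - m}"
      by (auto simp: minus_equation_iff)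
    then show ?thesis using whittaker_finite by simp
  qed
qed

lemma swapped_psi: "ham_module.psi scale (\<lambda>a b u. - h b a u) m a b = - psi m b a"
proof -
  interpret sw: ham_module scale "\<lambda>a b u. - h b a u" d1 by (rule swapped)
  have y: "sw.y1 = y2" "sw.y2 = y1"
    by (rule ext, simp add: sw.y1_def sw.y2_def y1_def y2_def)+
  obtain M where M: "killed M m" using ex_killed by blast
  then have M': "sw.killed M m" unfolding sw.killed_def killed_def y by simp
  have "sw.psi m a b = (\<Sum>i<M. \<Sum>j<M. scale (cc i * cc j) (- h (b + j) (a + i) ((y2 ^^ i) ((y1 ^^ j) m))))"
    unfolding sw.psi_def sw.gpsi_eq'[OF sw.endoK_h M'] sw.psum_def y ..
  also have "\<dots> = - (\<Sum>j<M. \<Sum>i<M. scale (cc j * cc i) (h (b + j) (a + i) ((y1 ^^ j) ((y2 ^^ i) m))))"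
    by (subst sum.swap) (simp add: sum_negf mult.commute y1_pow_y2_pow)
  also have "\<dots> = - psi m b a"
    unfolding psi_def gpsi_eq'[OF endoK_h M] psum_def ..
  finally show ?thesis .
qed

lemma swapped_kernel: "ham_module.psi_kernel scale (\<lambda>a b u. - h b a u) = psi_kernel"
proof -
  interpret sw: ham_module scale "\<lambda>a b u. - h b a u" d1 by (rule swapped)
  show ?thesis by (auto simp: psi_kernel_def sw.psi_kernel_def swapped_psi)
qed

lemma swapped_Wh: "ham_module.Wh (\<lambda>a b u. - h b a u) = Wh"
proof -
  interpret sw: ham_module scale "\<lambda>a b u. - h b a u" d1 by (rule swapped)
  show ?thesis by (auto simp: Wh_iff sw.Wh_iff minus_equation_iff)
qed

text \<open>
  The field \<open>t\<^sub>1\<^sup>n\<partial>\<^sub>2\<close>.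
\<close>

definition X' :: "nat \<Rightarrow> 'm \<Rightarrow> 'm" where "X' n u = - scale (1 / of_nat (Suc n)) (h (Suc n) 0 u)"

lemma swapped_X: "ham_module.X scale (\<lambda>a b u. - h b a u) = X'"
proof -
  interpret sw: ham_module scale "\<lambda>a b u. - h b a u" d1 by (rule swapped)
  show ?thesis by (intro ext) (simp add: sw.X_def X'_def)
qed

lemma psi_X1': "X' 1 (psi m a b) = scale (of_nat b) (psi m (a + 1) (b - 1)) + psi m (a + 1) b + psi (X' 1 m) a b"
proof -
  interpret sw: ham_module scale "\<lambda>a b u. - h b a u" d1 by (rule swapped)
  have e: "endo scale (X' 1)" using sw.endo_X unfolding swapped_X .
  show ?thesis
    by (rule neg_equal_iff_equal[THEN iffD1])
      (use sw.psi_X1[of m b a] in \<open>simp add: swapped_psi swapped_X lin_minus[OF e] algebra_simps del: One_nat_def\<close>)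
qed

lemma psi_X2': "X' 2 (psi m a b) = scale (of_nat b) (psi m (a + 2) (b - 1)) + psi m (a + 2) b
    + scale 2 (psi (X' 1 m) (a + 1) b) + psi (X' 2 m) a b"
proof -
  interpret sw: ham_module scale "\<lambda>a b u. - h b a u" d1 by (rule swapped)
  have e: "endo scale (X' 2)" using sw.endo_X unfolding swapped_X .
  show ?thesis
    by (rule neg_equal_iff_equal[THEN iffD1])
      (use sw.psi_X2[of m b a] in \<open>simp add: swapped_psi swapped_X lin_minus[OF e] algebra_simps del: One_nat_def\<close>)
qed

lemma d1_kernel: "m \<in> psi_kernel \<Longrightarrow> d1 m \<in> psi_kernel"
proof -
  interpret sw: ham_module scale "\<lambda>a b u. - h b a u" d1 by (rule swapped)
  show "m \<in> psi_kernel \<Longrightarrow> d1 m \<in> psi_kernel" using sw.d2_kernel[of m] unfolding swapped_kernel .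
qed

lemma X1'_kernel: "m \<in> psi_kernel \<Longrightarrow> X' 1 m \<in> psi_kernel"
proof -
  interpret sw: ham_module scale "\<lambda>a b u. - h b a u" d1 by (rule swapped)
  show "m \<in> psi_kernel \<Longrightarrow> X' 1 m \<in> psi_kernel" using sw.X1_kernel[of m] unfolding swapped_kernel swapped_X .
qed

lemma h20_kernel: "m \<in> psi_kernel \<Longrightarrow> h 2 0 m \<in> psi_kernel"
proof -
  interpret sw: ham_module scale "\<lambda>a b u. - h b a u" d1 by (rule swapped)
  show "m \<in> psi_kernel \<Longrightarrow> h 2 0 m \<in> psi_kernel"
    using sw.h02_kernel[of m] subspace_neg[OF subspace_kernel, of "- h 2 0 m"] unfolding swapped_kernel by simp
qed

lemma h30_kernel: "m \<in> psi_kernel \<Longrightarrow> h 3 0 m \<in> psi_kernel"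
proof -
  interpret sw: ham_module scale "\<lambda>a b u. - h b a u" d1 by (rule swapped)
  show "m \<in> psi_kernel \<Longrightarrow> h 3 0 m \<in> psi_kernel"
    using sw.h03_kernel[of m] subspace_neg[OF subspace_kernel, of "- h 3 0 m"] unfolding swapped_kernel by simp
qed

lemma h12_kernel: "m \<in> psi_kernel \<Longrightarrow> h 1 2 m \<in> psi_kernel"
proof -
  assume m: "m \<in> psi_kernel"
  have "scale 6 (h 1 2 m) = h 0 3 (h 2 0 m) - h 2 0 (h 0 3 m)"
    using h_comm[of 0 3 2 0 m] by simp
  also have "\<dots> \<in> psi_kernel" using m h03_kernel h20_kernel subspace_diff[OF subspace_kernel] by blast
  finally show "h 1 2 m \<in> psi_kernel" using subspace_scale[OF subspace_kernel, of _ "1/6"] by fastforce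
qed

lemma h21_kernel: "m \<in> psi_kernel \<Longrightarrow> h 2 1 m \<in> psi_kernel"
proof -
  assume m: "m \<in> psi_kernel"
  have "scale 6 (h 2 1 m) = h 0 2 (h 3 0 m) - h 3 0 (h 0 2 m)"
    using h_comm[of 0 2 3 0 m] by simp
  also have "\<dots> \<in> psi_kernel" using m h02_kernel h30_kernel subspace_diff[OF subspace_kernel] by blast
  finally show "h 2 1 m \<in> psi_kernel" using subspace_scale[OF subspace_kernel, of _ "1/6"] by fastforce
qed

lemma d1_d2: "d1 (d2 u) = d2 (d1 u)"
  using d2_comm[of 1 1 u] by (simp add: d1_def d2s)

lemma d1_pow_reduces:
  "\<exists>k. \<forall>w\<in>Wh. (d1 ^^ k) w \<in> span (psi_kernel \<union> (\<Union>i<k. (d1 ^^ i) ` Wh))"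
proof -
  interpret sw: ham_module scale "\<lambda>a b u. - h b a u" d1 by (rule swapped)
  show ?thesis using sw.d2_pow_reduces unfolding swapped_kernel swapped_Wh .
qed

text \<open>
  Descent in \<open>t\<^sub>2\<close> reduces to the kernel of \<open>y\<^sub>2\<close>, on which descent in \<open>t\<^sub>1\<close> reduces to the Whittaker vectors.
\<close>

lemma generated_by_Wh: "UNIV = span (\<Union>n. (d2 ^^ n) ` span (\<Union>n. (d1 ^^ n) ` Wh))"
proof -
  define K where "K = {u. y2 u = 0}"
  have y1_d1: "y1 (d1 u) = d1 (y1 u) + y1 u + u" for u
    using h_comm[of 0 1 1 1 u] by (simp add: y1_def d1_def d2s hs d2_comm)
  have y2_d1: "y2 (d1 u) = d1 (y2 u)" for u
    using h_comm[of 1 0 1 1 u] by (simp add: y2_def d1_def d2s hs d2_comm)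
  have K: "subspace K"
    by (rule subspaceI) (auto simp: K_def lin_add[OF endo_y2] lin_scale[OF endo_y2] lin_0[OF endo_y2])
  have n1: "\<exists>n. (y1 ^^ n) u = 0" and n2: "\<exists>n. (y2 ^^ n) u = 0" for u
    using ex_killed[of u] by (auto simp: killed_def)
  have "K \<subseteq> span (\<Union>n. (d1 ^^ n) ` {u \<in> K. y1 u = 0})"
    by (rule span_descent[OF endo_d1 endo_y1 y1_d1 K])
      (auto simp: K_def y2_d1 lin_0[OF endo_d1] n1 lin_0[OF endo_y1] simp flip: y1_y2)
  moreover have "{u \<in> K. y1 u = 0} = Wh" by (auto simp: K_def Wh_def)
  ultimately have KW: "K \<subseteq> span (\<Union>n. (d1 ^^ n) ` Wh)" by simp
  have "UNIV \<subseteq> span (\<Union>n. (d2 ^^ n) ` {u \<in> UNIV. y2 u = 0})"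
    by (rule span_descent[OF endo_d2 endo_y2]) (simp_all add: n2 y2_d2, simp add: y2_def)
  also have "\<dots> \<subseteq> span (\<Union>n. (d2 ^^ n) ` span (\<Union>n. (d1 ^^ n) ` Wh))"
    using KW by (intro span_mono UN_mono image_mono) (auto simp: K_def)
  finally show ?thesis by blast
qed

text \<open>
  Modulo the kernel, high powers of \<open>d\<^sub>1\<close> and of \<open>d\<^sub>2\<close> on Whittaker vectors reduce to lower ones. So the span of
  finitely many \<open>d\<^sub>1\<^sup>id\<^sub>2\<^sup>jb\<close> together with the kernel is stable under \<open>d\<^sub>1\<close> and \<open>d\<^sub>2\<close>, and it contains the Whittaker
  vectors, which generate everything.
\<close>

lemma finite_codim_kernel: "\<exists>S. finite S \<and> span (psi_kernel \<union> S) = UNIV"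
proof -
  obtain k1 where k1: "\<And>w. w \<in> Wh \<Longrightarrow> (d1 ^^ k1) w \<in> span (psi_kernel \<union> (\<Union>i<k1. (d1 ^^ i) ` Wh))"
    using d1_pow_reduces by blast
  obtain k2 where k2: "\<And>w. w \<in> Wh \<Longrightarrow> (d2 ^^ k2) w \<in> span (psi_kernel \<union> (\<Union>i<k2. (d2 ^^ i) ` Wh))"
    using d2_pow_reduces by blast
  obtain B where B: "finite B" "Wh = span B" using Wh_spanned by blast
  define S where "S = (\<lambda>(i, j, b). (d1 ^^ i) ((d2 ^^ j) b)) ` ({..<k1} \<times> {..<k2} \<times> B)"
  define Q where "Q = span (psi_kernel \<union> S)"
  have finS: "finite S" using B(1) by (simp add: S_def)
  have Qs: "subspace Q" unfolding Q_def by (rule subspace_span)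
  have comm: "(d1 ^^ i) ((d2 ^^ j) u) = (d2 ^^ j) ((d1 ^^ i) u)" for i j u
  proof (induction i)
    case (Suc i)
    have "d1 ((d2 ^^ j) v) = (d2 ^^ j) (d1 v)" for v by (induction j) (simp_all add: d1_d2)
    then show ?case using Suc by simp
  qed simp
  have e: "endo scale (\<lambda>u. (d1 ^^ i) ((d2 ^^ j) u))" for i j
    by (rule lin_compose[OF lin_funpow[OF endo_d1] lin_funpow[OF endo_d2]])
  have span_image: "T u \<in> Q" if T: "endo scale T" and u: "u \<in> span A" and A: "\<And>a. a \<in> A \<Longrightarrow> T a \<in> Q" for T u A
    using u
  proof (induction rule: span_induct_alt)
    case base
    show ?case using lin_0[OF T] subspace_0[OF Qs] by simp
  next
    case (step c x y)
    then show ?case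
      using A subspace_add[OF Qs] subspace_scale[OF Qs] by (simp add: lin_add[OF T] lin_scale[OF T])
  qed
  have QW: "(d1 ^^ i) ((d2 ^^ j) w) \<in> Q" if "i < k1" "j < k2" "w \<in> Wh" for i j w
  proof (rule span_image[OF e, of w B])
    show "w \<in> span B" using that B by simp
    show "(d1 ^^ i) ((d2 ^^ j) b) \<in> Q" if "b \<in> B" for b
      unfolding Q_def S_def using \<open>i < k1\<close> \<open>j < k2\<close> that by (intro span_base) force
  qed
  have NQ: "psi_kernel \<subseteq> Q" unfolding Q_def using span_superset by blast
  have N1: "(d1 ^^ i) m \<in> psi_kernel" if "m \<in> psi_kernel" for i m by (induction i) (use that d1_kernel in auto)
  have N2: "(d2 ^^ i) m \<in> psi_kernel" if "m \<in> psi_kernel" for i m by (induction i) (use that d2_kernel in auto)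
  have BW: "b \<in> Wh" if "b \<in> B" for b using B that span_base by blast
  have d1_Q: "d1 u \<in> Q" if "u \<in> Q" for u
  proof (rule span_image[OF endo_d1 that[unfolded Q_def]])
    fix a assume "a \<in> psi_kernel \<union> S"
    then show "d1 a \<in> Q"
    proof
      assume "a \<in> psi_kernel" then show ?thesis using d1_kernel NQ by blast
    next
      assume "a \<in> S"
      then obtain i j b where b: "i < k1" "j < k2" "b \<in> B" "a = (d1 ^^ i) ((d2 ^^ j) b)" by (auto simp: S_def)
      then have a: "d1 a = (d1 ^^ Suc i) ((d2 ^^ j) b)" by simp
      show ?thesis
      proof (cases "Suc i < k1")
        case True
        then show ?thesis unfolding a using b BW by (intro QW) auto
      next
        case False
        with b have i: "Suc i = k1" by simp
        have "(d2 ^^ j) ((d1 ^^ k1) b) \<in> Q"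
        proof (rule span_image[OF lin_funpow[OF endo_d2] k1[OF BW[OF b(3)]]])
          fix c assume "c \<in> psi_kernel \<union> (\<Union>i<k1. (d1 ^^ i) ` Wh)"
          then show "(d2 ^^ j) c \<in> Q" using N2 NQ QW b by (auto simp flip: comm)
        qed
        then show ?thesis unfolding a i comm .
      qed
    qed
  qed
  have d2_Q: "d2 u \<in> Q" if "u \<in> Q" for u
  proof (rule span_image[OF endo_d2 that[unfolded Q_def]])
    fix a assume "a \<in> psi_kernel \<union> S"
    then show "d2 a \<in> Q"
    proof
      assume "a \<in> psi_kernel" then show ?thesis using d2_kernel NQ by blast
    next
      assume "a \<in> S"
      then obtain i j b where b: "i < k1" "j < k2" "b \<in> B" "a = (d1 ^^ i) ((d2 ^^ j) b)" by (auto simp: S_def)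
      then have a: "d2 a = (d1 ^^ i) ((d2 ^^ Suc j) b)" unfolding b(4) comm by simp
      show ?thesis
      proof (cases "Suc j < k2")
        case True
        then show ?thesis unfolding a using b BW by (intro QW) auto
      next
        case False
        with b have j: "Suc j = k2" by simp
        have "(d1 ^^ i) ((d2 ^^ k2) b) \<in> Q"
        proof (rule span_image[OF lin_funpow[OF endo_d1] k2[OF BW[OF b(3)]]])
          fix c assume "c \<in> psi_kernel \<union> (\<Union>i<k2. (d2 ^^ i) ` Wh)"
          then show "(d1 ^^ i) c \<in> Q" using N1 NQ QW b by auto
        qed
        then show ?thesis unfolding a j .
      qed
    qed
  qed
  have WQ: "Wh \<subseteq> Q"
  proof
    fix w assume w: "w \<in> Wh"
    consider "k1 = 0" | "k2 = 0" | "k1 > 0" "k2 > 0" by auto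
    then show "w \<in> Q"
    proof cases
      case 1
      then have "w \<in> span psi_kernel" using k1[OF w] by simp
      then show ?thesis using NQ Qs span_minimal by blast
    next
      case 2
      then have "w \<in> span psi_kernel" using k2[OF w] by simp
      then show ?thesis using NQ Qs span_minimal by blast
    next
      case 3
      then show ?thesis using QW[of 0 0 w] w by simp
    qed
  qed
  have p1: "(d1 ^^ n) u \<in> Q" if "u \<in> Q" for n u by (induction n) (use that d1_Q in auto)
  have p2: "(d2 ^^ n) u \<in> Q" if "u \<in> Q" for n u by (induction n) (use that d2_Q in auto)
  have "span (\<Union>n. (d1 ^^ n) ` Wh) \<subseteq> Q"
    by (rule span_minimal[OF _ Qs]) (use p1 WQ in auto)
  then have "span (\<Union>n. (d2 ^^ n) ` span (\<Union>n. (d1 ^^ n) ` Wh)) \<subseteq> Q"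
    by (intro span_minimal[OF _ Qs]) (use p2 in auto)
  then have "Q = UNIV" using generated_by_Wh by auto
  then show ?thesis using finS Q_def by blast
qed

end

section \<open>A simple module of the general linear algebra in the quotient\<close>

context ham_module
begin

lemma endo_X': "endo scale (X' n)"
  by (rule linI) (simp_all add: X'_def hs scale_right_distrib mult.commute)

lemma X'1_h: "X' 1 (h a b u) = h a b (X' 1 u) + scale (of_nat b) (h (a + 1) (b - 1) u)"
proof -
  interpret sw: ham_module scale "\<lambda>a b u. - h b a u" d1 by (rule swapped)
  have "X' 1 (- h a b u) = - h a b (X' 1 u) + scale (of_nat b) (- h (a + 1) (b - 1) u)"
    using sw.X_h[of 1 a b u] unfolding swapped_X .
  then show ?thesis
    unfolding lin_minus[OF endo_X'] by (metis (no_types, lifting) add.inverse_inverse minus_add_distrib scale_minus_right)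
qed

lemma d1_comm: "d1 (h a b u) = h a b (d1 u) + scale (of_nat a - 1) (h a b u)"
  unfolding d1_def hs d2_comm h_comm[of 1 1 a b u]
  by (simp add: scale_left_diff_distrib algebra_simps)

text \<open>
  Vectors whose classes modulo the kernel are killed by the fields of degree one, the Hamiltonian fields of
  cubics.
\<close>

definition cubic_kernel where "cubic_kernel = {m. \<forall>i j. i + j = 3 \<longrightarrow> h i j m \<in> psi_kernel}"

lemma h3_kernel: "i + j = 3 \<Longrightarrow> m \<in> psi_kernel \<Longrightarrow> h i j m \<in> psi_kernel"
proof -
  assume "i + j = 3" and m: "m \<in> psi_kernel"
  then consider "i = 0" "j = 3" | "i = 1" "j = 2" | "i = 2" "j = 1" | "i = 3" "j = 0" by linarith
  then show ?thesis using h03_kernel[OF m] h12_kernel[OF m] h21_kernel[OF m] h30_kernel[OF m] by cases auto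
qed

lemma subspace_cubic_kernel: "subspace cubic_kernel"
  by (rule subspaceI)
    (auto simp: cubic_kernel_def hs intro: subspace_add[OF subspace_kernel] subspace_0[OF subspace_kernel] subspace_scale[OF subspace_kernel])

lemma kernel_subset_cubic_kernel: "psi_kernel \<subseteq> cubic_kernel" using h3_kernel by (auto simp: cubic_kernel_def)

lemma cubic_kernel_stable:
  assumes m: "m \<in> cubic_kernel"
  shows "d1 m \<in> cubic_kernel" "d2 m \<in> cubic_kernel" "X 1 m \<in> cubic_kernel" "X' 1 m \<in> cubic_kernel"
proof -
  have hN: "h i j m \<in> psi_kernel" if "i + j = 3" for i j using m that by (auto simp: cubic_kernel_def)
  note sN = subspace_diff[OF subspace_kernel] subspace_scale[OF subspace_kernel]
  have "h i j (d1 m) = d1 (h i j m) - scale (of_nat i - 1) (h i j m)" for i j by (simp add: d1_comm)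
  then show "d1 m \<in> cubic_kernel" using hN d1_kernel sN by (auto simp: cubic_kernel_def)
  have "h i j (d2 m) = d2 (h i j m) - scale (of_nat j - 1) (h i j m)" for i j by (simp add: d2_comm)
  then show "d2 m \<in> cubic_kernel" using hN d2_kernel sN by (auto simp: cubic_kernel_def)
  have "h i j (X 1 m) = X 1 (h i j m) - scale (of_nat i) (h (i - 1) (j + 1) m)" for i j
    by (simp add: X_h)
  moreover have "scale (of_nat i) (h (i - 1) (j + 1) m) \<in> psi_kernel" if "i + j = 3" for i j
    using hN[of "i - 1" "j + 1"] that sN subspace_0[OF subspace_kernel] by (cases i) auto
  ultimately show "X 1 m \<in> cubic_kernel" using hN X1_kernel sN by (auto simp: cubic_kernel_def)
  have "h i j (X' 1 m) = X' 1 (h i j m) - scale (of_nat j) (h (i + 1) (j - 1) m)" for i j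
    by (simp add: X'1_h del: One_nat_def)
  moreover have "scale (of_nat j) (h (i + 1) (j - 1) m) \<in> psi_kernel" if "i + j = 3" for i j
    using hN[of "i + 1" "j - 1"] that sN subspace_0[OF subspace_kernel] by (cases j) auto
  ultimately show "X' 1 m \<in> cubic_kernel" using hN X1'_kernel sN by (auto simp: cubic_kernel_def)
qed

lemma kernel_proper:
  assumes "(UNIV::'m set) \<noteq> {0}"
  shows "psi_kernel \<noteq> UNIV"
proof
  assume psi_kernel: "psi_kernel = UNIV"
  have "w = 0" if "w \<in> Wh" for w
  proof -
    have "psi w 0 1 = 0" using psi_kernel by (simp add: psi_kernel_def set_eq_iff)
    then show ?thesis using psi_Wh[OF that, of 0 1] that by (simp add: Wh_iff)
  qed
  then have Wh: "Wh = {0}" using subspace_0[OF subspace_Wh] by auto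
  have "(d1 ^^ n) 0 = 0" "(d2 ^^ n) 0 = 0" for n
    using lin_0[OF lin_funpow[OF endo_d1]] lin_0[OF lin_funpow[OF endo_d2]] by auto
  then have "UNIV = span {0::'m}"
    using generated_by_Wh by (simp add: Wh)
  then show False using assms by simp
qed

text \<open>
  These \<open>U\<close> correspond to the nonzero \<open>gl\<^sub>2\<close>-submodules \<open>U/psi_kernel\<close> of the space of classes killed by the cubics.
\<close>

definition stable_between :: "'m set \<Rightarrow> bool" where
  "stable_between U \<longleftrightarrow> subspace U \<and> psi_kernel \<subset> U \<and> U \<subseteq> cubic_kernel \<and>
     (\<forall>u\<in>U. d1 u \<in> U \<and> d2 u \<in> U \<and> X 1 u \<in> U \<and> X' 1 u \<in> U)"

end

text \<open>
  The map \<open>\<kappa>\<close> identifies the quotient by the kernel of \<open>psi\<close> with the finite-dimensional space \<open>range \<kappa>\<close>.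
\<close>

locale ham_coordinates = ham_module scale h d2
  for scale :: "complex \<Rightarrow> 'm::ab_group_add \<Rightarrow> 'm" and h d2 +
  fixes \<kappa> :: "'m \<Rightarrow> fvec" and \<sigma> :: "fvec \<Rightarrow> 'm"
  assumes kappa: "lin scale cscale \<kappa>" and sigma: "lin cscale scale \<sigma>"
    and kernel: "\<kappa> m = 0 \<longleftrightarrow> m \<in> psi_kernel" and kappa_sigma: "\<kappa> (\<sigma> (\<kappa> m)) = \<kappa> m"
    and range_finite: "finite_dim cscale (range \<kappa>)"
begin

sublocale F: cvs "cscale :: complex \<Rightarrow> fvec \<Rightarrow> fvec"
  unfolding cvs_def by (rule vector_space_cscale)

text \<open>
  For \<open>T\<close> preserving the kernel, this is the operator that \<open>T\<close> induces on the quotient, by \<open>induced_kappa\<close>.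
\<close>

definition induced :: "('m \<Rightarrow> 'm) \<Rightarrow> fvec \<Rightarrow> fvec" where "induced T v = \<kappa> (T (\<sigma> v))"

lemma endo_induced: "endo scale T \<Longrightarrow> endo cscale (induced T)"
  by (rule linI) (simp_all add: induced_def lin_add[OF sigma] lin_add[OF kappa] lin_scale[OF sigma]
    lin_scale[OF kappa] lin_add lin_scale)

lemma kappa_eq: "\<kappa> m = \<kappa> m' \<longleftrightarrow> m - m' \<in> psi_kernel"
  using kernel[of "m - m'"] by (simp add: lin_diff[OF kappa])

lemma induced_kappa:
  assumes T: "endo scale T" "\<And>m. m \<in> psi_kernel \<Longrightarrow> T m \<in> psi_kernel"
  shows "induced T (\<kappa> m) = \<kappa> (T m)"
proof -
  have "\<sigma> (\<kappa> m) - m \<in> psi_kernel" using kappa_sigma[of m] by (simp add: kappa_eq)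
  then have "T (\<sigma> (\<kappa> m)) - T m \<in> psi_kernel" using T(2) by (simp flip: lin_diff[OF T(1)])
  then show ?thesis by (simp add: induced_def kappa_eq)
qed

lemma subspace_image:
  assumes U: "subspace U"
  shows "F.subspace (\<kappa> ` U)"
proof (rule F.subspaceI)
  show "0 \<in> \<kappa> ` U" using subspace_0[OF U] lin_0[OF kappa] by force
  show "u + v \<in> \<kappa> ` U" if "u \<in> \<kappa> ` U" "v \<in> \<kappa> ` U" for u v
    using that subspace_add[OF U] by (auto simp flip: lin_add[OF kappa])
  show "cscale c u \<in> \<kappa> ` U" if "u \<in> \<kappa> ` U" for c u
    using that subspace_scale[OF U] by (auto simp flip: lin_scale[OF kappa])
qed

text \<open>
  The cubics raise the eigenvalue of the Euler field \<open>d\<^sub>1 + d\<^sub>2\<close> by one, so in the finite-dimensional quotient they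
  kill an eigenvector whose eigenvalue has maximal real part. This provides an element outside the kernel of \<open>psi\<close>.
\<close>

lemma stable_between_cubic_kernel:
  assumes ne: "(UNIV::'m set) \<noteq> {0}"
  shows "stable_between cubic_kernel"
proof -
  let ?E = "\<lambda>u. d1 u + d2 u"
  have E: "endo scale ?E" by (rule linI) (simp_all add: lin_add[OF endo_d1] lin_scale[OF endo_d1] d2s scale_right_distrib)
  have EN: "?E m \<in> psi_kernel" if "m \<in> psi_kernel" for m using that d1_kernel d2_kernel subspace_add[OF subspace_kernel] by blast
  have Eh: "?E (h i j u) = h i j (?E u) + h i j u" if "i + j = 3" for i j u
  proof -
    have c: "of_nat i - 1 + (of_nat j - 1) = (1 :: complex)"
      using arg_cong[OF that, of "of_nat :: nat \<Rightarrow> complex"] by (simp add: algebra_simps)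
    have "?E (h i j u) = h i j (?E u) + scale (of_nat i - 1 + (of_nat j - 1)) (h i j u)"
      unfolding d1_comm d2_comm scale_left_distrib by (simp add: hs)
    then show ?thesis unfolding c by simp
  qed
  note Ek = induced_kappa[OF E EN]
  define V0 where "V0 = range \<kappa>"
  obtain B where B: "finite B" "F.span B = V0" using range_finite by (auto simp: finite_dim_def V0_def)
  have V0s: "F.subspace V0" using B by (metis F.subspace_span)
  have EV: "induced ?E v \<in> V0" for v by (simp add: V0_def induced_def)
  obtain p where p: "p \<noteq> 0" "\<And>v. v \<in> V0 \<Longrightarrow> op_poly cscale (induced ?E) p v = 0"
    using F.annihilating_poly[OF endo_induced[OF E] B(1)] EV unfolding B(2) by metis
  let ?R = "{c. \<exists>v\<in>V0. v \<noteq> 0 \<and> induced ?E v = cscale c v}"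
  have "?R \<subseteq> {c. poly p c = 0}"
    using F.eigenvalue_root[OF endo_induced[OF E]] p(2) by blast
  then have fin: "finite ?R" using poly_roots_finite[OF p(1)] finite_subset by blast
  obtain m0 where "m0 \<notin> psi_kernel" using kernel_proper[OF ne] by blast
  then have "\<kappa> m0 \<in> V0" "\<kappa> m0 \<noteq> 0" using kernel by (auto simp: V0_def)
  then have "?R \<noteq> {}"
    using F.eigenvector_exists[OF endo_induced[OF E] V0s EV _ _ p(1) p(2)] by blast
  then have "Max (Re ` ?R) \<in> Re ` ?R" using fin by (intro Max_in) auto
  then obtain c where c: "c \<in> ?R" "Re c = Max (Re ` ?R)" by force
  then obtain m where m: "\<kappa> m \<noteq> 0" "\<kappa> (?E m) = cscale c (\<kappa> m)" by (auto simp: V0_def Ek)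
  have "h i j m \<in> psi_kernel" if ij: "i + j = 3" for i j
  proof (rule ccontr)
    assume "h i j m \<notin> psi_kernel"
    then have nz: "\<kappa> (h i j m) \<noteq> 0" by (simp add: kernel)
    have "?E m - scale c m \<in> psi_kernel" using m(2) by (simp add: kappa_eq flip: lin_scale[OF kappa])
    then have "h i j (?E m - scale c m) \<in> psi_kernel" using h3_kernel ij by blast
    then have "\<kappa> (h i j (?E m)) = \<kappa> (scale c (h i j m))" by (simp add: kappa_eq hs)
    then have "\<kappa> (?E (h i j m)) = cscale (c + 1) (\<kappa> (h i j m))"
      unfolding Eh[OF ij] by (simp add: lin_add[OF kappa] lin_scale[OF kappa] F.scale_left_distrib)
    then have "c + 1 \<in> ?R" using nz by (auto simp: V0_def Ek intro!: bexI[of _ "\<kappa> (h i j m)"])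
    then have "Re (c + 1) \<le> Max (Re ` ?R)" using fin by (intro Max_ge imageI finite_imageI)
    then show False using c(2) by simp
  qed
  then have "m \<in> cubic_kernel" by (simp add: cubic_kernel_def)
  moreover have "m \<notin> psi_kernel" using m(1) kernel by simp
  ultimately show ?thesis using subspace_cubic_kernel kernel_subset_cubic_kernel cubic_kernel_stable by (auto simp: stable_between_def)
qed

lemma minimal_stable:
  assumes ne: "(UNIV::'m set) \<noteq> {0}"
  shows "\<exists>U. stable_between U \<and> (\<forall>U'. stable_between U' \<longrightarrow> U' \<subseteq> U \<longrightarrow> U' = U)"
proof -
  obtain B where B: "finite B" "F.span B = range \<kappa>" using range_finite by (auto simp: finite_dim_def)
  obtain U where U: "stable_between U" "\<And>U'. stable_between U' \<Longrightarrow> F.dim (\<kappa> ` U) \<le> F.dim (\<kappa> ` U')"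
    using ex_has_least_nat[of stable_between cubic_kernel "\<lambda>U. F.dim (\<kappa> ` U)"] stable_between_cubic_kernel[OF ne] by blast
  have "U' = U" if U': "stable_between U'" "U' \<subseteq> U" for U'
  proof -
    have "\<not> \<kappa> ` U' \<subset> \<kappa> ` U"
      using F.dim_psubspace_less[OF B(1), of "\<kappa> ` U" "\<kappa> ` U'"] B(2) U(2)[OF U'(1)] U'
        subspace_image[of U'] by (auto simp: stable_between_def not_less)
    then have eq: "\<kappa> ` U' = \<kappa> ` U" using U'(2) by blast
    have "u \<in> U'" if "u \<in> U" for u
    proof -
      obtain u' where u': "u' \<in> U'" "\<kappa> u = \<kappa> u'" using eq \<open>u \<in> U\<close> by blast
      then have "u - u' \<in> psi_kernel" by (simp add: kappa_eq)
      then have "u - u' \<in> U'" using U'(1) by (auto simp: stable_between_def)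
      moreover have "subspace U'" using U'(1) by (simp add: stable_between_def)
      ultimately have "u' + (u - u') \<in> U'" using u'(1) subspace_add by blast
      then show ?thesis by simp
    qed
    then show ?thesis using U'(2) by blast
  qed
  with U(1) show ?thesis by blast
qed

end

locale ham_quotient = ham_coordinates scale h d2 \<kappa> \<sigma>
  for scale :: "complex \<Rightarrow> 'm::ab_group_add \<Rightarrow> 'm" and h d2 \<kappa> \<sigma> +
  fixes U :: "'m set"
  assumes U: "stable_between U" and minimal: "\<And>U'. stable_between U' \<Longrightarrow> U' \<subseteq> U \<Longrightarrow> U' = U"
begin

definition V :: "fvec set" where "V = \<kappa> ` U"

lemma U_facts: "subspace U" "psi_kernel \<subseteq> U" "U \<subseteq> cubic_kernel" "u \<in> U \<Longrightarrow> d1 u \<in> U" "u \<in> U \<Longrightarrow> d2 u \<in> U"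
  "u \<in> U \<Longrightarrow> X 1 u \<in> U" "u \<in> U \<Longrightarrow> X' 1 u \<in> U"
  using U by (auto simp: stable_between_def)

lemma subspace_V: "F.subspace V" unfolding V_def by (rule subspace_image) (rule U_facts)

lemma kappa_sigma_V: "v \<in> V \<Longrightarrow> \<kappa> (\<sigma> v) = v"
  using kappa_sigma by (auto simp: V_def)

lemma sigma_V: "v \<in> V \<Longrightarrow> \<sigma> v \<in> U"
proof -
  assume "v \<in> V"
  then obtain u where u: "u \<in> U" "v = \<kappa> u" by (auto simp: V_def)
  then have "\<sigma> v - u \<in> U" using kappa_sigma[of u] U_facts(2) by (auto simp: kappa_eq)
  then have "(\<sigma> v - u) + u \<in> U" using u(1) subspace_add[OF U_facts(1)] by blast
  then show ?thesis by simp
qed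

text \<open>
  The matrix unit \<open>E\<^sub>i\<^sub>j\<close> acts as \<open>t\<^sub>i\<partial>\<^sub>j\<close>, corrected by minus the divergence on the diagonal; the correction
  compensates the divergence twist of the polynomial factor.
\<close>

definition gl2_op :: "complex^2^2 \<Rightarrow> 'm \<Rightarrow> 'm" where
  "gl2_op A u = scale (A $ 1 $ 1) (d1 u - u) + scale (A $ 2 $ 2) (d2 u - u)
    + scale (A $ 1 $ 2) (X' 1 u) + scale (A $ 2 $ 1) (X 1 u)"

lemma endo_gl2_op: "endo scale (gl2_op A)"
  by (rule linI)
    (simp_all add: gl2_op_def lin_add[OF endo_d1] lin_scale[OF endo_d1] d2s lin_add[OF endo_X] lin_scale[OF endo_X]
      lin_add[OF endo_X'] lin_scale[OF endo_X'] scale_right_distrib scale_right_diff_distrib mult.commute)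

lemma gl2_op_kernel: "m \<in> psi_kernel \<Longrightarrow> gl2_op A m \<in> psi_kernel"
  unfolding gl2_op_def
  by (intro subspace_add[OF subspace_kernel] subspace_scale[OF subspace_kernel] subspace_diff[OF subspace_kernel]
      d1_kernel d2_kernel X1_kernel X1'_kernel)

lemma gl2_op_U: "m \<in> U \<Longrightarrow> gl2_op A m \<in> U"
  unfolding gl2_op_def
  by (intro subspace_add[OF U_facts(1)] subspace_scale[OF U_facts(1)] subspace_diff[OF U_facts(1)] U_facts)

definition rho :: "complex^2^2 \<Rightarrow> fvec \<Rightarrow> fvec" where "rho A = induced (gl2_op A)"

lemma rho_kappa: "rho A (\<kappa> m) = \<kappa> (gl2_op A m)"
  unfolding rho_def by (rule induced_kappa[OF endo_gl2_op gl2_op_kernel])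

lemma rho_V: "v \<in> V \<Longrightarrow> rho A v \<in> V"
  using gl2_op_U by (auto simp: V_def rho_kappa)

lemma X1_X1': "X 1 (X' 1 u) = X' 1 (X 1 u) + d2 u - d1 u"
proof -
  have "h 0 2 (h 2 0 u) = h 2 0 (h 0 2 u) + scale 4 (h 1 1 u)"
    using h_comm[of 0 2 2 0 u] by simp
  then have "scale (-1/4) (h 0 2 (h 2 0 u)) = scale (-1/4) (h 2 0 (h 0 2 u)) - h 1 1 u"
    by (simp add: scale_right_distrib)
  then show ?thesis
    by (simp add: X_def X'_def hs d1_def numeral_2_eq_2)
qed

lemma d_X1: "d1 (X 1 u) = X 1 (d1 u) - X 1 u" "d1 (X' 1 u) = X' 1 (d1 u) + X' 1 u" "d2 (X' 1 u) = X' 1 (d2 u) - X' 1 u"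
  using d1_comm[of 0 2 u] d1_comm[of 2 0 u] d2_comm[of 2 0 u]
  by (simp_all add: X_def X'_def hs d2s lin_scale[OF endo_d1] lin_minus[OF endo_d1] numeral_2_eq_2
     scale_right_distrib scale_right_diff_distrib)

lemma gl2_op_bracket: "gl2_op (mat_bracket A B) u = gl2_op A (gl2_op B u) - gl2_op B (gl2_op A u)"
proof -
  have l: "endo scale (X 1)" "endo scale (X' 1)" by (rule endo_X, rule endo_X')
  define c where "c = A$1$2 * B$2$1 - A$2$1 * B$1$2"
  have e: "mat_bracket A B $ 1 $ 1 = c" "mat_bracket A B $ 2 $ 2 = - c"
    "mat_bracket A B $ 1 $ 2 = (A$1$1 - A$2$2) * B$1$2 - (B$1$1 - B$2$2) * A$1$2"
    "mat_bracket A B $ 2 $ 1 = (A$2$2 - A$1$1) * B$2$1 - (B$2$2 - B$1$1) * A$2$1"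
    by (simp_all add: mat_bracket_def matrix_matrix_mult_def sum_2 c_def algebra_simps)
  have "gl2_op (mat_bracket A B) u = scale c (d1 u - d2 u)
     + scale ((A$1$1 - A$2$2) * B$1$2 - (B$1$1 - B$2$2) * A$1$2) (X' 1 u)
     + scale ((A$2$2 - A$1$1) * B$2$1 - (B$2$2 - B$1$1) * A$2$1) (X 1 u)"
    unfolding gl2_op_def e by (simp add: scale_right_diff_distrib)
  also have "\<dots> = gl2_op A (gl2_op B u) - gl2_op B (gl2_op A u)"
    unfolding gl2_op_def lin_add[OF endo_d1] lin_scale[OF endo_d1] lin_diff[OF endo_d1] d2s
      lin_add[OF l(1)] lin_scale[OF l(1)] lin_diff[OF l(1)]
      lin_add[OF l(2)] lin_scale[OF l(2)] lin_diff[OF l(2)] d_X1 d2_X1 X1_X1' d1_d2 c_def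
      scale_right_distrib scale_right_diff_distrib scale_left_diff_distrib scale_scale
    by (simp add: algebra_simps)
  finally show ?thesis .
qed

lemma gl2_module: "lie_module mat_scale mat_bracket UNIV cscale V rho"
proof (intro lie_module.intro lie_algebra_gl2 vector_space_cscale lie_module_axioms.intro)
  fix A B :: "complex^2^2" and v w :: fvec and c
  show "F.subspace V" by (rule subspace_V)
  assume v: "v \<in> V"
  then obtain u where u: "u \<in> U" "v = \<kappa> u" by (auto simp: V_def)
  show "rho A v \<in> V" by (rule rho_V[OF v])
  show "rho (A + B) v = rho A v + rho B v"
    by (simp add: u rho_kappa gl2_op_def lin_add[OF kappa, symmetric] scale_left_distrib algebra_simps)
  show "rho (mat_scale c A) v = cscale c (rho A v)"
    by (simp add: u rho_kappa gl2_op_def lin_scale[OF kappa, symmetric] mat_scale_def scale_right_distrib)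
  show "rho A (cscale c v) = cscale c (rho A v)" unfolding rho_def by (rule lin_scale[OF endo_induced[OF endo_gl2_op]])
  show "rho (mat_bracket A B) v = rho A (rho B v) - rho B (rho A v)"
    by (simp add: u rho_kappa gl2_op_bracket lin_diff[OF kappa])
  show "rho A (v + w) = rho A v + rho A w" unfolding rho_def by (rule lin_add[OF endo_induced[OF endo_gl2_op]])
qed

lemma matE_entries [simp]: "matE i j $ k $ l = (if k = i \<and> l = j then 1 else 0)"
  by (simp add: matE_def axis_def)

lemma gl2_op_matE: "gl2_op (matE 1 1) u = d1 u - u" "gl2_op (matE 2 2) u = d2 u - u" "gl2_op (matE 1 2) u = X' 1 u" "gl2_op (matE 2 1) u = X 1 u"
  by (simp_all add: gl2_op_def)

lemma V_nonzero: "V \<noteq> {0}"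
proof -
  obtain u where "u \<in> U" "u \<notin> psi_kernel" using U by (auto simp: stable_between_def)
  then have "\<kappa> u \<in> V" "\<kappa> u \<noteq> 0" using kernel by (auto simp: V_def)
  then show ?thesis by auto
qed

text \<open>
  A \<open>gl\<^sub>2\<close>-submodule is also stable under \<open>d\<^sub>1, d\<^sub>2\<close>, since these differ from \<open>E\<^sub>1\<^sub>1, E\<^sub>2\<^sub>2\<close> by scalars. So
  its preimage in \<open>U\<close> competes with \<open>U\<close> for minimality.
\<close>

lemma gl2_simple: "simple_fd_gl2_module V rho"
  unfolding simple_fd_gl2_module_def
proof (intro conjI)
  show "lie_module mat_scale mat_bracket UNIV cscale V rho" by (rule gl2_module)
  obtain B where "finite B" "F.span B = range \<kappa>" using range_finite by (auto simp: finite_dim_def)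
  then show "finite_dim cscale V"
    using F.subspace_finite_dim[OF _ _ subspace_V, of B "range \<kappa>"] by (auto simp: finite_dim_def V_def)
  show "simple_module UNIV cscale V rho"
    unfolding simple_module_def
  proof (intro conjI V_nonzero allI impI)
    fix V' assume "submodule UNIV cscale V rho V'"
    then have V': "F.subspace V'" "V' \<subseteq> V" "\<And>A v. v \<in> V' \<Longrightarrow> rho A v \<in> V'" by (auto simp: submodule_def)
    show "V' = {0} \<or> V' = V"
    proof (cases "V' = {0}")
      case False
      define U' where "U' = {u \<in> U. \<kappa> u \<in> V'}"
      have "stable_between U'"
        unfolding stable_between_def
      proof (intro conjI ballI)
        show "subspace U'"
          by (rule subspaceI)
            (auto simp: U'_def lin_add[OF kappa] lin_scale[OF kappa] lin_0[OF kappa] subspace_add[OF U_facts(1)]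
              subspace_scale[OF U_facts(1)] subspace_0[OF U_facts(1)] F.subspace_add[OF V'(1)]
              F.subspace_scale[OF V'(1)] F.subspace_0[OF V'(1)])
        show "U' \<subseteq> cubic_kernel" using U_facts(3) by (auto simp: U'_def)
        have "psi_kernel \<subseteq> U'" using U_facts(2) kernel F.subspace_0[OF V'(1)] by (force simp: U'_def)
        moreover obtain v where v: "v \<in> V'" "v \<noteq> 0" using False F.subspace_0[OF V'(1)] by blast
        then obtain u where "u \<in> U" "v = \<kappa> u" using V'(2) by (auto simp: V_def)
        then have "u \<in> U'" "u \<notin> psi_kernel" using v kernel by (auto simp: U'_def)
        ultimately show "psi_kernel \<subset> U'" by blast
      next
        fix u assume u: "u \<in> U'"
        then have k: "\<kappa> u \<in> V'" and uU: "u \<in> U" by (auto simp: U'_def)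
        have r: "\<kappa> (gl2_op A u) \<in> V'" for A using V'(3)[OF k, of A] by (simp add: rho_kappa)
        have "\<kappa> (d1 u) = \<kappa> (gl2_op (matE 1 1) u) + \<kappa> u" "\<kappa> (d2 u) = \<kappa> (gl2_op (matE 2 2) u) + \<kappa> u"
          by (simp_all add: gl2_op_matE lin_diff[OF kappa])
        then have "\<kappa> (d1 u) \<in> V'" "\<kappa> (d2 u) \<in> V'" using r k F.subspace_add[OF V'(1)] by auto
        then show "d1 u \<in> U'" "d2 u \<in> U'" using U_facts uU by (auto simp: U'_def)
        show "X 1 u \<in> U'" "X' 1 u \<in> U'"
          using r[of "matE 2 1"] r[of "matE 1 2"] U_facts uU by (auto simp: U'_def gl2_op_matE)
      qed
      then have "U' = U" by (rule minimal) (auto simp: U'_def)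
      then have "V \<subseteq> V'" by (auto simp: U'_def V_def)
      then show ?thesis using V'(2) by blast
    qed simp
  qed
qed

end

section \<open>Tensor modules\<close>

lemma tens_zero [simp]: "0 \<otimes>\<^sub>A v = 0" "p \<otimes>\<^sub>A 0 = 0"
  by (rule poly_mapping_eqI, simp add: lookup_tens, rule poly_mapping_eqI, simp)+

lemma tens_minus: "(- p) \<otimes>\<^sub>A v = - (p \<otimes>\<^sub>A v)" "p \<otimes>\<^sub>A (- v) = - (p \<otimes>\<^sub>A v)"
  using tens_bilinear(1)[of p "- p" v] tens_bilinear(2)[of p v "- v"]
  by (simp_all add: eq_neg_iff_add_eq_0 add.commute)

lemma tens_diff: "(p - q) \<otimes>\<^sub>A v = p \<otimes>\<^sub>A v - q \<otimes>\<^sub>A v" "p \<otimes>\<^sub>A (v - w) = p \<otimes>\<^sub>A v - p \<otimes>\<^sub>A w"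
  using tens_bilinear(1)[of p "- q" v] tens_bilinear(2)[of p v "- w"] by (simp_all add: tens_minus)

lemma vector_space_T_scale: "vector_space T_scale"
  by (rule vector_space_pm_scale[OF vector_space_cscale])

lemma lookup_T_scale [simp]: "Poly_Mapping.lookup (T_scale c P) k = cscale c (Poly_Mapping.lookup P k)"
  by (rule lookup_pm_scale[OF vector_space_cscale])

abbreviation tmono :: "nat \<times> nat \<Rightarrow> A2" where "tmono k \<equiv> Poly_Mapping.single k 1"

lemma sum_tens: "P = (\<Sum>k\<in>Poly_Mapping.keys P. tmono k \<otimes>\<^sub>A Poly_Mapping.lookup P k)"
proof (rule poly_mapping_eqI)
  fix l
  interpret vector_space "cscale :: complex \<Rightarrow> fvec \<Rightarrow> fvec" by (rule vector_space_cscale)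
  have "Poly_Mapping.lookup (\<Sum>k\<in>Poly_Mapping.keys P. tmono k \<otimes>\<^sub>A Poly_Mapping.lookup P k) l
      = (\<Sum>k\<in>Poly_Mapping.keys P. if k = l then Poly_Mapping.lookup P k else 0)"
    by (simp add: lookup_sum lookup_tens lookup_single when_def if_distrib[of "\<lambda>c. cscale c _"] cong: if_cong)
  also have "\<dots> = Poly_Mapping.lookup P l" by (simp add: in_keys_iff)
  finally show "Poly_Mapping.lookup P l = Poly_Mapping.lookup (\<Sum>k\<in>Poly_Mapping.keys P. tmono k \<otimes>\<^sub>A Poly_Mapping.lookup P k) l" by simp
qed

lemma tw_apply_simps:
  "tw_apply X (p + q) = tw_apply X p + tw_apply X q"
  "tw_apply X (f * p) = vf_apply X f * p + f * tw_apply X p"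
  "tw_apply X (cscale c p) = cscale c (tw_apply X p)"
  "tw_apply (X + Y) p = tw_apply X p + tw_apply Y p"
  "tw_apply (vf_scale c X) p = cscale c (tw_apply X p)"
  "tw_apply (vf_bracket X Y) p = tw_apply X (tw_apply Y p) - tw_apply Y (tw_apply X p)"
  by (simp_all add: tw_apply_def vf_apply_def vf_scale_def vf_bracket_def pd_add pd1_mult pd2_mult cscale_eq_mult
    pd_commute algebra_simps)

lemma jacobian_bracket:
  "pd1 (fst (vf_bracket X Y)) = vf_apply X (pd1 (fst Y)) - vf_apply Y (pd1 (fst X))
     + (pd1 (snd X) * pd2 (fst Y) - pd1 (snd Y) * pd2 (fst X))"
  "pd2 (fst (vf_bracket X Y)) = vf_apply X (pd2 (fst Y)) - vf_apply Y (pd2 (fst X))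
     + (pd2 (fst X) * pd1 (fst Y) + pd2 (snd X) * pd2 (fst Y) - pd2 (fst Y) * pd1 (fst X) - pd2 (snd Y) * pd2 (fst X))"
  "pd1 (snd (vf_bracket X Y)) = vf_apply X (pd1 (snd Y)) - vf_apply Y (pd1 (snd X))
     + (pd1 (fst X) * pd1 (snd Y) + pd1 (snd X) * pd2 (snd Y) - pd1 (fst Y) * pd1 (snd X) - pd1 (snd Y) * pd2 (snd X))"
  "pd2 (snd (vf_bracket X Y)) = vf_apply X (pd2 (snd Y)) - vf_apply Y (pd2 (snd X))
     + (pd2 (fst X) * pd1 (snd Y) - pd2 (fst Y) * pd1 (snd X))"
  by (simp_all add: vf_bracket_def vf_apply_def pd_add pd_diff pd1_mult pd2_mult pd_commute algebra_simps)

text \<open>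
  The tensor module extends to all polynomial vector fields \<open>f\<^sub>1\<partial>\<^sub>1 + f\<^sub>2\<partial>\<^sub>2\<close>: the Jacobian entry \<open>\<partial>\<^sub>jf\<^sub>i\<close> acts with
  \<open>E\<^sub>j\<^sub>i\<close>. In this form the bracket relation is the chain rule for Jacobians, \<open>jacobian_bracket\<close>, combined with the
  commutators of matrix units.
\<close>

locale gl2_rep =
  fixes V :: "fvec set" and rho :: "complex^2^2 \<Rightarrow> fvec \<Rightarrow> fvec"
  assumes gl2: "lie_module mat_scale mat_bracket UNIV cscale V rho"
begin

sublocale V: lie_module mat_scale mat_bracket UNIV cscale V rho by (rule gl2)

sublocale T: vector_space T_scale by (rule vector_space_T_scale)

lemma subspace_T: "T.subspace (T_space V)"
  by (rule T.subspaceI)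
    (auto simp: T_space_def lookup_add intro: V.V.subspace_0 V.V.subspace_add V.V.subspace_scale V.subspace_M)

lemma tens_T: "v \<in> V \<Longrightarrow> p \<otimes>\<^sub>A v \<in> T_space V"
  by (simp add: T_space_def lookup_tens V.V.subspace_scale[OF V.subspace_M])

lemma T_induct [consumes 1, case_names zero tens add]:
  assumes "P \<in> T_space V" "Q 0" "\<And>k v. v \<in> V \<Longrightarrow> Q (tmono k \<otimes>\<^sub>A v)"
    "\<And>P P'. P \<in> T_space V \<Longrightarrow> P' \<in> T_space V \<Longrightarrow> Q P \<Longrightarrow> Q P' \<Longrightarrow> Q (P + P')"
  shows "Q P"
proof -
  have l: "Poly_Mapping.lookup P k \<in> V" for k using assms(1) unfolding T_space_def by blast
  have "finite K \<Longrightarrow> (\<Sum>k\<in>K. tmono k \<otimes>\<^sub>A Poly_Mapping.lookup P k) \<in> T_space V \<and>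
     Q (\<Sum>k\<in>K. tmono k \<otimes>\<^sub>A Poly_Mapping.lookup P k)" for K
    by (induction K rule: finite_induct)
      (auto simp: assms l T.subspace_0[OF subspace_T] intro!: T.subspace_add[OF subspace_T] assms(3,4) tens_T)
  from this[of "Poly_Mapping.keys P"] show ?thesis using sum_tens[of P] by simp
qed

definition T_form :: "vf \<Rightarrow> A2 \<Rightarrow> fvec \<Rightarrow> ((nat \<times> nat) \<Rightarrow>\<^sub>0 fvec)" where
  "T_form X p v = tw_apply X p \<otimes>\<^sub>A v + (pd1 (fst X) * p) \<otimes>\<^sub>A rho (matE 1 1) v + (pd2 (fst X) * p) \<otimes>\<^sub>A rho (matE 2 1) v
     + (pd1 (snd X) * p) \<otimes>\<^sub>A rho (matE 1 2) v + (pd2 (snd X) * p) \<otimes>\<^sub>A rho (matE 2 2) v"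

lemma T_form_add: "T_form X (p + q) v = T_form X p v + T_form X q v"
  by (simp add: T_form_def tw_apply_simps distrib_left tens_bilinear)

lemma T_form_add_right: "v \<in> V \<Longrightarrow> w \<in> V \<Longrightarrow> T_form X p (v + w) = T_form X p v + T_form X p w"
  by (simp add: T_form_def V.act_add tens_bilinear)

lemma cscale_mult_right: "f * cscale c p = cscale c (f * p)" for f p :: A2
  by (simp add: cscale_eq_mult mult.left_commute)

lemma T_form_scale: "T_form X (cscale c p) v = T_scale c (T_form X p v)"
  by (simp add: T_form_def tw_apply_simps tens_bilinear cscale_mult_right T.scale_right_distrib)

lemma T_form_scale_right: "v \<in> V \<Longrightarrow> T_form X p (cscale c v) = T_scale c (T_form X p v)"
  by (simp add: T_form_def V.act_scale tens_bilinear T.scale_right_distrib)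

text \<open>
  The universal property of the tensor product extends \<open>T_form X\<close> to a linear operator.
\<close>

definition T_lin where
  "T_lin X h \<longleftrightarrow> (\<forall>P\<in>T_space V. \<forall>Q\<in>T_space V. h (P + Q) = h P + h Q) \<and>
      (\<forall>c. \<forall>P\<in>T_space V. h (T_scale c P) = T_scale c (h P)) \<and>
      (\<forall>p. \<forall>v\<in>V. h (p \<otimes>\<^sub>A v) = T_form X p v)"

definition actT where "actT X = (SOME h. T_lin X h)"

lemma actT: "T_lin X (actT X)"
proof -
  have "\<exists>h. T_lin X h"
    using tens_universal[OF V.subspace_M vector_space_T_scale, of "T_form X",
        OF T_form_add T_form_add_right T_form_scale T_form_scale_right]
    unfolding T_lin_def by blast
  then show ?thesis unfolding actT_def by (rule someI_ex)
qed

lemma actT_add: "P \<in> T_space V \<Longrightarrow> Q \<in> T_space V \<Longrightarrow> actT X (P + Q) = actT X P + actT X Q"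
  and actT_scale: "P \<in> T_space V \<Longrightarrow> actT X (T_scale c P) = T_scale c (actT X P)"
  and actT_tens: "v \<in> V \<Longrightarrow> actT X (p \<otimes>\<^sub>A v) = T_form X p v"
  using actT[of X] by (auto simp: T_lin_def)

lemma actT_0: "actT X 0 = 0"
  using actT_scale[of 0 X 0] T.subspace_0[OF subspace_T] by simp

lemma T_form_T: "v \<in> V \<Longrightarrow> T_form X p v \<in> T_space V"
  unfolding T_form_def by (intro T.subspace_add[OF subspace_T] tens_T V.act_closed) auto

lemma actT_closed: "P \<in> T_space V \<Longrightarrow> actT X P \<in> T_space V"
  by (induction P rule: T_induct)
    (auto simp: actT_0 T.subspace_0[OF subspace_T] actT_tens T_form_T actT_add T.subspace_add[OF subspace_T])

text \<open>
  Oriented as rewrite rules that sort products of matrix units, to compare both sides of the bracket relation.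
\<close>

lemma matE_bracket:
  assumes v: "v \<in> V"
  shows "rho (matE 1 2) (rho (matE 1 1) v) = rho (matE 1 1) (rho (matE 1 2) v) - rho (matE 1 2) v"
    "rho (matE 2 1) (rho (matE 1 1) v) = rho (matE 1 1) (rho (matE 2 1) v) + rho (matE 2 1) v"
    "rho (matE 2 2) (rho (matE 1 1) v) = rho (matE 1 1) (rho (matE 2 2) v)"
    "rho (matE 2 1) (rho (matE 1 2) v) = rho (matE 1 2) (rho (matE 2 1) v) - rho (matE 1 1) v + rho (matE 2 2) v"
    "rho (matE 2 2) (rho (matE 1 2) v) = rho (matE 1 2) (rho (matE 2 2) v) - rho (matE 1 2) v"
    "rho (matE 2 2) (rho (matE 2 1) v) = rho (matE 2 1) (rho (matE 2 2) v) + rho (matE 2 1) v"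
proof -
  have m: "rho (A - B) v = rho A v - rho B v" for A B
    using V.act_add_left[of "A - B" B v] v by simp
  have z: "rho 0 v = 0" using m[of 0 0] by simp
  have b: "mat_bracket (matE 1 1) (matE 1 2) = matE 1 2" "mat_bracket (matE 2 1) (matE 1 1) = matE 2 1"
    "mat_bracket (matE 2 2) (matE 1 1) = 0" "mat_bracket (matE 1 2) (matE 2 1) = matE 1 1 - matE 2 2"
    "mat_bracket (matE 1 2) (matE 2 2) = matE 1 2" "mat_bracket (matE 2 2) (matE 2 1) = matE 2 1"
    by (simp_all add: mat_bracket_def matE_def axis_def vec_eq_iff matrix_matrix_mult_def sum_2 forall_2)
  note c = V.act_bracket[OF UNIV_I UNIV_I v]
  show "rho (matE 1 2) (rho (matE 1 1) v) = rho (matE 1 1) (rho (matE 1 2) v) - rho (matE 1 2) v"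
    using c[of "matE 1 1" "matE 1 2"] unfolding b by (simp add: algebra_simps)
  show "rho (matE 2 1) (rho (matE 1 1) v) = rho (matE 1 1) (rho (matE 2 1) v) + rho (matE 2 1) v"
    using c[of "matE 2 1" "matE 1 1"] unfolding b by (simp add: algebra_simps)
  show "rho (matE 2 2) (rho (matE 1 1) v) = rho (matE 1 1) (rho (matE 2 2) v)"
    using c[of "matE 2 2" "matE 1 1"] unfolding b z by (simp add: algebra_simps)
  show "rho (matE 2 1) (rho (matE 1 2) v) = rho (matE 1 2) (rho (matE 2 1) v) - rho (matE 1 1) v + rho (matE 2 2) v"
    using c[of "matE 1 2" "matE 2 1"] unfolding b m by (simp add: algebra_simps)
  show "rho (matE 2 2) (rho (matE 1 2) v) = rho (matE 1 2) (rho (matE 2 2) v) - rho (matE 1 2) v"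
    using c[of "matE 1 2" "matE 2 2"] unfolding b by (simp add: algebra_simps)
  show "rho (matE 2 2) (rho (matE 2 1) v) = rho (matE 2 1) (rho (matE 2 2) v) + rho (matE 2 1) v"
    using c[of "matE 2 2" "matE 2 1"] unfolding b by (simp add: algebra_simps)
qed

lemma actT_T_form:
  assumes v: "v \<in> V"
  shows "actT X (T_form Y p v) = T_form X (tw_apply Y p) v + T_form X (pd1 (fst Y) * p) (rho (matE 1 1) v)
    + T_form X (pd2 (fst Y) * p) (rho (matE 2 1) v) + T_form X (pd1 (snd Y) * p) (rho (matE 1 2) v)
    + T_form X (pd2 (snd Y) * p) (rho (matE 2 2) v)"
proof -
  have r: "rho A v \<in> V" for A using V.act_closed v by simp
  show ?thesis
    unfolding T_form_def[of Y]
    by (simp add: actT_add actT_tens tens_T v r T.subspace_add[OF subspace_T])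
qed

lemma T_form_bracket:
  assumes v: "v \<in> V"
  shows "T_form (vf_bracket X Y) p v = actT X (T_form Y p v) - actT Y (T_form X p v)"
  unfolding actT_T_form[OF v]
  unfolding T_form_def jacobian_bracket tw_apply_simps matE_bracket[OF v] tens_bilinear tens_diff
    distrib_left distrib_right left_diff_distrib right_diff_distrib
  by (simp add: algebra_simps)

lemma T_lie_module: "lie_module vf_scale vf_bracket Sbar2 T_scale (T_space V) actT"
proof (intro lie_module.intro lie_algebra_Sbar2 vector_space_T_scale lie_module_axioms.intro)
  fix X Y :: vf and P Q :: "(nat \<times> nat) \<Rightarrow>\<^sub>0 fvec" and c
  show "T.subspace (T_space V)" by (rule subspace_T)
  assume P: "P \<in> T_space V"
  show "actT X P \<in> T_space V" by (rule actT_closed[OF P])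
  show "actT X (T_scale c P) = T_scale c (actT X P)" by (rule actT_scale[OF P])
  show "actT (X + Y) P = actT X P + actT Y P"
    using P
  proof (induction P rule: T_induct)
    case (tens k v)
    then show ?case
      by (simp add: actT_tens T_form_def tw_apply_simps pd_add distrib_right tens_bilinear algebra_simps)
  qed (simp_all add: actT_0 actT_add)
  show "actT (vf_scale c X) P = T_scale c (actT X P)"
    using P
  proof (induction P rule: T_induct)
    case (tens k v)
    have m: "cscale c p * q = cscale c (p * q)" for p q :: A2 by (simp add: cscale_eq_mult mult.assoc)
    show ?case using tens
      by (simp only: actT_tens T_form_def tw_apply_simps(5))
        (simp add: vf_scale_def pd_cscale m tens_bilinear T.scale_right_distrib)
  qed (simp_all add: actT_0 actT_add T.scale_right_distrib)
  show "actT (vf_bracket X Y) P = actT X (actT Y P) - actT Y (actT X P)"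
    using P
  proof (induction P rule: T_induct)
    case (tens k v)
    then show ?case by (simp add: actT_tens T_form_bracket)
  next
    case (add P P')
    then show ?case by (simp add: actT_add actT_closed)
  qed (simp add: actT_0)
  show "Q \<in> T_space V \<Longrightarrow> actT X (P + Q) = actT X P + actT X Q" by (rule actT_add[OF P])
qed

lemma pd_cmono:
  assumes "c = 0 \<or> (i \<ge> 0 \<and> j \<ge> 0)"
  shows "pd1 (cmono c i j) = cmono (c * i) (i - 1) j" "pd2 (cmono c i j) = cmono (c * j) i (j - 1)"
proof -
  have n: "nat (k - 1) = nat k - 1" for k :: int by simp
  show "pd1 (cmono c i j) = cmono (c * i) (i - 1) j" "pd2 (cmono c i j) = cmono (c * j) i (j - 1)"
    using assms by (auto simp: cmono_def pd1_single pd2_single n mult.commute)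
qed

lemma T_module_actT: "T_module V rho actT"
  unfolding T_module_def
proof (intro conjI T_lie_module allI ballI impI)
  fix p v assume v: "v \<in> V"
  have z: "fst dd2 = 0" "pd1 (snd dd2) = 0" "pd2 (snd dd2) = 1"
    by (simp_all add: dd2_def cmono_def pd1_single pd2_single flip: zero_prod_def)
  show "actT dd2 (p \<otimes>\<^sub>A v) = tw_apply dd2 p \<otimes>\<^sub>A v + p \<otimes>\<^sub>A rho (matE 2 2) v"
    using v by (simp add: actT_tens T_form_def z)
next
  fix a1 a2 :: int and p v
  assume v: "v \<in> V" and a: "a1 \<ge> -1 \<and> a2 \<ge> -1 \<and> (a1, a2) \<noteq> (-1, -1)"
  have c: "1 + a2 = 0 \<or> a1 + 1 \<ge> 0 \<and> a2 \<ge> 0" "1 + a1 = 0 \<or> a1 \<ge> 0 \<and> a2 + 1 \<ge> 0"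
    using a by linarith+
  have j: "pd1 (fst (L a1 a2)) = cmono ((1 + a1) * (1 + a2)) a1 a2"
    "pd2 (fst (L a1 a2)) = cmono (a2 * (1 + a2)) (a1 + 1) (a2 - 1)"
    "pd1 (snd (L a1 a2)) = - cmono (a1 * (1 + a1)) (a1 - 1) (a2 + 1)"
    "pd2 (snd (L a1 a2)) = - cmono ((1 + a1) * (1 + a2)) a1 a2"
    unfolding L_def fst_conv snd_conv pd_minus pd_cmono[OF c(1)] pd_cmono[OF c(2)]
    by (simp_all add: algebra_simps)
  have r: "rho (matE 1 1 - matE 2 2) v = rho (matE 1 1) v - rho (matE 2 2) v"
    using V.act_add_left[of "matE 1 1 - matE 2 2" "matE 2 2" v] v by simp
  show "actT (L a1 a2) (p \<otimes>\<^sub>A v) =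
        tw_apply (L a1 a2) p \<otimes>\<^sub>A v
        + (cmono ((1 + a1) * (1 + a2)) a1 a2 * p) \<otimes>\<^sub>A rho (matE 1 1 - matE 2 2) v
        + (cmono (a2 * (1 + a2)) (a1 + 1) (a2 - 1) * p) \<otimes>\<^sub>A rho (matE 2 1) v
        - (cmono (a1 * (1 + a1)) (a1 - 1) (a2 + 1) * p) \<otimes>\<^sub>A rho (matE 1 2) v"
    using v by (simp add: actT_tens T_form_def j r tens_diff tens_minus)
qed

end

section \<open>Simple quotients from surjections\<close>

text \<open>
  Cosets of the kernel are the fibres of \<open>\<phi>\<close>, so submodules of the quotient correspond to submodules of \<open>M'\<close>.
\<close>

lemma simple_quotient_of_surjection:
  fixes s :: "complex \<Rightarrow> 'm::ab_group_add \<Rightarrow> 'm" and s' :: "complex \<Rightarrow> 'n::ab_group_add \<Rightarrow> 'n"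
  assumes M: "lie_module gs br g s M act" and M': "lie_module gs br g s' M' act'"
    and add: "\<And>v w. v \<in> M \<Longrightarrow> w \<in> M \<Longrightarrow> \<phi> (v + w) = \<phi> v + \<phi> w"
    and scale: "\<And>c v. v \<in> M \<Longrightarrow> \<phi> (s c v) = s' c (\<phi> v)"
    and equi: "\<And>x v. x \<in> g \<Longrightarrow> v \<in> M \<Longrightarrow> \<phi> (act x v) = act' x (\<phi> v)"
    and surj: "\<phi> ` M = M'" and simple: "simple_module g s' M' act'"
  defines "N \<equiv> {v \<in> M. \<phi> v = 0}"
  shows "simple_quotient g s M act N" "\<exists>f. quotient_iso g s M act N s' M' act' f"
proof -
  interpret M: lie_module gs br g s M act by fact
  interpret M': lie_module gs br g s' M' act' by fact
  note sub = M.subspace_M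
  have zero: "\<phi> 0 = 0" using scale[of 0 0] M.V.subspace_0[OF sub] by simp
  have diff: "\<phi> (v - w) = \<phi> v - \<phi> w" if "v \<in> M" "w \<in> M" for v w
    using add[of "v - w" w] that M.V.subspace_diff[OF sub] by simp
  have act0: "act' x 0 = 0" if "x \<in> g" for x
    using M'.act_scale[OF that M'.V.subspace_0[OF M'.subspace_M], of 0] by simp
  have N: "submodule g s M act N"
    unfolding submodule_def N_def
    by (auto intro!: M.V.subspaceI simp: add scale zero equi act0 M.act_closed
        M.V.subspace_0[OF sub] M.V.subspace_add[OF sub] M.V.subspace_scale[OF sub])
  have vs: "vector_space s" by (rule M.V.vector_space_axioms)
  note ops = coset_ops[OF vs N M]
  have coset_image: "\<phi> ` (v +o N) = {\<phi> v}" if v: "v \<in> M" for v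
  proof -
    have "v \<in> v +o N" using zero M.V.subspace_0[OF sub] by (auto simp: elt_set_plus_def N_def intro!: bexI[of _ 0])
    moreover have "\<phi> w = \<phi> v" if "w \<in> v +o N" for w
      using that v by (auto simp: elt_set_plus_def N_def add)
    ultimately show ?thesis by blast
  qed
  have coset_eq: "v +o N = w +o N" if "v \<in> M" "w \<in> M" "\<phi> v = \<phi> w" for v w
  proof -
    have "v +o N \<subseteq> w +o N" if "v \<in> M" "w \<in> M" "\<phi> v = \<phi> w" for v w
    proof
      fix z assume "z \<in> v +o N"
      then obtain n where n: "n \<in> N" "z = v + n" by (auto simp: elt_set_plus_def)
      have "(v - w) + n \<in> N"
        using n that M.V.subspace_diff[OF sub] M.V.subspace_add[OF sub] by (auto simp: N_def add diff)
      then show "z \<in> w +o N" using n by (auto simp: elt_set_plus_def intro!: bexI[of _ "(v - w) + n"])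
    qed
    from this[OF that] this[OF that(2,1) that(3)[symmetric]] show ?thesis by blast
  qed
  have N_coset: "v +o N = N \<longleftrightarrow> \<phi> v = 0" if v: "v \<in> M" for v
  proof -
    have z: "0 +o N = N" by simp
    have "0 \<in> M" using M.V.subspace_0[OF sub] .
    then show ?thesis using coset_eq[OF v \<open>0 \<in> M\<close>] coset_image[OF v] coset_image[of 0] z zero by (metis singleton_inject)
  qed
  define f where "f C = the_elem (\<phi> ` C)" for C
  have f: "f (v +o N) = \<phi> v" if "v \<in> M" for v using coset_image[OF that] by (simp add: f_def)
  have "quotient_iso g s M act N s' M' act' f"
    unfolding quotient_iso_def
  proof (intro conjI allI ballI)
    have "inj_on f (quot M N)"
    proof (rule inj_onI)
      fix C D assume "C \<in> quot M N" "D \<in> quot M N" "f C = f D"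
      moreover then obtain v w where "v \<in> M" "w \<in> M" "C = v +o N" "D = w +o N" by (auto simp: quot_def)
      ultimately show "C = D" using coset_eq[of v w] by (simp add: f)
    qed
    moreover have "f ` quot M N = M'" using surj unfolding quot_def by (simp add: image_image f)
    ultimately show "bij_betw f (quot M N) M'" by (simp add: bij_betw_def)
  next
    fix C D assume "C \<in> quot M N" "D \<in> quot M N"
    then obtain v w where "v \<in> M" "w \<in> M" "C = v +o N" "D = w +o N" by (auto simp: quot_def)
    then show "f (C + D) = f C + f D" by (simp add: ops f add M.V.subspace_add[OF sub])
  next
    fix c C assume "C \<in> quot M N"
    then obtain v where "v \<in> M" "C = v +o N" by (auto simp: quot_def)
    then show "f (quot_scale s N c C) = s' c (f C)" using ops(2)[of v v] by (simp add: f scale M.V.subspace_scale[OF sub])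
  next
    fix x C assume "x \<in> g" "C \<in> quot M N"
    then obtain v where "v \<in> M" "C = v +o N" by (auto simp: quot_def)
    then show "f (quot_act act N x C) = act' x (f C)"
      using ops(3)[of v v x] \<open>x \<in> g\<close> by (simp add: f equi M.act_closed)
  qed
  then show "\<exists>f. quotient_iso g s M act N s' M' act' f" by (rule exI[where x = f])
  have ne: "M' \<noteq> {0}" using simple by (simp add: simple_module_def)
  show "simple_quotient g s M act N"
    unfolding simple_quotient_def
  proof (intro conjI N allI impI)
    have "0 \<in> M'" by (rule M'.V.subspace_0[OF M'.subspace_M])
    then obtain v where "v \<in> M" "\<phi> v \<noteq> 0" using ne surj by blast
    then have "v +o N \<in> quot M N" "v +o N \<noteq> N" using N_coset by (auto simp: quot_def)
    then show "quot M N \<noteq> {N}" by blast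
  next
    fix Q assume "quot_submodule g s M act N Q"
    then have Q: "Q \<subseteq> quot M N" "N \<in> Q" "\<And>C D. C \<in> Q \<Longrightarrow> D \<in> Q \<Longrightarrow> C + D \<in> Q"
      "\<And>c C. C \<in> Q \<Longrightarrow> quot_scale s N c C \<in> Q" "\<And>x C. x \<in> g \<Longrightarrow> C \<in> Q \<Longrightarrow> quot_act act N x C \<in> Q"
      by (auto simp: quot_submodule_def)
    define K where "K = \<phi> ` {v \<in> M. v +o N \<in> Q}"
    have "submodule g s' M' act' K"
      unfolding submodule_def
    proof (intro conjI ballI)
      show "M'.V.subspace K"
      proof (rule M'.V.subspaceI)
        show "0 \<in> K" using Q(2) zero M.V.subspace_0[OF sub] by (force simp: K_def)
        show "u + w \<in> K" if "u \<in> K" "w \<in> K" for u w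
        proof -
          from that obtain a b where "a \<in> M" "b \<in> M" "a +o N \<in> Q" "b +o N \<in> Q" "u = \<phi> a" "w = \<phi> b"
            by (auto simp: K_def)
          moreover then have "(a + b) +o N \<in> Q" using Q(3)[of "a +o N" "b +o N"] ops(1)[of a b] by simp
          ultimately show ?thesis
            unfolding K_def by (intro image_eqI[of _ _ "a + b"]) (auto simp: add M.V.subspace_add[OF sub])
        qed
        show "s' c u \<in> K" if "u \<in> K" for c u
        proof -
          from that obtain a where "a \<in> M" "a +o N \<in> Q" "u = \<phi> a" by (auto simp: K_def)
          moreover then have "s c a +o N \<in> Q" using Q(4)[of "a +o N" c] ops(2)[of a a c] by simp
          ultimately show ?thesis
            unfolding K_def by (intro image_eqI[of _ _ "s c a"]) (auto simp: scale M.V.subspace_scale[OF sub])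
        qed
      qed
      show "K \<subseteq> M'" using surj by (auto simp: K_def)
      show "act' x u \<in> K" if "x \<in> g" "u \<in> K" for x u
      proof -
        from that obtain a where "a \<in> M" "a +o N \<in> Q" "u = \<phi> a" by (auto simp: K_def)
        moreover then have "act x a +o N \<in> Q" using Q(5)[of x "a +o N"] ops(3)[of a a x] that by simp
        ultimately show ?thesis
          unfolding K_def by (intro image_eqI[of _ _ "act x a"]) (use that in \<open>auto simp: equi M.act_closed\<close>)
      qed
    qed
    then consider "K = {0}" | "K = M'" using simple by (auto simp: simple_module_def)
    then show "Q = {N} \<or> Q = quot M N"
    proof cases
      case 1
      have "C = N" if CQ: "C \<in> Q" for C
      proof -
        from that Q(1) obtain v where "v \<in> M" "C = v +o N" by (auto simp: quot_def)
        moreover then have "\<phi> v \<in> K" using CQ by (auto simp: K_def)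
        ultimately show ?thesis using 1 N_coset by auto
      qed
      then show ?thesis using Q(2) by blast
    next
      case 2
      have "v +o N \<in> Q" if v: "v \<in> M" for v
      proof -
        have "\<phi> v \<in> K" using 2 surj v by blast
        then obtain w where "w \<in> M" "w +o N \<in> Q" "\<phi> v = \<phi> w" by (auto simp: K_def)
        then show ?thesis using coset_eq[OF v, of w] by simp
      qed
      then show ?thesis using Q(1) by (auto simp: quot_def)
    qed
  qed
qed

section \<open>Hamiltonian vector fields\<close>

definition ham :: "A2 \<Rightarrow> vf" where "ham f = (pd2 f, - pd1 f)"

abbreviation H :: "nat \<Rightarrow> nat \<Rightarrow> vf" where "H a b \<equiv> ham (tmono (a, b))"

lemma ham_add: "ham (f + g) = ham f + ham g"
  by (simp add: ham_def pd_add)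

lemma cscale_minus: "cscale c (- p) = - cscale c p" for p :: A2
  by (simp add: cscale_eq_mult)

lemma ham_scale: "ham (cscale c f) = vf_scale c (ham f)"
  by (simp add: ham_def vf_scale_def pd_cscale cscale_minus)

lemma ham_in_Sbar2: "ham f \<in> Sbar2"
  by (auto simp: Sbar2_def ham_def pd_minus pd_commute intro!: exI[of _ 0])

lemma ham_bracket: "vf_bracket (ham f) (ham g) = ham (vf_apply (ham f) g)"
  by (simp add: vf_bracket_def ham_def vf_apply_def pd_add pd_minus pd_diff pd1_mult pd2_mult pd_commute algebra_simps)

lemma dd2_simps: "fst dd2 = 0" "snd dd2 = tmono (0, 1)"
  by (simp_all add: dd2_def cmono_def)

lemma pd_t2: "pd1 (tmono (0, Suc 0)) = 0" "pd2 (tmono (0, Suc 0)) = 1"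
  by (simp_all add: pd1_single pd2_single flip: zero_prod_def)

lemma dd2_bracket: "vf_bracket dd2 (ham g) = ham (vf_apply dd2 g - g)"
  by (simp add: vf_bracket_def ham_def vf_apply_def dd2_simps pd_add pd_minus pd_diff pd1_mult pd2_mult pd_commute
     pd_t2 algebra_simps)

lemma cscale_mult_left: "cscale c p * q = cscale c (p * q)" for p q :: A2
  by (simp add: cscale_eq_mult mult.assoc)

lemma single_eq_cscale: "Poly_Mapping.single k c = cscale c (tmono k)"
  by (rule poly_mapping_eqI) (simp add: lookup_single when_def)

lemma H_apply: "vf_apply (H a b) (tmono (c, d)) = cscale (of_nat (b * c) - of_nat (a * d)) (tmono (a + c - 1, b + d - 1))"
proof -
  have "vf_apply (H a b) (tmono (c, d)) = Poly_Mapping.single (a + (c - 1), b - 1 + d) (of_nat (b * c))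
      - Poly_Mapping.single (a - 1 + c, b + (d - 1)) (of_nat (a * d))"
    by (simp add: vf_apply_def ham_def pd1_single pd2_single mult_single)
  also have "Poly_Mapping.single (a + (c - 1), b - 1 + d) (of_nat (b * c) :: complex)
      = Poly_Mapping.single (a + c - 1, b + d - 1) (of_nat (b * c))" by (cases b; cases c) auto
  also have "Poly_Mapping.single (a - 1 + c, b + (d - 1)) (of_nat (a * d) :: complex)
      = Poly_Mapping.single (a + c - 1, b + d - 1) (of_nat (a * d))" by (cases a; cases d) auto
  finally show ?thesis by (simp add: single_eq_cscale[of _ "_ - _"] flip: single_diff)
qed

lemma H_bracket: "vf_bracket (H a b) (H c d) = vf_scale (of_nat (b * c) - of_nat (a * d)) (H (a + c - 1) (b + d - 1))"
  by (simp only: ham_bracket H_apply ham_scale)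

lemma dd2_H: "vf_bracket dd2 (H a b) = vf_scale (of_nat b - 1) (H a b)"
proof -
  have "vf_apply dd2 (tmono (a, b)) = Poly_Mapping.single (a, b) (of_nat b)"
    by (cases b) (simp_all add: vf_apply_def dd2_simps pd2_single mult_single)
  then have "vf_apply dd2 (tmono (a, b)) - tmono (a, b) = cscale (of_nat b - 1) (tmono (a, b))"
    by (simp add: single_eq_cscale[symmetric] single_diff)
  then show ?thesis by (simp only: dd2_bracket ham_scale)
qed

lemma H_values:
  "H 0 0 = 0" "H 0 1 = D1" "H 1 0 = vf_scale (-1) D2"
  "H 0 (Suc n) = vf_scale (of_nat (Suc n)) (tmono (0, n), 0)"
  "H (Suc n) 0 = vf_scale (- of_nat (Suc n)) (0, tmono (n, 0))"
  by (simp_all add: ham_def D1_def D2_def vf_scale_def pd1_single pd2_single zero_prod_def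
     single_eq_cscale[symmetric] single_uminus)
    (simp_all flip: zero_prod_def add: poly_mapping_eqI lookup_single when_def)

interpretation VF: vector_space vf_scale by (rule vector_space_vf)

lemma sum_single: "f = (\<Sum>k\<in>Poly_Mapping.keys f. cscale (Poly_Mapping.lookup f k) (tmono k))" for f :: A2
proof (rule poly_mapping_eqI)
  fix l
  have "Poly_Mapping.lookup (\<Sum>k\<in>Poly_Mapping.keys f. cscale (Poly_Mapping.lookup f k) (tmono k)) l
      = (\<Sum>k\<in>Poly_Mapping.keys f. if k = l then Poly_Mapping.lookup f k else 0)"
    by (simp add: lookup_sum lookup_single when_def if_distrib cong: if_cong)
  also have "\<dots> = Poly_Mapping.lookup f l" by (simp add: in_keys_iff)
  finally show "Poly_Mapping.lookup f l = Poly_Mapping.lookup (\<Sum>k\<in>Poly_Mapping.keys f. cscale (Poly_Mapping.lookup f k) (tmono k)) l" by simp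
qed

text \<open>
  After subtracting a multiple of \<open>d\<^sub>2\<close> a field is divergence free, and integrating its components shows that it is
  Hamiltonian.
\<close>

lemma Sbar2_spanned:
  assumes G: "VF.subspace G" and H: "\<And>a b. H a b \<in> G" and d: "dd2 \<in> G"
  shows "Sbar2 \<subseteq> G"
proof
  fix X assume "X \<in> Sbar2"
  then obtain c where c: "pd1 (fst X) + pd2 (snd X) = Poly_Mapping.single (0, 0) c" by (auto simp: Sbar2_def)
  have ham_0: "ham 0 = 0" by (simp add: ham_def zero_prod_def)
  have ham_G: "ham f \<in> G" for f
  proof -
    have "ham (\<Sum>k\<in>K. cscale (Poly_Mapping.lookup f k) (tmono k)) \<in> G" if "finite K" for K
      using that by (induction K)
        (auto simp: ham_0 VF.subspace_0[OF G] ham_add ham_scale H intro!: VF.subspace_add[OF G] VF.subspace_scale[OF G])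
    from this[of "Poly_Mapping.keys f"] show ?thesis using sum_single[of f] by simp
  qed
  have "\<exists>f. pd2 f = p" for p
  proof (induction p rule: pm_induct)
    case zero
    show ?case by (rule exI[of _ 0]) simp
  next
    case (single k c)
    show ?case by (cases k, rule exI[of _ "Poly_Mapping.single (fst k, Suc (snd k)) (c / of_nat (Suc (snd k)))"])
        (simp add: pd2_single del: of_nat_Suc)
  next
    case (add p q)
    then show ?case by (metis pd_add(2))
  qed
  then obtain f where f: "pd2 f = fst X" by blast
  define q where "q = snd X + pd1 f - cscale c (tmono (0, 1))"
  have "pd2 q = 0"
    using c f by (simp add: q_def pd_add pd_diff pd_cscale pd_t2 flip: pd_commute)
      (simp add: cscale_eq_mult pd_commute[symmetric] algebra_simps)
  then have q0: "Poly_Mapping.lookup q (a, Suc b) = 0" for a b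
    using lookup_pd2[of q a b] of_nat_neq_0[of b, where ?'a = complex] by (simp del: of_nat_Suc)
  have qG: "(0, Poly_Mapping.single k (Poly_Mapping.lookup q k)) \<in> G" if k: "k \<in> Poly_Mapping.keys q" for k
  proof -
    obtain a where a: "k = (a, 0)"
      using k q0 by (metis in_keys_iff not0_implies_Suc surj_pair)
    have "(0, Poly_Mapping.single k (Poly_Mapping.lookup q k)) =
        ham (Poly_Mapping.single (Suc a, 0) (- Poly_Mapping.lookup q k / of_nat (Suc a)))"
      by (simp add: a ham_def pd1_single pd2_single single_uminus[symmetric] del: of_nat_Suc)
    then show ?thesis using ham_G by simp
  qed
  have "(0, \<Sum>k\<in>K. Poly_Mapping.single k (Poly_Mapping.lookup q k)) \<in> G" if "finite K" "K \<subseteq> Poly_Mapping.keys q" for K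
    using that
  proof (induction K)
    case empty
    then show ?case using VF.subspace_0[OF G] by (simp add: zero_prod_def)
  next
    case (insert k K)
    then have "(0, Poly_Mapping.single k (Poly_Mapping.lookup q k)) + (0, \<Sum>k\<in>K. Poly_Mapping.single k (Poly_Mapping.lookup q k)) \<in> G"
      using qG by (intro VF.subspace_add[OF G]) auto
    then show ?case using insert by simp
  qed
  from this[of "Poly_Mapping.keys q"] have "(0, q) \<in> G"
    using sum_single[of q] by (simp add: single_eq_cscale[symmetric])
  moreover have "X = ham f + (0, q) + vf_scale c dd2"
    by (simp add: prod_eq_iff ham_def f q_def vf_scale_def dd2_simps cscale_eq_mult)
  ultimately show "X \<in> G" using ham_G d by (simp add: VF.subspace_add[OF G] VF.subspace_scale[OF G])
qed

text \<open>
  Brackets with \<open>t\<^sub>2\<^sup>3\<close> and \<open>t\<^sub>1\<^sup>3\<close> produce every Hamiltonian monomial of degree at least four from one of degree one less: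
  \<open>{t\<^sub>2\<^sup>3, t\<^sub>1\<^sup>a\<^sup>+\<^sup>1t\<^sub>2\<^sup>b\<^sup>-\<^sup>2}\<close> is a nonzero multiple of \<open>t\<^sub>1\<^sup>at\<^sub>2\<^sup>b\<close> if \<open>b \<ge> 2\<close>, and otherwise \<open>a \<ge> 2\<close>. The mixed monomials of degree two
  and three come from the pure ones in the same way.
\<close>

lemma Sbar2_generated:
  assumes G: "VF.subspace G" and br: "\<And>X Y. X \<in> G \<Longrightarrow> Y \<in> G \<Longrightarrow> vf_bracket X Y \<in> G"
    and d: "dd2 \<in> G" and g1: "\<And>n. n \<le> 2 \<Longrightarrow> (tmono (0, n), 0) \<in> G" and g2: "\<And>n. n \<le> 2 \<Longrightarrow> (0, tmono (n, 0)) \<in> G"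
  shows "Sbar2 \<subseteq> G"
proof (rule Sbar2_spanned[OF G _ d])
  have br': "H (a + c - 1) (b + d - 1) \<in> G" if "H a b \<in> G" "H c d \<in> G" "b * c \<noteq> a * d" for a b c d
  proof -
    define e where "e = of_nat (b * c) - (of_nat (a * d) :: complex)"
    have e: "e \<noteq> 0" using that(3) unfolding e_def by (metis eq_iff_diff_eq_0 of_nat_eq_iff)
    have "vf_scale (1 / e) (vf_bracket (H a b) (H c d)) \<in> G" using br that VF.subspace_scale[OF G] by blast
    then show ?thesis unfolding H_bracket e_def[symmetric] using e by simp
  qed
  have gen: "H 0 (Suc n) \<in> G" "H (Suc n) 0 \<in> G" if "n \<le> 2" for n
    using g1[OF that] g2[OF that] VF.subspace_scale[OF G] by (simp_all only: H_values(4,5))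
  show "H a b \<in> G" for a b
  proof (induction "a + b" arbitrary: a b rule: less_induct)
    case less
    have g: "H 0 3 \<in> G" "H 3 0 \<in> G" "H 0 2 \<in> G" "H 2 0 \<in> G" "H 0 1 \<in> G" "H 1 0 \<in> G"
      using gen[of 2] gen[of 1] gen[of 0] by (simp_all add: numeral_eq_Suc)
    consider "a + b \<ge> 4" | "a + b = 3" | "a + b = 2" | "a + b = 1" | "a + b = 0" by linarith
    then show ?case
    proof cases
      case 1
      show ?thesis
      proof (cases "b \<ge> 2")
        case True
        then have "H (a + 1) (b - 2) \<in> G" by (intro less) auto
        from br'[OF g(1) this] True show ?thesis by simp
      next
        case False
        with 1 have a: "a \<ge> 2" by simp
        then have "H (a - 2) (b + 1) \<in> G" by (intro less) auto
        from br'[OF g(2) this] a show ?thesis by simp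
      qed
    next
      case 2
      then consider "a = 0" "b = 3" | "a = 1" "b = 2" | "a = 2" "b = 1" | "a = 3" "b = 0" by linarith
      then show ?thesis using g br'[OF g(1) g(4)] br'[OF g(3) g(2)] by cases auto
    next
      case 3
      then consider "a = 0" "b = 2" | "a = 1" "b = 1" | "a = 2" "b = 0" by linarith
      then show ?thesis using g br'[OF g(3) g(4)] by cases auto
    next
      case 4
      then consider "a = 0" "b = 1" | "a = 1" "b = 0" by linarith
      then show ?thesis using g by cases auto
    next
      case 5
      then show ?thesis using VF.subspace_0[OF G] H_values(1) by simp
    qed
  qed
qed

section \<open>The surjection from a tensor module\<close>

context ham_quotient
begin

sublocale T: gl2_rep V rho unfolding gl2_rep_def by (rule gl2_module)

definition Psi :: "A2 \<Rightarrow> 'm \<Rightarrow> 'm" where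
  "Psi p m = (\<Sum>k\<in>Poly_Mapping.keys p. scale (Poly_Mapping.lookup p k) (psi m (fst k) (snd k)))"

lemma Psi_eq: "finite K \<Longrightarrow> Poly_Mapping.keys p \<subseteq> K \<Longrightarrow>
    Psi p m = (\<Sum>k\<in>K. scale (Poly_Mapping.lookup p k) (psi m (fst k) (snd k)))"
  unfolding Psi_def by (rule sum.mono_neutral_left) (auto simp: in_keys_iff)

lemma Psi_add: "Psi (p + q) m = Psi p m + Psi q m"
proof -
  let ?K = "Poly_Mapping.keys p \<union> Poly_Mapping.keys q"
  have "Poly_Mapping.keys (p + q) \<subseteq> ?K" by (rule Poly_Mapping.keys_add)
  then show ?thesis by (simp add: Psi_eq[of ?K] lookup_add scale_left_distrib sum.distrib)
qed

lemma Psi_cscale: "Psi (cscale c p) m = scale c (Psi p m)"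
proof -
  have "Poly_Mapping.keys (cscale c p) \<subseteq> Poly_Mapping.keys p" by (auto simp: in_keys_iff)
  then show ?thesis by (simp add: Psi_eq[of "Poly_Mapping.keys p"] scale_sum_right)
qed

lemma Psi_mono: "Psi (tmono (a, b)) m = psi m a b"
  by (simp add: Psi_def)

lemma endo_Psi: "endo scale (Psi p)"
  by (rule linI) (simp_all add: Psi_def psis scale_right_distrib sum.distrib scale_sum_right mult.commute)

lemma psi_mod_kernel: "\<kappa> m = \<kappa> m' \<Longrightarrow> psi m a b = psi m' a b"
  using psis(5)[of m m' a b] by (auto simp: kappa_eq psi_kernel_def)

text \<open>
  The map \<open>t\<^sub>1\<^sup>at\<^sub>2\<^sup>b \<otimes> v \<mapsto> psi (\<sigma> v) a b\<close>. It does not depend on the section \<open>\<sigma>\<close>, because \<open>psi\<close> factors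
  through the quotient by its kernel.
\<close>

definition tensor_evaluation :: "(((nat \<times> nat) \<Rightarrow>\<^sub>0 fvec) \<Rightarrow> 'm) \<Rightarrow> bool" where
  "tensor_evaluation \<pi> \<longleftrightarrow> (\<forall>P\<in>T_space V. \<forall>Q\<in>T_space V. \<pi> (P + Q) = \<pi> P + \<pi> Q) \<and>
      (\<forall>c. \<forall>P\<in>T_space V. \<pi> (T_scale c P) = scale c (\<pi> P)) \<and>
      (\<forall>p. \<forall>v\<in>V. \<pi> (p \<otimes>\<^sub>A v) = Psi p (\<sigma> v))"

lemma tensor_evaluation_exists: "\<exists>\<pi>. tensor_evaluation \<pi>"
proof -
  have "vector_space scale" by unfold_locales
  from tens_universal[OF subspace_V this, of "\<lambda>p v. Psi p (\<sigma> v)"] show ?thesis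
    unfolding tensor_evaluation_def
    by (simp add: Psi_add Psi_cscale lin_add[OF endo_Psi] lin_scale[OF endo_Psi] lin_add[OF sigma] lin_scale[OF sigma])
      blast
qed

lemma psi_sigma_rho: "v \<in> V \<Longrightarrow> psi (\<sigma> (rho A v)) a b = psi (gl2_op A (\<sigma> v)) a b"
  by (rule psi_mod_kernel) (metis kappa_sigma_V rho_V rho_kappa)

text \<open>
  The fields \<open>t\<^sub>2\<^sup>2\<partial>\<^sub>1\<close> and \<open>t\<^sub>1\<^sup>2\<partial>\<^sub>2\<close> are Hamiltonian fields of cubics, so they act as zero on \<open>V\<close>.
\<close>

lemma X2_sigma: "v \<in> V \<Longrightarrow> psi (X 2 (\<sigma> v)) a b = 0" "v \<in> V \<Longrightarrow> psi (X' 2 (\<sigma> v)) a b = 0"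
proof -
  assume v: "v \<in> V"
  then have h: "h i j (\<sigma> v) \<in> psi_kernel" if "i + j = 3" for i j
    using sigma_V U_facts(3) that by (auto simp: cubic_kernel_def)
  have "X 2 (\<sigma> v) \<in> psi_kernel"
    using h[of 0 3] by (simp add: X_def numeral_3_eq_3 numeral_2_eq_2 subspace_scale[OF subspace_kernel])
  then show "psi (X 2 (\<sigma> v)) a b = 0" by (simp add: psi_kernel_def)
  have "X' 2 (\<sigma> v) \<in> psi_kernel"
    using h[of 3 0] by (simp add: X'_def numeral_3_eq_3 numeral_2_eq_2 subspace_scale[OF subspace_kernel] subspace_neg[OF subspace_kernel])
  then show "psi (X' 2 (\<sigma> v)) a b = 0" by (simp add: psi_kernel_def)
qed

lemma tw_mono:
  "tw_apply (tmono (0, n), 0) (tmono (a, b)) = cscale (of_nat a) (tmono (a - 1, b + n)) + tmono (a, b + n)"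
  "tw_apply (0, tmono (n, 0)) (tmono (a, b)) = cscale (of_nat b) (tmono (a + n, b - 1)) + tmono (a + n, b)"
  "tw_apply dd2 (tmono (a, b)) = cscale (of_nat b) (tmono (a, b)) + tmono (a, b + 1)"
  by (simp_all add: tw_apply_def pd1_single pd2_single mult_single distrib_left add.commute single_eq_cscale[symmetric])
    (cases b; simp add: dd2_simps pd2_single mult_single distrib_left single_eq_cscale[symmetric])

text \<open>
  Both sides are linear, so the homomorphism property may be checked on monomial tensors.
\<close>

lemma intertwines_extend:
  assumes \<pi>: "tensor_evaluation \<pi>" and S: "endo scale S"
    and base: "\<And>a b v. v \<in> V \<Longrightarrow> \<pi> (T.T_form Z (tmono (a, b)) v) = S (psi (\<sigma> v) a b)"
    and Q: "Q \<in> T_space V"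
  shows "\<pi> (T.actT Z Q) = S (\<pi> Q)"
  using Q
proof (induction Q rule: T.T_induct)
  case zero
  have "\<pi> 0 = 0"
    using \<pi> T.T.subspace_0[OF T.subspace_T] unfolding tensor_evaluation_def
    by (metis T.T.scale_zero_left scale_zero_left)
  then show ?case by (simp add: T.actT_0 lin_0[OF S])
next
  case (tens k v)
  then show ?case using \<pi> base[OF tens, of "fst k" "snd k"]
    by (simp add: T.actT_tens tensor_evaluation_def Psi_mono[of "fst k" "snd k", simplified])
next
  case (add Q Q')
  then show ?case using \<pi>
    by (simp add: T.actT_add tensor_evaluation_def lin_add[OF S] T.actT_closed)
qed

lemma tensor_evaluation_T_form:
  assumes \<pi>: "tensor_evaluation \<pi>" and v: "v \<in> V"
  shows "\<pi> (T.T_form Z p v) = Psi (tw_apply Z p) (\<sigma> v) + Psi (pd1 (fst Z) * p) (\<sigma> (rho (matE 1 1) v))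
    + Psi (pd2 (fst Z) * p) (\<sigma> (rho (matE 2 1) v)) + Psi (pd1 (snd Z) * p) (\<sigma> (rho (matE 1 2) v))
    + Psi (pd2 (snd Z) * p) (\<sigma> (rho (matE 2 2) v))"
proof -
  have a: "\<pi> (P + Q) = \<pi> P + \<pi> Q" if "P \<in> T_space V" "Q \<in> T_space V" for P Q
    using \<pi> that by (auto simp: tensor_evaluation_def)
  have t: "\<pi> (p \<otimes>\<^sub>A v) = Psi p (\<sigma> v)" if "v \<in> V" for p v
    using \<pi> that by (auto simp: tensor_evaluation_def)
  show ?thesis
    unfolding T.T_form_def
    by (simp add: a t v rho_V T.tens_T T.T.subspace_add[OF T.subspace_T])
qed

lemma Psi_0 [simp]: "Psi 0 m = 0" by (simp add: Psi_def)

lemma intertwines_X: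
  assumes \<pi>: "tensor_evaluation \<pi>" and n: "n \<le> 2" and v: "v \<in> V"
  shows "\<pi> (T.T_form (tmono (0, n), 0) (tmono (a, b)) v) = X n (psi (\<sigma> v) a b)"
proof -
  have "\<pi> (T.T_form (tmono (0, n), 0) (tmono (a, b)) v) = scale (of_nat a) (psi (\<sigma> v) (a - 1) (b + n))
      + psi (\<sigma> v) a (b + n) + scale (of_nat n) (psi (X 1 (\<sigma> v)) a (b + (n - 1)))"
    unfolding tensor_evaluation_T_form[OF \<pi> v] tw_mono Psi_add Psi_cscale Psi_mono
    by (simp add: pd1_single pd2_single mult_single single_eq_cscale[of _ "of_nat n"] cscale_mult_left Psi_cscale Psi_mono
        psi_sigma_rho[OF v] gl2_op_matE add.commute)
  moreover have "n = 0 \<or> n = 1 \<or> n = 2" using n by auto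
  ultimately show ?thesis using psi_X0[of "\<sigma> v" a b] psi_X1[of "\<sigma> v" a b] psi_X2[of "\<sigma> v" a b] X2_sigma[OF v]
    by auto
qed

lemma intertwines_X':
  assumes \<pi>: "tensor_evaluation \<pi>" and n: "n \<le> 2" and v: "v \<in> V"
  shows "\<pi> (T.T_form (0, tmono (n, 0)) (tmono (a, b)) v) = X' n (psi (\<sigma> v) a b)"
proof -
  have "\<pi> (T.T_form (0, tmono (n, 0)) (tmono (a, b)) v) = scale (of_nat b) (psi (\<sigma> v) (a + n) (b - 1))
      + psi (\<sigma> v) (a + n) b + scale (of_nat n) (psi (X' 1 (\<sigma> v)) (a + (n - 1)) b)"
    unfolding tensor_evaluation_T_form[OF \<pi> v] tw_mono Psi_add Psi_cscale Psi_mono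
    by (simp add: pd1_single pd2_single mult_single single_eq_cscale[of _ "of_nat n"] cscale_mult_left Psi_cscale Psi_mono
        psi_sigma_rho[OF v] gl2_op_matE add.commute)
  moreover have "X' 0 (psi (\<sigma> v) a b) = scale (of_nat b) (psi (\<sigma> v) a (b - 1)) + psi (\<sigma> v) a b"
    using psi_h10[of "\<sigma> v" a b] by (simp add: X'_def)
  moreover have "n = 0 \<or> n = 1 \<or> n = 2" using n by auto
  ultimately show ?thesis using psi_X1'[of "\<sigma> v" a b] psi_X2'[of "\<sigma> v" a b] X2_sigma[OF v]
    by auto
qed

lemma intertwines_d2:
  assumes \<pi>: "tensor_evaluation \<pi>" and v: "v \<in> V"
  shows "\<pi> (T.T_form dd2 (tmono (a, b)) v) = d2 (psi (\<sigma> v) a b)"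
  unfolding tensor_evaluation_T_form[OF \<pi> v] tw_mono Psi_add Psi_cscale Psi_mono
  by (simp add: dd2_simps pd_t2 Psi_mono psi_sigma_rho[OF v] gl2_op_matE psis psi_d2 scale_left_diff_distrib)

end

theorem theorem4p8:
  fixes s :: "complex \<Rightarrow> 'm::ab_group_add \<Rightarrow> 'm"
    and actM :: "vf \<Rightarrow> 'm \<Rightarrow> 'm"
  assumes "Omega1 s UNIV actM"
    and "simple_module Sbar2 s UNIV actM"
  shows "\<exists>V rho actT N f.
    simple_fd_gl2_module V rho \<and>
    T_module V rho actT \<and>
    simple_quotient Sbar2 T_scale (T_space V) actT N \<and>
    quotient_iso Sbar2 T_scale (T_space V) actT N s UNIV actM f"
proof -
  have M: "lie_module vf_scale vf_bracket Sbar2 s UNIV actM" using assms(1) by (simp add: Omega1_def)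
  interpret M: lie_module vf_scale vf_bracket Sbar2 s UNIV actM by (rule M)
  have act_0: "actM 0 u = 0" for u
    using M.act_scale_left[of 0 u 0] VF.subspace_0[OF M.subspace_g] by simp
  have endo_act: "endo s (actM Z)" if "Z \<in> Sbar2" for Z
    by (rule linI) (use that in \<open>auto simp: M.act_add M.act_scale\<close>)
  have D: "D1 = H 0 1" "D2 = vf_scale (-1) (H 1 0)"
    using H_values(2,3) by simp_all
  have act_D: "actM D1 u = actM (H 0 1) u" "actM D2 u = - actM (H 1 0) u" for u
    unfolding D M.act_scale_left[OF ham_in_Sbar2 UNIV_I] by simp_all
  have nil: "\<exists>n. ((\<lambda>u. actM Z u - u) ^^ n) u = 0" if "Z = D1 \<or> Z = D2" for Z u
  proof -
    have "Z \<in> Delta2" unfolding Delta2_def using that VF.span_base by blast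
    moreover have "phi1 Z = 1" using that by (auto simp: phi1_def D1_def D2_def lookup_one when_def zero_prod_def)
    ultimately show ?thesis using assms(1) unfolding Omega1_def by fastforce
  qed
  have ham: "ham_module s (\<lambda>a b. actM (H a b)) (actM dd2)"
  proof (intro ham_module.intro cvs.intro ham_module_axioms.intro)
    show "vector_space s" by unfold_locales
    show "endo s (actM (H a b))" for a b by (rule endo_act[OF ham_in_Sbar2])
    show "endo s (actM dd2)" by (rule endo_act[OF dd2_in_Sbar2])
    show "actM (H 0 0) m = 0" for m by (simp add: H_values(1) act_0)
    show "actM (H a b) (actM (H c d) m) = actM (H c d) (actM (H a b) m)
      + s (of_nat (b * c) - of_nat (a * d)) (actM (H (a + c - 1) (b + d - 1)) m)" for a b c d m
      using M.act_bracket[OF ham_in_Sbar2 ham_in_Sbar2 UNIV_I, of "tmono (a, b)" "tmono (c, d)" m]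
      unfolding H_bracket M.act_scale_left[OF ham_in_Sbar2 UNIV_I] by (simp add: algebra_simps)
    show "actM dd2 (actM (H a b) m) = actM (H a b) (actM dd2 m) + s (of_nat b - 1) (actM (H a b) m)" for a b m
      using M.act_bracket[OF dd2_in_Sbar2 ham_in_Sbar2 UNIV_I, of "tmono (a, b)" m]
      unfolding dd2_H M.act_scale_left[OF ham_in_Sbar2 UNIV_I] by (simp add: algebra_simps)
    show "\<exists>n. ((\<lambda>u. actM (H 0 1) u - u) ^^ n) m = 0" for m
      using nil[of D1 m] unfolding act_D by blast
    show "\<exists>n. ((\<lambda>u. - actM (H 1 0) u - u) ^^ n) m = 0" for m
      using nil[of D2 m] unfolding act_D by blast
    have "Wh1 UNIV actM = {m. actM (H 0 1) m = m \<and> actM (H 1 0) m = - m}"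
      unfolding Wh1_def act_D by (auto simp: minus_equation_iff)
    then show "\<exists>B. finite B \<and> M.V.span B = {m. actM (H 0 1) m = m \<and> actM (H 1 0) m = - m}"
      using assms(1) by (auto simp: Omega1_def finite_dim_def)
  qed
  interpret h: ham_module s "\<lambda>a b. actM (H a b)" "actM dd2" by (rule ham)
  have ne: "(UNIV :: 'm set) \<noteq> {0}" using assms(2) by (simp add: simple_module_def)
  obtain S where S: "finite S" "M.V.span (h.psi_kernel \<union> S) = UNIV" using h.finite_codim_kernel by blast
  obtain \<kappa> :: "'m \<Rightarrow> fvec" and \<sigma> where ks: "lin s cscale \<kappa>" "lin cscale s \<sigma>" "\<forall>m. \<kappa> m = 0 \<longleftrightarrow> m \<in> h.psi_kernel"
    "\<forall>m. \<kappa> (\<sigma> (\<kappa> m)) = \<kappa> m" "finite_dim cscale (range \<kappa>)"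
    using h.quotient_coordinates[OF h.subspace_kernel S] by blast
  interpret c: ham_coordinates s "\<lambda>a b. actM (H a b)" "actM dd2" \<kappa> \<sigma>
    by unfold_locales (use ks in auto)
  obtain U where U: "h.stable_between U" "\<And>U'. h.stable_between U' \<Longrightarrow> U' \<subseteq> U \<Longrightarrow> U' = U"
    using c.minimal_stable[OF ne] by blast
  interpret q: ham_quotient s "\<lambda>a b. actM (H a b)" "actM dd2" \<kappa> \<sigma> U
    by unfold_locales (use U in auto)
  obtain \<pi> where \<pi>: "q.tensor_evaluation \<pi>" using q.tensor_evaluation_exists by blast
  have \<pi>_add: "\<pi> (P + Q) = \<pi> P + \<pi> Q" if "P \<in> T_space q.V" "Q \<in> T_space q.V" for P Q
    using \<pi> that by (simp add: q.tensor_evaluation_def)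
  have \<pi>_scale: "\<pi> (T_scale c P) = s c (\<pi> P)" if "P \<in> T_space q.V" for P c
    using \<pi> that by (simp add: q.tensor_evaluation_def)
  have \<pi>_tens: "\<pi> (p \<otimes>\<^sub>A v) = q.Psi p (\<sigma> v)" if "v \<in> q.V" for p v
    using \<pi> that by (simp add: q.tensor_evaluation_def)
  interpret T: lie_module vf_scale vf_bracket Sbar2 T_scale "T_space q.V" q.T.actT by (rule q.T.T_lie_module)
  \<comment> \<open>the fields intertwined by \<open>\<pi>\<close> form a subalgebra, so generators suffice\<close>
  define G where "G = {Z \<in> Sbar2. \<forall>P\<in>T_space q.V. \<pi> (q.T.actT Z P) = actM Z (\<pi> P)}"
  have "Sbar2 \<subseteq> G"
  proof (rule Sbar2_generated)
    show "VF.subspace G"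
    proof (rule VF.subspaceI)
      show "0 \<in> G"
        unfolding G_def using VF.subspace_0[OF M.subspace_g] T.act_scale_left[of 0 _ 0] \<pi>_scale[of _ 0]
        by (auto simp: act_0)
      show "X + Y \<in> G" if "X \<in> G" "Y \<in> G" for X Y
        using that VF.subspace_add[OF M.subspace_g] unfolding G_def
        by (auto simp: T.act_add_left M.act_add_left \<pi>_add T.act_closed)
      show "vf_scale c X \<in> G" if "X \<in> G" for c X
        using that VF.subspace_scale[OF M.subspace_g] unfolding G_def
        by (auto simp: T.act_scale_left M.act_scale_left \<pi>_scale T.act_closed)
    qed
    have \<pi>_diff: "\<pi> (P - Q) = \<pi> P - \<pi> Q" if "P \<in> T_space q.V" "Q \<in> T_space q.V" for P Q
      using \<pi>_add[of "P - Q" Q] that q.T.T.subspace_diff[OF T.subspace_M] by simp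
    show "vf_bracket X Y \<in> G" if "X \<in> G" "Y \<in> G" for X Y
      using that unfolding G_def
      by (auto simp: T.act_bracket M.act_bracket \<pi>_diff T.act_closed M.br_closed)
    show "dd2 \<in> G"
      unfolding G_def
      by (intro CollectI conjI ballI dd2_in_Sbar2
          q.intertwines_extend[OF \<pi> endo_act[OF dd2_in_Sbar2] q.intertwines_d2[OF \<pi>]])
    show "(tmono (0, n), 0) \<in> G" if n: "n \<le> 2" for n
    proof -
      have Z: "(tmono (0, n), 0) = vf_scale (1 / of_nat (Suc n)) (H 0 (Suc n))"
        using of_nat_neq_0[of n, where ?'a = complex] unfolding H_values(4) by (simp del: of_nat_Suc)
      have X: "actM (tmono (0, n), 0) = h.X n"
        unfolding Z by (rule ext) (simp only: h.X_def M.act_scale_left[OF ham_in_Sbar2 UNIV_I])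
      have "(tmono (0, n), 0) \<in> Sbar2" unfolding Z using VF.subspace_scale[OF M.subspace_g ham_in_Sbar2] .
      moreover have "\<pi> (q.T.actT (tmono (0, n), 0) P) = actM (tmono (0, n), 0) (\<pi> P)" if "P \<in> T_space q.V" for P
        unfolding X by (rule q.intertwines_extend[OF \<pi> h.endo_X q.intertwines_X[OF \<pi> n] that])
      ultimately show ?thesis unfolding G_def by simp
    qed
    show "(0, tmono (n, 0)) \<in> G" if n: "n \<le> 2" for n
    proof -
      have Z: "(0, tmono (n, 0)) = vf_scale (- (1 / of_nat (Suc n))) (H (Suc n) 0)"
        using of_nat_neq_0[of n, where ?'a = complex] unfolding H_values(5) by (simp del: of_nat_Suc)
      have X: "actM (0, tmono (n, 0)) = h.X' n"
        unfolding Z by (rule ext) (simp only: h.X'_def M.act_scale_left[OF ham_in_Sbar2 UNIV_I] M.V.scale_minus_left)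
      have "(0, tmono (n, 0)) \<in> Sbar2" unfolding Z using VF.subspace_scale[OF M.subspace_g ham_in_Sbar2] .
      moreover have "\<pi> (q.T.actT (0, tmono (n, 0)) P) = actM (0, tmono (n, 0)) (\<pi> P)" if "P \<in> T_space q.V" for P
        unfolding X by (rule q.intertwines_extend[OF \<pi> h.endo_X' q.intertwines_X'[OF \<pi> n] that])
      ultimately show ?thesis unfolding G_def by simp
    qed
  qed
  then have equi: "\<pi> (q.T.actT Z P) = actM Z (\<pi> P)" if "Z \<in> Sbar2" "P \<in> T_space q.V" for Z P
    using that by (auto simp: G_def)
  have surj: "\<pi> ` T_space q.V = UNIV"
  proof -
    have "submodule Sbar2 s UNIV actM (\<pi> ` T_space q.V)"
      unfolding submodule_def
    proof (intro conjI ballI)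
      show "M.V.subspace (\<pi> ` T_space q.V)"
      proof (rule M.V.subspaceI)
        show "0 \<in> \<pi> ` T_space q.V"
          using \<pi>_scale[of 0 0] q.T.T.subspace_0[OF T.subspace_M] by (force simp: image_iff)
        show "x + y \<in> \<pi> ` T_space q.V" if "x \<in> \<pi> ` T_space q.V" "y \<in> \<pi> ` T_space q.V" for x y
          using that q.T.T.subspace_add[OF T.subspace_M] by (auto simp flip: \<pi>_add)
        show "s c x \<in> \<pi> ` T_space q.V" if "x \<in> \<pi> ` T_space q.V" for c x
          using that q.T.T.subspace_scale[OF T.subspace_M] by (auto simp flip: \<pi>_scale)
      qed
      show "actM Z x \<in> \<pi> ` T_space q.V" if "Z \<in> Sbar2" "x \<in> \<pi> ` T_space q.V" for Z x
        using that(2) q.T.actT_closed[of _ Z] by (auto simp flip: equi[OF that(1)])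
    qed simp
    then have "\<pi> ` T_space q.V = {0} \<or> \<pi> ` T_space q.V = UNIV"
      using assms(2) unfolding simple_module_def by blast
    moreover obtain v where v: "v \<in> q.V" "v \<noteq> 0"
      using q.V_nonzero c.F.subspace_0[OF q.subspace_V] by blast
    then have "\<sigma> v \<notin> h.psi_kernel" using ks(3) q.kappa_sigma_V[OF v(1)] by metis
    then obtain a b where "h.psi (\<sigma> v) a b \<noteq> 0" by (auto simp: h.psi_kernel_def)
    then have "\<pi> (tmono (a, b) \<otimes>\<^sub>A v) \<noteq> 0" by (simp add: \<pi>_tens[OF v(1)] q.Psi_mono)
    then have "\<pi> ` T_space q.V \<noteq> {0}" using q.T.tens_T[OF v(1)] by blast
    ultimately show ?thesis by blast
  qed
  from simple_quotient_of_surjection[OF q.T.T_lie_module M \<pi>_add \<pi>_scale equi surj assms(2)]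
  show ?thesis using q.gl2_simple q.T.T_module_actT by blast
qed

end
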